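(* Let $\alpha\in S^1$ be an irrational rotation (i.e. $\alpha=e^{2\pi i\varphi}$ with $\varphi$ irrational), let $\mathcal{A}=S^1\times\{\mathsf{0},\mathsf{1}\}$ and let $\varrho\colon\mathcal{A}\to\mathcal{A}^+$ be the substitution $$\varrho\colon\quad (\theta,\mathsf{0})\mapsto(\theta,\mathsf{0})\,(-\theta,\mathsf{1}),\qquad (\theta,\mathsf{1})\mapsto(\theta\alpha,\mathsf{0})\,(\theta\alpha,\mathsf{1}).$$ Let $\mu$ be the unique shift-invariant probability measure on $X_\varrho$, and consider the decomposition $L^2(X_\varrho,\mu)=\bigoplus_{n\in\mathbb{Z}}H_{\chi_n}$, where $\chi_n(z)=z^n$. Let $\rho^{(n)}_{\max}$ denote the maximal spectral type of $H_{\chi_n}$ (with respect to the Koopman operator of the shift). Then: (i) if $n=0$, $\rho^{(n)}_{\max}$ is pure point; (ii) if $n\in2\mathbb{Z}+1$, $\rho^{(n)}_{\max}$ is Lebesgue measure; (iii) if $n\in2\mathbb{Z}\setminus\{0\}$, $\rho^{(n)}_{\max}$ is purely singular continuous.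
   Context: Subshift. Substitutions extend to words and bi-infinite sequences by concatenation (in $\varrho(w)$ the word $\varrho(w_0)$ begins at position $0$). $\mathcal{L}^n(\varrho)$ is the closure in $\mathcal{A}^n$ of the set of length-$n$ words that occur as subwords of some $\varrho^k(a)$, $a\in\mathcal{A}$, $k\ge1$. $X_\varrho=\{w\in\mathcal{A}^{\mathbb{Z}} : w_{[i,j]}\in\mathcal{L}^{j-i+1}(\varrho)\text{ for all } i\le j\}$ with left shift $\sigma(w)_n=w_{n+1}$; $(X_\varrho,\sigma)$ is uniquely ergodic. For $\mathsf{a}=(\theta,\mathsf{d})\in\mathcal{A}$ write $\pi_G(\mathsf{a})=\theta$ (the spin). Decomposition. $\varrho$ is recognisable, and $(X_\varrho,\sigma,\mu)$ is measure-theoretically isomorphic to a skew product over the dyadic odometer $(\mathbb{Z}_2,+1)$ with fibre $S^1$, with the product of Haar measures $\nu\times\mu_{\mathrm{H}}$; concretely via $x\mapsto(z(x),\pi_G(x_0))$, where $z(x)\in\mathbb{Z}_2$ is determined by: for each $k\ge1$, $x=\sigma^{j}(\varrho^k(y))$ for some $y\in X_\varrho$ with $0\le j<2^k$ and $j\equiv z(x)\bmod 2^k$. Under this isomorphism $H_{\chi}=L^2(\mathbb{Z}_2,\nu)\otimes\chi$, i.e. $H_\chi$ consists of the functions $x\mapsto h(z(x))\,\chi(\pi_G(x_0))$ with $h\in L^2(\mathbb{Z}_2,\nu)$. Each $H_\chi$ is invariant under the Koopman operator $Uf=f\circ\sigma$. Spectral type. For $f\in L^2(X_\varrho,\mu)$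 the spectral measure $\rho_f$ is the unique positive measure on $\mathbb{T}$ (identified with the unit circle) with $\langle f\mid U^nf\rangle=\int_{\mathbb{T}}z^n\,d\rho_f(z)$ for all $n\in\mathbb{Z}$. The maximal spectral type $\rho_{\max}^{H}$ of a $U$-invariant closed subspace $H$ is the maximal spectral type of $U|_H$: the measure (unique up to mutual absolute continuity, and realised as $\rho_g$ for some $g\in H$) such that $\rho_f\ll\rho^H_{\max}$ for all $f\in H$. Statements about $\rho_{\max}$ are understood up to equivalence of measures. *)

theory Defs
  imports "HOL-Probability.Probability" "HOL-Library.Sublist"
begin

section \<open>Substitutions on compact alphabets and their subshifts\<close>

definition subst_word :: "('a \<Rightarrow> 'a list) \<Rightarrow> 'a list \<Rightarrow> 'a list" where
  "subst_word s w = concat (map s w)"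

text \<open>A word of length \<open>n\<close> is encoded in \<open>A\<^sup>n\<close> as an extensional function on \<open>{..<n}\<close>.\<close>

definition word_fun :: "'a list \<Rightarrow> nat \<Rightarrow> 'a" where
  "word_fun w = (\<lambda>i\<in>{..<length w}. w ! i)"

definition language :: "('a::topological_space \<Rightarrow> 'a list) \<Rightarrow> 'a set \<Rightarrow> nat \<Rightarrow> (nat \<Rightarrow> 'a) set" where
  "language s A n =
     product_topology (\<lambda>_. top_of_set A) {..<n} closure_of
       {word_fun w | w. length w = n \<and>
          (\<exists>a\<in>A. \<exists>k\<ge>1. sublist w ((subst_word s ^^ k) [a]))}"

definition subshift :: "('a::topological_space \<Rightarrow> 'a list) \<Rightarrow> 'a set \<Rightarrow> (int \<Rightarrow> 'a) set" where
  "subshift s A = {w. (\<forall>i. w i \<in> A) \<and>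
     (\<forall>i j. i \<le> j \<longrightarrow>
        (\<lambda>m\<in>{..<nat (j - i + 1)}. w (i + int m)) \<in> language s A (nat (j - i + 1)))}"

text \<open>The integer powers \<open>\<sigma>\<^sup>n\<close> of the left shift.\<close>

definition shift_power :: "int \<Rightarrow> (int \<Rightarrow> 'a) \<Rightarrow> (int \<Rightarrow> 'a)" where
  "shift_power n w = (\<lambda>i. w (i + n))"

abbreviation shift :: "(int \<Rightarrow> 'a) \<Rightarrow> (int \<Rightarrow> 'a)" where
  "shift \<equiv> shift_power 1"

definition invariant_probability :: "(int \<Rightarrow> 'a::topological_space) set \<Rightarrow> (int \<Rightarrow> 'a) measure \<Rightarrow> bool" where
  "invariant_probability X M \<longleftrightarrow>
     prob_space M \<and> sets M = sets (restrict_space borel X) \<and> distr M M shift = M"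


section \<open>The substitution\<close>

text \<open>The markers 0 and 1 of the letters are encoded as \<open>False\<close> and \<open>True\<close>.\<close>

type_synonym letter = "complex \<times> bool"

abbreviation circle :: "complex set" where
  "circle \<equiv> sphere 0 1"

definition alphabet :: "letter set" where
  "alphabet = circle \<times> UNIV"

definition rho :: "complex \<Rightarrow> letter \<Rightarrow> letter list" where
  "rho \<alpha> = (\<lambda>(\<theta>, d).
     if d then [(\<theta> * \<alpha>, False), (\<theta> * \<alpha>, True)]
     else [(\<theta>, False), (- \<theta>, True)])"

definition spin :: "letter \<Rightarrow> complex" where
  "spin a = fst a"

text \<open>All images of letters have length 2, so the image of the letter at position \<open>m\<close> of a
  bi-infinite sequence occupies the positions \<open>2 * m\<close> and \<open>2 * m + 1\<close>.\<close>

definition rho_biinf :: "complex \<Rightarrow> (int \<Rightarrow> letter) \<Rightarrow> (int \<Rightarrow> letter)" where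
  "rho_biinf \<alpha> w = (\<lambda>i. rho \<alpha> (w (i div 2)) ! nat (i mod 2))"

definition X_rho :: "complex \<Rightarrow> (int \<Rightarrow> letter) set" where
  "X_rho \<alpha> = subshift (rho \<alpha>) alphabet"


section \<open>Dyadic integers\<close>

text \<open>The dyadic integers are the inverse limit of the rings of integers modulo \<open>2 ^ k\<close>:
  \<open>z k\<close> is the residue of \<open>z\<close> modulo \<open>2 ^ k\<close>.\<close>

definition dyadic :: "(nat \<Rightarrow> nat) set" where
  "dyadic = {z. (\<forall>k. z k < 2 ^ k) \<and> (\<forall>k. z (Suc k) mod 2 ^ k = z k)}"

definition dyadic_add :: "(nat \<Rightarrow> nat) \<Rightarrow> (nat \<Rightarrow> nat) \<Rightarrow> (nat \<Rightarrow> nat)" where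
  "dyadic_add a z = (\<lambda>k. (a k + z k) mod 2 ^ k)"

definition haar_dyadic :: "(nat \<Rightarrow> nat) measure \<Rightarrow> bool" where
  "haar_dyadic \<nu> \<longleftrightarrow>
     prob_space \<nu> \<and> sets \<nu> = sets (restrict_space borel dyadic) \<and>
     (\<forall>a\<in>dyadic. distr \<nu> \<nu> (dyadic_add a) = \<nu>)"

text \<open>The odometer coordinate \<open>z(x)\<close>. Since \<open>0 \<le> j < 2 ^ k\<close> and \<open>j\<close> is congruent to \<open>z(x)\<close>
  modulo \<open>2 ^ k\<close>, the shift \<open>j\<close> is the residue \<open>z k\<close>. Uniqueness of \<open>z\<close> for \<open>x \<in> X_rho \<alpha>\<close>
  is the recognisability of the substitution.\<close>

definition odometer_coord :: "complex \<Rightarrow> (int \<Rightarrow> letter) \<Rightarrow> (nat \<Rightarrow> nat)" where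
  "odometer_coord \<alpha> x = (THE z. z \<in> dyadic \<and>
     (\<forall>k\<ge>1. \<exists>y\<in>X_rho \<alpha>. x = shift_power (int (z k)) ((rho_biinf \<alpha> ^^ k) y)))"


section \<open>The spaces \<open>H\<close> of a character\<close>

text \<open>Elements of \<open>L\<^sup>2\<close> are represented by functions; conditions on them are stated up to
  almost everywhere equality.\<close>

definition L2 :: "'a measure \<Rightarrow> ('a \<Rightarrow> complex) set" where
  "L2 M = {f. f \<in> borel_measurable M \<and> integrable M (\<lambda>x. (cmod (f x))\<^sup>2)}"

definition L2_inner :: "'a measure \<Rightarrow> ('a \<Rightarrow> complex) \<Rightarrow> ('a \<Rightarrow> complex) \<Rightarrow> complex" where
  "L2_inner M f g = (\<integral>x. cnj (f x) * g x \<partial>M)"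

definition chi :: "int \<Rightarrow> complex \<Rightarrow> complex" where
  "chi n z = z powi n"

definition H_chi ::
  "complex \<Rightarrow> (int \<Rightarrow> letter) measure \<Rightarrow> (nat \<Rightarrow> nat) measure \<Rightarrow> int \<Rightarrow> ((int \<Rightarrow> letter) \<Rightarrow> complex) set" where
  "H_chi \<alpha> \<mu> \<nu> n = {f \<in> L2 \<mu>. \<exists>h\<in>L2 \<nu>.
     AE x in \<mu>. f x = h (odometer_coord \<alpha> x) * chi n (spin (x 0))}"


section \<open>Spectral measures\<close>

text \<open>\<open>U\<^sup>n f\<close> for integer \<open>n\<close>, where \<open>U f = f \<circ> \<sigma>\<close>.\<close>

definition koopman_power :: "int \<Rightarrow> ((int \<Rightarrow> 'a) \<Rightarrow> complex) \<Rightarrow> ((int \<Rightarrow> 'a) \<Rightarrow> complex)" where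
  "koopman_power n f = f \<circ> shift_power n"

definition circle_borel :: "complex measure" where
  "circle_borel = restrict_space borel circle"

definition is_spectral_measure ::
  "(int \<Rightarrow> 'a) measure \<Rightarrow> ((int \<Rightarrow> 'a) \<Rightarrow> complex) \<Rightarrow> complex measure \<Rightarrow> bool" where
  "is_spectral_measure M f \<rho> \<longleftrightarrow>
     finite_measure \<rho> \<and> sets \<rho> = sets circle_borel \<and>
     (\<forall>n::int. L2_inner M f (koopman_power n f) = (\<integral>z. z powi n \<partial>\<rho>))"

text \<open>Note the argument order of the library: \<open>absolutely_continuous \<rho> \<rho>'\<close> says \<open>\<rho>' \<lless> \<rho>\<close>.\<close>

definition equivalent_measures :: "'a measure \<Rightarrow> 'a measure \<Rightarrow> bool" where
  "equivalent_measures \<rho> \<rho>' \<longleftrightarrow>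
     sets \<rho> = sets \<rho>' \<and> absolutely_continuous \<rho> \<rho>' \<and> absolutely_continuous \<rho>' \<rho>"

text \<open>The maximal spectral type is only defined up to equivalence; this predicate holds for
  every finite measure in the equivalence class.\<close>

definition is_maximal_spectral_type ::
  "(int \<Rightarrow> 'a) measure \<Rightarrow> ((int \<Rightarrow> 'a) \<Rightarrow> complex) set \<Rightarrow> complex measure \<Rightarrow> bool" where
  "is_maximal_spectral_type M H \<rho> \<longleftrightarrow>
     finite_measure \<rho> \<and> sets \<rho> = sets circle_borel \<and>
     (\<exists>g\<in>H. \<exists>\<rho>g. is_spectral_measure M g \<rho>g \<and> equivalent_measures \<rho>g \<rho>) \<and>
     (\<forall>f\<in>H. \<forall>\<rho>f. is_spectral_measure M f \<rho>f \<longrightarrow> absolutely_continuous \<rho> \<rho>f)"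

definition circle_lebesgue :: "complex measure" where
  "circle_lebesgue =
     distr (restrict_space lborel {0..<1}) circle_borel (\<lambda>t::real. cis (2 * pi * t))"

definition pure_point :: "'a measure \<Rightarrow> bool" where
  "pure_point \<rho> \<longleftrightarrow>
     (\<exists>C. countable C \<and> C \<in> sets \<rho> \<and> emeasure \<rho> (space \<rho> - C) = 0)"

definition mutually_singular :: "'a measure \<Rightarrow> 'a measure \<Rightarrow> bool" where
  "mutually_singular \<rho> \<rho>' \<longleftrightarrow>
     (\<exists>N. N \<in> sets \<rho> \<and> N \<in> sets \<rho>' \<and> emeasure \<rho>' N = 0 \<and> emeasure \<rho> (space \<rho> - N) = 0)"

definition purely_singular_continuous :: "complex measure \<Rightarrow> bool" where
  "purely_singular_continuous \<rho> \<longleftrightarrow>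
     (\<forall>z\<in>space \<rho>. emeasure \<rho> {z} = 0) \<and> mutually_singular \<rho> circle_lebesgue"

end

theory Submission
  imports Defs
begin

text \<open>
  On \<open>H_chi\<close> the Koopman operator \<open>U\<close> is a rank one cocycle over the odometer, so everything can be read
  off from the vectors \<open>cyl K j\<close>, the character of the spin restricted to the points whose odometer
  coordinate is \<open>j\<close> modulo \<open>2\<^sup>K\<close>; they span a dense subspace. Put \<open>\<beta> = \<alpha>\<^sup>n\<close> and \<open>\<sigma> = (-1)\<^sup>n\<close>, and let \<open>a k\<close>
  and \<open>b k\<close> be \<open>cyl (k + 1)\<close> at \<open>0\<close> and at \<open>2\<^sup>k\<close>, i.e. the character at the first letter of the level \<open>k\<close>
  supertiles of the two types. The substitution gives \<open>a k = a (k+1) + b (k+1)\<close> and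
  \<open>b k = \<beta> U\<^sup>m (\<sigma> a (k+1) + b (k+1))\<close> with \<open>m = -2\<^sup>k\<close>.

  For \<open>n = 0\<close> the approximants are \<open>2\<^sup>K\<close>-periodic, so spectral measures live on dyadic roots of unity.
  For odd \<open>n\<close> this is a Rudin-Shapiro recursion: all correlations of \<open>a k\<close> and \<open>b k\<close> off time \<open>0\<close> vanish,
  so both have Lebesgue spectral measure, and absolute continuity passes to limits.
  For even \<open>n \<noteq> 0\<close> it becomes the Riesz product recursion \<open>a k = (1 + \<beta> U\<^sup>m) a (k+1)\<close> with
  \<open>m = -2\<^sup>k\<^sup>+\<^sup>1\<close>. As \<open>|1 + \<beta> v|/2\<close> and \<open>|1 + \<beta> v\<^sup>2|/2\<close> are never both close to \<open>1\<close>, the twisted ergodic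
  averages of \<open>a k\<close> tend uniformly to \<open>0\<close> and there are no atoms. The means of \<open>U\<close> to the powers
  \<open>1, 2, 4, \<dots>\<close> converge strongly to \<open>\<beta> / (2 - cnj \<beta>) \<noteq> 0\<close>, whereas the corresponding means of \<open>z, z\<^sup>2, z\<^sup>4, \<dots>\<close>
  tend to \<open>0\<close> in mean square for Lebesgue measure; hence the spectral measures are singular.
\<close>

section \<open>Finite words and the subshift\<close>

text \<open>A spectral measure is known only through its Fourier coefficients, so the spectral
  arguments rest on one isometry: the norm of \<open>q(U) f\<close> is the norm of \<open>q\<close>
  in the spectral measure of \<open>f\<close>, for Laurent polynomials \<open>q\<close>. The measure
  \<mu> is known only to be shift invariant; this already makes the residues modulo
  \<open>2 ^ K\<close> equidistributed. Letters of \<open>X_rho\<close> are limits of letters in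
  legal words, so desubstitution has to rest on a closed condition: the two spins of an image are
  equal or opposite. The sign \<sigma> decides the type. For \<sigma> = -1 the diagonal terms at
  time 0 cancel, as \<open>a k\<close> and \<open>b k\<close> have equal norms. For \<sigma> = 1 the
  vector \<open>b k\<close> is a shifted multiple of \<open>a k\<close>, so one sequence of vectors
  remains. Its normalised correlation at time \<open>2 ^ (k + 1)\<close> obeys
  \<open>c = (\<beta> + cnj \<beta> * c') / 2\<close>, with \<open>c'\<close> the value one level
  up; a bounded solution must be the fixed point \<open>\<beta> / (2 - cnj \<beta>)\<close> at every
  level. The deviations of the translates along powers of two from this multiple of
  \<open>a k\<close> are almost orthogonal and average out. Irrationality gives
  \<open>\<beta> \<noteq> 1\<close>; otherwise \<open>v = 1\<close> would make both factors of the
  Riesz product maximal.\<close>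

lemma subst_word_nth:
  assumes "\<And>a. length (s a) = 2" and "i < 2 * length v"
  shows "subst_word s v ! i = s (v ! (i div 2)) ! (i mod 2)"
  using assms(2)
proof (induction v arbitrary: i)
  case Nil
  then show ?case by simp
next
  case (Cons b v)
  show ?case
  proof (cases "i < 2")
    case True
    then have "i = 0 \<or> i = 1" by auto
    then show ?thesis by (auto simp: subst_word_def nth_append assms(1))
  next
    case False
    then obtain i' where i': "i = i' + 2" by (metis add.commute le_add_diff_inverse not_less)
    then show ?thesis
      using Cons.IH[of i'] Cons.prems by (auto simp: subst_word_def nth_append assms(1))
  qed
qed

lemma length_subst_word:
  assumes "\<And>a. length (s a) = 2"
  shows "length (subst_word s v) = 2 * length v"
  by (induction v) (auto simp: subst_word_def assms)

lemma length_subst_word_power: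
  assumes "\<And>a. length (s a) = 2"
  shows "length ((subst_word s ^^ k) v) = 2 ^ k * length v"
  by (induction k) (auto simp: length_subst_word assms)

lemma length_rho [simp]: "length (rho \<alpha> a) = 2"
  by (auto simp: rho_def split: prod.splits)

lemmas rho_word_length = length_subst_word_power[of "rho \<alpha>" for \<alpha>, OF length_rho]

text \<open>Markers are discrete, so nearby letters have equal markers and close spins; these are
  the basic neighbourhoods in the letter space.\<close>

definition letter_close :: "real \<Rightarrow> letter \<Rightarrow> letter \<Rightarrow> bool" where
  "letter_close \<epsilon> u v \<longleftrightarrow> dist (fst u) (fst v) < \<epsilon> \<and> snd u = snd v"

text \<open>The lower bound \<open>m\<close> on the level leaves room for desubstitution: removing
  one layer from a witness of level at least 2 leaves one of level at least 1.\<close>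

definition approximable :: "complex \<Rightarrow> nat \<Rightarrow> (nat \<Rightarrow> letter) \<Rightarrow> real \<Rightarrow> nat \<Rightarrow> bool" where
  "approximable \<alpha> L u \<epsilon> m \<longleftrightarrow> (\<exists>c\<in>alphabet. \<exists>k\<ge>m. \<exists>p. p + L \<le> 2 ^ k \<and>
     (\<forall>i<L. letter_close \<epsilon> ((subst_word (rho \<alpha>) ^^ k) [c] ! (p + i)) (u i)))"

lemma approximable_cong:
  assumes "\<And>i. i < L \<Longrightarrow> u i = v i"
  shows "approximable \<alpha> L u \<epsilon> m \<longleftrightarrow> approximable \<alpha> L v \<epsilon> m"
  unfolding approximable_def using assms by (auto cong: conj_cong)

lemma open_letter_close: "open {v. letter_close \<epsilon> v u}"
proof -
  have "{v. letter_close \<epsilon> v u} = ball (fst u) \<epsilon> \<times> {snd u}"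
    by (auto simp: letter_close_def dist_commute)
  moreover have "open (ball (fst u) \<epsilon> \<times> {snd u})"
    by (intro open_Times open_ball discrete_topology_class.open_discrete)
  ultimately show ?thesis by (simp only:)
qed

lemma rho_closed: "norm \<alpha> = 1 \<Longrightarrow> a \<in> alphabet \<Longrightarrow> set (rho \<alpha> a) \<subseteq> alphabet"
  by (auto simp: alphabet_def rho_def norm_mult split: prod.splits if_splits)

lemma rho_word_closed:
  assumes "norm \<alpha> = 1" "set v \<subseteq> alphabet"
  shows "set ((subst_word (rho \<alpha>) ^^ k) v) \<subseteq> alphabet"
proof (induction k)
  case (Suc k)
  then have "set (rho \<alpha> b) \<subseteq> alphabet" if "b \<in> set ((subst_word (rho \<alpha>) ^^ k) v)" for b
    using rho_closed[OF assms(1)] that by blast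
  moreover have "set (subst_word (rho \<alpha>) u) = (\<Union>b\<in>set u. set (rho \<alpha> b))" for u
    by (simp add: subst_word_def)
  ultimately show ?case by auto
qed (use assms in auto)

text \<open>The closure is taken in the product topology, so the box of \<epsilon>-neighbourhoods
  around \<open>u\<close> meets the legal words; the prefix in front of the subword found there
  gives the position \<open>p\<close>.\<close>

lemma language_approximable:
  assumes "u \<in> language (rho \<alpha>) alphabet L" "\<epsilon> > 0"
  shows "approximable \<alpha> L u \<epsilon> 1"
proof -
  let ?T = "PiE {..<L} (\<lambda>i. alphabet \<inter> {v. letter_close \<epsilon> v (u i)})"
  have "openin (product_topology (\<lambda>_. top_of_set alphabet) {..<L}) ?T"
    unfolding openin_PiE_gen by (auto intro: openin_open_Int open_letter_close)
  moreover have "u \<in> ?T"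
    using assms by (auto simp: language_def in_closure_of letter_close_def PiE_iff)
  ultimately obtain w a k where w: "word_fun w \<in> ?T" "length w = L" "a \<in> alphabet" "k \<ge> 1"
      "sublist w ((subst_word (rho \<alpha>) ^^ k) [a])"
    using assms(1) unfolding language_def in_closure_of by blast
  from w(5) obtain ps ss where ps: "(subst_word (rho \<alpha>) ^^ k) [a] = ps @ w @ ss"
    by (auto simp: sublist_def)
  have "length (ps @ w @ ss) = 2 ^ k" using rho_word_length[where v="[a]" and k=k and \<alpha>=\<alpha>] by (simp add: ps)
  then have len: "length ps + L \<le> 2 ^ k" using w(2) by simp
  have "letter_close \<epsilon> ((subst_word (rho \<alpha>) ^^ k) [a] ! (length ps + i)) (u i)" if "i < L" for i
    using w(1,2) that by (auto simp: ps nth_append word_fun_def PiE_iff)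
  with w len show ?thesis unfolding approximable_def by blast
qed

lemma approximable_language:
  assumes "norm \<alpha> = 1" "u \<in> PiE {..<L} (\<lambda>_. alphabet)" "\<And>\<epsilon>. \<epsilon> > 0 \<Longrightarrow> approximable \<alpha> L u \<epsilon> 1"
  shows "u \<in> language (rho \<alpha>) alphabet L"
  unfolding language_def in_closure_of
proof (intro conjI allI impI)
  show "u \<in> topspace (product_topology (\<lambda>_. top_of_set alphabet) {..<L})" using assms(2) by simp
  fix T assume T: "u \<in> T \<and> openin (product_topology (\<lambda>_. top_of_set alphabet) {..<L}) T"
  then obtain U where U: "\<And>i. i < L \<Longrightarrow> openin (top_of_set alphabet) (U i)"
     "u \<in> PiE {..<L} U" "PiE {..<L} U \<subseteq> T"
    unfolding openin_product_topology_alt by (metis (no_types, lifting) lessThan_iff)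
  have "\<exists>e>0. \<forall>v\<in>alphabet. letter_close e v (u i) \<longrightarrow> v \<in> U i" if i: "i < L" for i
  proof -
    obtain V where V: "open V" "U i = alphabet \<inter> V" using U(1)[OF i] by (auto simp: openin_open)
    then have "u i \<in> V" using U(2) i by (auto simp: PiE_iff)
    then obtain A B where AB: "open A" "open B" "u i \<in> A \<times> B" "A \<times> B \<subseteq> V"
      using V(1) unfolding open_prod_def by meson
    then obtain e where e: "e > 0" "ball (fst (u i)) e \<subseteq> A"
      by (metis mem_Times_iff open_contains_ball)
    have "v \<in> V" if "letter_close e v (u i)" for v
    proof -
      have "fst v \<in> A" "snd v \<in> B" using that e AB by (auto simp: letter_close_def dist_commute subset_eq mem_Times_iff)
      then show ?thesis using AB(4) by (metis mem_Times_iff subsetD)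
    qed
    then show ?thesis using e V by auto
  qed
  then obtain e where e: "\<And>i. i < L \<Longrightarrow> e i > (0::real)"
    "\<And>i v. i < L \<Longrightarrow> v \<in> alphabet \<Longrightarrow> letter_close (e i) v (u i) \<Longrightarrow> v \<in> U i"
    by metis
  \<comment> \<open>The additional 1 keeps the set nonempty when \<open>L = 0\<close>.\<close>
  define \<epsilon> where "\<epsilon> = Min (insert 1 (e ` {..<L}))"
  have "\<epsilon> > 0" unfolding \<epsilon>_def using e by (subst Min_gr_iff) auto
  have \<epsilon>_le: "\<epsilon> \<le> e i" if "i < L" for i unfolding \<epsilon>_def using that by (intro Min_le) auto
  from assms(3)[OF \<open>\<epsilon> > 0\<close>] obtain c k p where cp: "c \<in> alphabet" "k \<ge> 1" "p + L \<le> 2 ^ k"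
     "\<And>i. i < L \<Longrightarrow> letter_close \<epsilon> ((subst_word (rho \<alpha>) ^^ k) [c] ! (p + i)) (u i)"
    unfolding approximable_def by blast
  let ?W = "(subst_word (rho \<alpha>) ^^ k) [c]"
  define w where "w = take L (drop p ?W)"
  have lenW: "length ?W = 2 ^ k" using rho_word_length[where v="[c]" and k=k and \<alpha>=\<alpha>] by simp
  then have len: "length w = L" using cp(3) by (simp add: w_def)
  have "sublist w ?W" unfolding w_def by (meson sublist_drop sublist_order.order_trans sublist_take)
  moreover have "word_fun w \<in> PiE {..<L} U"
  proof (rule PiE_I)
    fix i assume "i \<in> {..<L}"
    then have i: "i < L" by simp
    have eq: "word_fun w i = ?W ! (p + i)" using i len cp(3) lenW by (simp add: word_fun_def w_def)
    have "?W ! (p + i) \<in> alphabet"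
    proof -
      have "p + i < length ?W" using cp(3) lenW i by simp
      then have "?W ! (p + i) \<in> set ?W" by (rule nth_mem)
      then show ?thesis using rho_word_closed[OF assms(1), of "[c]" k] cp(1) by auto
    qed
    moreover have "letter_close (e i) (?W ! (p + i)) (u i)"
      using cp(4)[OF i] \<epsilon>_le[OF i] by (auto simp: letter_close_def)
    ultimately show "word_fun w i \<in> U i" using e(2)[OF i] eq by simp
  qed (use len in \<open>auto simp: word_fun_def\<close>)
  ultimately show "\<exists>y. y \<in> {word_fun w |w. length w = L \<and> (\<exists>a\<in>alphabet. \<exists>k\<ge>1. sublist w ((subst_word (rho \<alpha>) ^^ k) [a]))} \<and> y \<in> T"
    using len cp(1,2) U(3) by blast
qed

lemma X_rho_alphabet: "x \<in> X_rho \<alpha> \<Longrightarrow> x i \<in> alphabet"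
  by (simp add: X_rho_def subshift_def)

lemma X_rho_approximable:
  assumes "x \<in> X_rho \<alpha>" "\<epsilon> > 0"
  shows "approximable \<alpha> L (\<lambda>i. x (a + int i)) \<epsilon> 2"
proof -
  \<comment> \<open>Three extra letters make the window longer than the image of a single letter,
    which excludes level 1.\<close>
  define N where "N = L + 3"
  have "(\<lambda>m\<in>{..<N}. x (a + int m)) \<in> language (rho \<alpha>) alphabet N"
  proof -
    have "a \<le> a + int L + 2" by simp
    then have "(\<lambda>m\<in>{..<nat (a + int L + 2 - a + 1)}. x (a + int m)) \<in> language (rho \<alpha>) alphabet (nat (a + int L + 2 - a + 1))"
      using assms(1) unfolding X_rho_def subshift_def by blast
    moreover have "nat (a + int L + 2 - a + 1) = N" by (simp add: N_def)
    ultimately show ?thesis by simp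
  qed
  from language_approximable[OF this assms(2)] obtain c k p where
    c: "c \<in> alphabet" "k \<ge> 1" "p + N \<le> 2 ^ k"
     "\<And>i. i < N \<Longrightarrow> letter_close \<epsilon> ((subst_word (rho \<alpha>) ^^ k) [c] ! (p + i)) (x (a + int i))"
    unfolding approximable_def by auto
  have "k \<noteq> 1" using c(3) by (auto simp: N_def)
  then have "k \<ge> 2" using c(2) by simp
  then show ?thesis unfolding approximable_def
    by (intro bexI[of _ c] exI[of _ k] exI[of _ p] conjI allI impI c) (use c in \<open>auto simp: N_def\<close>)
qed

lemma X_rhoI:
  assumes "norm \<alpha> = 1" "\<And>i. x i \<in> alphabet"
    and "\<And>\<epsilon> a L. \<epsilon> > 0 \<Longrightarrow> approximable \<alpha> L (\<lambda>i. x (a + int i)) \<epsilon> 1"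
  shows "x \<in> X_rho \<alpha>"
  unfolding X_rho_def subshift_def
proof (intro CollectI conjI allI impI)
  fix i j :: int
  show "(\<lambda>m\<in>{..<nat (j - i + 1)}. x (i + int m)) \<in> language (rho \<alpha>) alphabet (nat (j - i + 1))"
  proof (rule approximable_language[OF assms(1)])
    fix \<epsilon> :: real assume "\<epsilon> > 0"
    from assms(3)[OF this, of "nat (j - i + 1)" i]
    show "approximable \<alpha> (nat (j - i + 1)) (\<lambda>m\<in>{..<nat (j - i + 1)}. x (i + int m)) \<epsilon> 1"
      by (rule approximable_cong[THEN iffD1, rotated]) simp
  qed (use assms(2) in auto)
qed (rule assms(2))

lemma shift_power_X_rho:
  assumes "x \<in> X_rho \<alpha>" shows "shift_power n x \<in> X_rho \<alpha>"
  unfolding X_rho_def subshift_def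
proof (intro CollectI conjI allI impI)
  fix i j :: int assume "i \<le> j"
  then have "i + n \<le> j + n" by simp
  with assms have "(\<lambda>m\<in>{..<nat ((j + n) - (i + n) + 1)}. x ((i + n) + int m)) \<in>
      language (rho \<alpha>) alphabet (nat ((j + n) - (i + n) + 1))"
    unfolding X_rho_def subshift_def mem_Collect_eq by metis
  moreover have "(j + n) - (i + n) + 1 = j - i + 1" "\<And>m. (i + n) + int m = i + int m + n" by simp_all
  ultimately show "(\<lambda>m\<in>{..<nat (j - i + 1)}. shift_power n x (i + int m)) \<in> language (rho \<alpha>) alphabet (nat (j - i + 1))"
    unfolding shift_power_def by (simp only:)
next
  fix i show "shift_power n x i \<in> alphabet"
    using X_rho_alphabet[OF assms] by (simp add: shift_power_def)
qed


section \<open>Desubstitution\<close>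

text \<open>Peeling off the outermost substitution exhibits a window of \<open>x\<close> as nearly a
  piece of the image of \<open>v\<close>, where \<open>v\<close> is again legal of level at least 1.
  Desubstitution reads \<open>v\<close> off from this.\<close>

lemma X_rho_window:
  assumes "x \<in> X_rho \<alpha>" "\<epsilon> > 0" "norm \<alpha> = 1"
  obtains k p v where "k \<ge> 1" "p + L \<le> 2 * 2 ^ k" "length v = 2 ^ k" "set v \<subseteq> alphabet"
    "\<exists>c\<in>alphabet. v = (subst_word (rho \<alpha>) ^^ k) [c]"
    "\<And>i. i < L \<Longrightarrow> letter_close \<epsilon> (rho \<alpha> (v ! ((p + i) div 2)) ! ((p + i) mod 2)) (x (a + int i))"
proof -
  obtain c k p where c: "c \<in> alphabet" "k \<ge> 2" "p + L \<le> 2 ^ k"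
     "\<And>i. i < L \<Longrightarrow> letter_close \<epsilon> ((subst_word (rho \<alpha>) ^^ k) [c] ! (p + i)) (x (a + int i))"
    using X_rho_approximable[OF assms(1,2), of L a] unfolding approximable_def by blast
  obtain k' where k': "k = Suc k'" "k' \<ge> 1" using c(2) by (cases k) auto
  define v where "v = (subst_word (rho \<alpha>) ^^ k') [c]"
  have len: "length v = 2 ^ k'" by (simp add: v_def rho_word_length)
  have set: "set v \<subseteq> alphabet" unfolding v_def using c(1) by (intro rho_word_closed assms) auto
  have eq: "(subst_word (rho \<alpha>) ^^ k) [c] ! (p + i) = rho \<alpha> (v ! ((p + i) div 2)) ! ((p + i) mod 2)" if "i < L" for i
  proof -
    have "p + i < 2 * length v" using that c(3) by (simp add: len k')
    then show ?thesis using subst_word_nth[of "rho \<alpha>" "p + i" v] by (simp add: k' v_def)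
  qed
  show ?thesis
    by (rule that[of k' p v]) (use k' c len set eq in \<open>auto simp: v_def\<close>)
qed

lemma rho_nth: "rho \<alpha> (\<theta>, d) ! 0 = (if d then \<theta> * \<alpha> else \<theta>, False)"
  "rho \<alpha> (\<theta>, d) ! Suc 0 = (if d then \<theta> * \<alpha> else - \<theta>, True)"
  by (auto simp: rho_def)

lemma snd_rho_nth: "j < 2 \<Longrightarrow> snd (rho \<alpha> a ! j) \<longleftrightarrow> j = 1"
  by (cases a) (auto simp: rho_def less_2_cases_iff)

text \<open>Closeness fixes markers exactly, and inside an image the marker is the parity of the
  position. The tolerance 1 is arbitrary, as spins play no part.\<close>

lemma X_rho_marker_Suc:
  assumes "x \<in> X_rho \<alpha>" "norm \<alpha> = 1"
  shows "snd (x (i + 1)) \<longleftrightarrow> \<not> snd (x i)"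
proof -
  obtain k p v where "\<And>j. j < 2 \<Longrightarrow> letter_close 1 (rho \<alpha> (v ! ((p + j) div 2)) ! ((p + j) mod 2)) (x (i + int j))"
    using X_rho_window[OF assms(1) _ assms(2), of 1 2 i] by (metis zero_less_one)
  from this[of 0] this[of 1] show ?thesis
    by (auto simp: letter_close_def snd_rho_nth mod_Suc)
qed

lemma X_rho_marker:
  assumes "x \<in> X_rho \<alpha>" "norm \<alpha> = 1"
  shows "snd (x i) \<longleftrightarrow> (snd (x 0) \<longleftrightarrow> even i)"
proof (induction i rule: int_induct[where k=0])
  case (step1 i)
  then show ?case using X_rho_marker_Suc[OF assms, of i] by auto
next
  case (step2 i)
  then show ?case using X_rho_marker_Suc[OF assms, of "i - 1"] by auto
qed auto

text \<open>The marker at the origin tells whether the origin is the first or the second place of an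
  image; this is the lowest binary digit of the odometer coordinate.\<close>

definition phase :: "(int \<Rightarrow> letter) \<Rightarrow> nat" where
  "phase x = of_bool (snd (x 0))"

text \<open>The two letters of an image have opposite spins for the marker 0 and equal spins for the marker 1.\<close>

definition desub_letter :: "complex \<Rightarrow> complex \<Rightarrow> complex \<Rightarrow> letter" where
  "desub_letter \<alpha> p q = (if q = - p then (p, False) else (p / \<alpha>, True))"

definition desub :: "complex \<Rightarrow> (int \<Rightarrow> letter) \<Rightarrow> (int \<Rightarrow> letter)" where
  "desub \<alpha> x = (\<lambda>m. desub_letter \<alpha> (fst (x (2 * m - int (phase x)))) (fst (x (2 * m - int (phase x) + 1))))"

lemma X_rho_marker_phase:
  assumes "x \<in> X_rho \<alpha>" "norm \<alpha> = 1"
  shows "snd (x (2 * m - int (phase x))) = False" "snd (x (2 * m - int (phase x) + 1)) = True"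
  using X_rho_marker[OF assms, of "2 * m - int (phase x)"] X_rho_marker[OF assms, of "2 * m - int (phase x) + 1"]
  by (auto simp: phase_def)

text \<open>The approximating pairs are exactly of the form \<open>(t, t)\<close> or
  \<open>(t, - t)\<close>, and having equal or opposite entries is a closed condition, so limits
  inherit it.\<close>

lemma X_rho_pair:
  assumes "x \<in> X_rho \<alpha>" "norm \<alpha> = 1" "\<not> snd (x i)"
  shows "fst (x (i + 1)) = fst (x i) \<or> fst (x (i + 1)) = - fst (x i)"
proof (rule ccontr)
  let ?p = "fst (x i)" and ?q = "fst (x (i + 1))"
  assume neg: "\<not> ?thesis"
  \<comment> \<open>Half the smaller distance from \<open>?q\<close> to \<open>?p\<close> and
    \<open>- ?p\<close>: an approximating pair within this tolerance would bring \<open>?q\<close>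
    closer to one of them than it is.\<close>
  define \<epsilon> where "\<epsilon> = min (norm (?q - ?p)) (norm (?q + ?p)) / 2"
  have "\<epsilon> > 0" using neg by (auto simp: \<epsilon>_def add_eq_0_iff2)
  then obtain k p v where w: "\<And>j. j < 2 \<Longrightarrow> letter_close \<epsilon> (rho \<alpha> (v ! ((p + j) div 2)) ! ((p + j) mod 2)) (x (i + int j))"
    using X_rho_window[OF assms(1) _ assms(2), of \<epsilon> 2 i] by metis
  have "even p" using w[of 0] assms(3) by (auto simp: letter_close_def snd_rho_nth)
  then have "(p + 1) div 2 = p div 2" "p mod 2 = 0" "(p + 1) mod 2 = 1" by presburger+
  moreover obtain \<theta> d where "v ! (p div 2) = (\<theta>, d)" by force
  ultimately have "dist (if d then \<theta> * \<alpha> else \<theta>) ?p < \<epsilon>" "dist (if d then \<theta> * \<alpha> else - \<theta>) ?q < \<epsilon>"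
    using w[of 0] w[of 1] by (auto simp: letter_close_def rho_nth)
  then obtain t where t: "norm (t - ?p) < \<epsilon>" "norm (t - ?q) < \<epsilon> \<or> norm (- t - ?q) < \<epsilon>"
    by (auto simp: dist_norm split: if_splits)
  from t(2) have "norm (?q - ?p) < 2 * \<epsilon> \<or> norm (?q + ?p) < 2 * \<epsilon>"
  proof
    assume "norm (t - ?q) < \<epsilon>"
    moreover have "norm (?q - ?p) = norm ((t - ?p) - (t - ?q))" by simp
    ultimately show ?thesis using t(1) norm_triangle_ineq4[of "t - ?p" "t - ?q"] by linarith
  next
    assume "norm (- t - ?q) < \<epsilon>"
    moreover have "norm (?q + ?p) = norm ((t - ?p) + (- t - ?q))"
    proof -
      have "?q + ?p = - ((t - ?p) + (- t - ?q))" by simp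
      then show ?thesis by (simp only: norm_minus_cancel)
    qed
    ultimately show ?thesis using t(1) norm_triangle_ineq[of "t - ?p" "- t - ?q"] by linarith
  qed
  then show False unfolding \<epsilon>_def by linarith
qed

lemma rho_biinf_desub:
  assumes "x \<in> X_rho \<alpha>" "norm \<alpha> = 1"
  shows "x = shift_power (int (phase x)) (rho_biinf \<alpha> (desub \<alpha> x))"
proof
  fix i
  define m where "m = (i + int (phase x)) div 2"
  let ?u = "x (2 * m - int (phase x))" and ?v = "x (2 * m - int (phase x) + 1)"
  have "\<alpha> \<noteq> 0" using assms(2) by auto
  have mk: "snd ?u = False" "snd ?v = True" using X_rho_marker_phase[OF assms] by blast+
  have "fst ?u \<noteq> 0" using X_rho_alphabet[OF assms(1), of "2 * m - int (phase x)"] by (auto simp: alphabet_def)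
  have pair: "fst ?v = fst ?u \<or> fst ?v = - fst ?u" using X_rho_pair[OF assms] mk by blast
  have r: "rho \<alpha> (desub \<alpha> x m) = [?u, ?v]"
    using pair mk \<open>\<alpha> \<noteq> 0\<close> \<open>fst ?u \<noteq> 0\<close>
    by (cases "?u"; cases "?v") (auto simp: desub_def desub_letter_def rho_def)
  consider "i + int (phase x) = 2 * m" | "i + int (phase x) = 2 * m + 1" unfolding m_def by linarith
  then show "x i = shift_power (int (phase x)) (rho_biinf \<alpha> (desub \<alpha> x)) i"
  proof cases
    case 1
    then have e: "2 * m - int (phase x) = i" by simp
    show ?thesis using r 1 unfolding e by (simp add: shift_power_def rho_biinf_def)
  next
    case 2
    then have e: "2 * m - int (phase x) + 1 = i" by simp
    have "(2 * m + 1) div 2 = m" "(2 * m + 1) mod 2 = 1" by simp_all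
    then show ?thesis using r 2 unfolding e by (simp add: shift_power_def rho_biinf_def)
  qed
qed

text \<open>The word \<open>v\<close> behind a window of \<open>x\<close> approximates the
  desubstituted sequence. Spins transfer isometrically; the markers need care, because they are
  decided by the exact spin relation in \<open>x\<close> and not by the one in its
  approximant.\<close>

lemma desub_X_rho:
  assumes "x \<in> X_rho \<alpha>" "norm \<alpha> = 1"
  shows "desub \<alpha> x \<in> X_rho \<alpha>"
proof (rule X_rhoI[OF assms(2)])
  have n1: "norm (fst (x i)) = 1" for i
    using X_rho_alphabet[OF assms(1), of i] by (auto simp: alphabet_def)
  have "\<alpha> \<noteq> 0" using assms(2) by auto
  show "desub \<alpha> x i \<in> alphabet" for i
    using n1 assms(2) by (auto simp: desub_def desub_letter_def alphabet_def norm_divide)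
  fix \<epsilon> :: real and a :: int and L :: nat assume "\<epsilon> > 0"
  \<comment> \<open>A tolerance of at most 1/2 keeps equal and opposite pairs apart: confusing them
    would give \<open>norm (2 * t) < 1\<close> for a unit spin \<open>t\<close>.\<close>
  define \<delta> where "\<delta> = min \<epsilon> (1 / 2)"
  have "\<delta> > 0" using \<open>\<epsilon> > 0\<close> by (simp add: \<delta>_def)
  define b where "b = 2 * a - int (phase x)"
  \<comment> \<open>The two extra letters keep the window nonempty for \<open>L = 0\<close>, since
    the parity of \<open>p\<close> is read at its first letter.\<close>
  obtain k p v where w: "k \<ge> 1" "p + (2 * L + 2) \<le> 2 * 2 ^ k" "length v = 2 ^ k" "set v \<subseteq> alphabet"
    "\<exists>c\<in>alphabet. v = (subst_word (rho \<alpha>) ^^ k) [c]"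
    "\<And>i. i < 2 * L + 2 \<Longrightarrow> letter_close \<delta> (rho \<alpha> (v ! ((p + i) div 2)) ! ((p + i) mod 2)) (x (b + int i))"
    using X_rho_window[OF assms(1) \<open>\<delta> > 0\<close> assms(2), of "2 * L + 2" b] by metis
  have "even p" using w(6)[of 0] X_rho_marker_phase(1)[OF assms, of a]
    by (auto simp: letter_close_def snd_rho_nth b_def)
  then obtain p' where p': "p = 2 * p'" by blast
  have "letter_close \<epsilon> (v ! (p' + i)) (desub \<alpha> x (a + int i))" if i: "i < L" for i
  proof -
    let ?p = "fst (x (b + 2 * int i))" and ?q = "fst (x (b + 2 * int i + 1))"
    obtain \<theta> d where v: "v ! (p' + i) = (\<theta>, d)" by force
    have "p' + i < length v" using w(2,3) i p' by simp
    then have "(\<theta>, d) \<in> alphabet" using w(4) v nth_mem by (metis subsetD)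
    then have n\<theta>: "norm \<theta> = 1" by (auto simp: alphabet_def)
    have e: "(p + 2 * i) div 2 = p' + i" "(p + 2 * i) mod 2 = 0" "(p + (2 * i + 1)) div 2 = p' + i" "(p + (2 * i + 1)) mod 2 = 1"
      unfolding p' by presburger+
    have c: "dist (if d then \<theta> * \<alpha> else \<theta>) ?p < \<delta>" "dist (if d then \<theta> * \<alpha> else - \<theta>) ?q < \<delta>"
    proof -
      have "int (2 * i) = 2 * int i" "int (2 * i + 1) = 2 * int i + 1" "2 * i < 2 * L + 2" "2 * i + 1 < 2 * L + 2"
        using i by simp_all
      then have "letter_close \<delta> (rho \<alpha> (\<theta>, d) ! 0) (x (b + 2 * int i))"
        "letter_close \<delta> (rho \<alpha> (\<theta>, d) ! 1) (x (b + 2 * int i + 1))"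
        using w(6)[of "2 * i"] w(6)[of "2 * i + 1"] unfolding e v by (simp_all add: ac_simps)
      then show "dist (if d then \<theta> * \<alpha> else \<theta>) ?p < \<delta>" "dist (if d then \<theta> * \<alpha> else - \<theta>) ?q < \<delta>"
        by (simp_all add: letter_close_def rho_nth)
    qed
    have D: "desub \<alpha> x (a + int i) = desub_letter \<alpha> ?p ?q"
      by (simp add: desub_def b_def algebra_simps)
    have pair: "?q = ?p \<or> ?q = - ?p"
      using X_rho_pair[OF assms, of "b + 2 * int i"] X_rho_marker_phase(1)[OF assms, of "a + int i"]
      by (simp add: b_def algebra_simps)
    have two: "norm (2 * t) = 2" if "norm t = 1" for t :: complex using that by (simp add: norm_mult)
    show ?thesis
    proof (cases d)
      case False
      have "?q = - ?p"
      proof (rule ccontr)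
        assume "?q \<noteq> - ?p"
        then have "?q = ?p" using pair by blast
        then have "norm (\<theta> - ?p) < 1/2" "norm (- (\<theta> + ?p)) < 1/2"
          using c False unfolding \<delta>_def by (auto simp: dist_norm)
        then have "norm (\<theta> - ?p) < 1/2" "norm (\<theta> + ?p) < 1/2" by (simp_all only: norm_minus_cancel)
        then have "norm ((\<theta> - ?p) + (\<theta> + ?p)) < 1" by (smt (verit) norm_triangle_ineq field_sum_of_halves)
        then have "norm (2 * \<theta>) < 1" by (simp add: algebra_simps mult_2)
        then show False using two[OF n\<theta>] by simp
      qed
      then show ?thesis using c False unfolding D v by (auto simp: letter_close_def desub_letter_def \<delta>_def)
    next
      case True
      have "?q \<noteq> - ?p"
      proof
        assume "?q = - ?p"
        then have "norm (\<theta> * \<alpha> - ?p) < 1/2" "norm (\<theta> * \<alpha> + ?p) < 1/2"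
          using c True unfolding \<delta>_def by (auto simp: dist_norm norm_minus_commute add.commute)
        then have "norm ((\<theta> * \<alpha> - ?p) + (\<theta> * \<alpha> + ?p)) < 1" by (smt (verit) norm_triangle_ineq field_sum_of_halves)
        then have "norm (2 * (\<theta> * \<alpha>)) < 1" by (simp add: algebra_simps mult_2)
        then show False using two[of "\<theta> * \<alpha>"] n\<theta> assms(2) by (simp add: norm_mult)
      qed
      moreover have "dist \<theta> (?p / \<alpha>) = dist (\<theta> * \<alpha>) ?p"
      proof -
        have "\<theta> - ?p / \<alpha> = (\<theta> * \<alpha> - ?p) / \<alpha>" using \<open>\<alpha> \<noteq> 0\<close> by (simp add: field_simps)
        then show ?thesis by (simp add: dist_norm norm_divide assms(2))
      qed
      ultimately show ?thesis using c True unfolding D v by (auto simp: letter_close_def desub_letter_def \<delta>_def)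
    qed
  qed
  moreover have "p' + L \<le> 2 ^ k" using w(2) p' by simp
  ultimately show "approximable \<alpha> L (\<lambda>i. desub \<alpha> x (a + int i)) \<epsilon> 1"
    using w(1,5) unfolding approximable_def by blast
qed


section \<open>Recognisability\<close>

lemma shift_power_add: "shift_power a (shift_power b w) = shift_power (a + b) w"
  by (simp add: shift_power_def fun_eq_iff algebra_simps)

lemma shift_power_0 [simp]: "shift_power 0 w = w"
  by (simp add: shift_power_def)

lemma rho_biinf_shift: "rho_biinf \<alpha> (shift_power n w) = shift_power (2 * n) (rho_biinf \<alpha> w)"
proof
  fix i
  have "(i + 2 * n) div 2 = i div 2 + n" "(i + 2 * n) mod 2 = i mod 2" by simp_all
  then show "rho_biinf \<alpha> (shift_power n w) i = shift_power (2 * n) (rho_biinf \<alpha> w) i"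
    by (simp add: rho_biinf_def shift_power_def add.commute)
qed

lemma rho_biinf_power_shift:
  "(rho_biinf \<alpha> ^^ k) (shift_power n w) = shift_power (2 ^ k * n) ((rho_biinf \<alpha> ^^ k) w)"
proof (induction k arbitrary: n w)
  case (Suc k)
  then show ?case by (simp add: rho_biinf_shift mult.assoc)
qed simp

lemma snd_rho_biinf: "snd (rho_biinf \<alpha> w i) \<longleftrightarrow> odd i"
  by (auto simp: rho_biinf_def snd_rho_nth nat_less_iff odd_iff_mod_2_eq_one even_iff_mod_2_eq_zero)

lemma rho_biinf_alphabet:
  assumes "norm \<alpha> = 1" "\<And>i. w i \<in> alphabet"
  shows "rho_biinf \<alpha> w i \<in> alphabet"
proof -
  have "nat (i mod 2) < length (rho \<alpha> (w (i div 2)))" by (simp add: nat_less_iff)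
  then show ?thesis
    using rho_closed[OF assms(1) assms(2)] unfolding rho_biinf_def by (meson nth_mem subsetD)
qed

lemma rho_biinf_power_alphabet:
  assumes "norm \<alpha> = 1" "\<And>i. w i \<in> alphabet"
  shows "(rho_biinf \<alpha> ^^ k) w i \<in> alphabet"
  by (induction k arbitrary: i) (auto intro: rho_biinf_alphabet assms)

text \<open>A nonzero spin differs from its negative, so the image itself shows whether its two
  spins are opposite (marker 0) or equal (marker 1).\<close>

lemma rho_biinf_inj:
  assumes "\<alpha> \<noteq> 0" "\<And>i. fst (u i) \<noteq> 0" "\<And>i. fst (v i) \<noteq> 0" "rho_biinf \<alpha> u = rho_biinf \<alpha> v"
  shows "u = v"
proof
  fix i
  have "rho \<alpha> (u i) ! 0 = rho \<alpha> (v i) ! 0" "rho \<alpha> (u i) ! 1 = rho \<alpha> (v i) ! 1"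
    using fun_cong[OF assms(4), of "2 * i"] fun_cong[OF assms(4), of "2 * i + 1"] by (simp_all add: rho_biinf_def)
  then show "u i = v i" using assms(1) assms(2)[of i] assms(3)[of i]
    by (cases "u i"; cases "v i") (auto simp: rho_nth split: if_splits)
qed

text \<open>Markers alternate along an image, so the marker at the origin reveals the parity of
  \<open>N\<close>. Once this last bit is cancelled, injectivity removes one layer of the
  substitution and the induction continues with the remaining bits.\<close>

lemma recognisable:
  assumes "norm \<alpha> = 1" "\<And>i. y i \<in> alphabet" "\<And>i. y' i \<in> alphabet" "N < 2 ^ k" "N' < 2 ^ k"
    and "shift_power (int N) ((rho_biinf \<alpha> ^^ k) y) = shift_power (int N') ((rho_biinf \<alpha> ^^ k) y')"
  shows "N = N' \<and> y = y'"
  using assms(4-)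
proof (induction k arbitrary: N N')
  case 0
  then show ?case by simp
next
  case (Suc k)
  let ?w = "(rho_biinf \<alpha> ^^ k) y" and ?w' = "(rho_biinf \<alpha> ^^ k) y'"
  have alph: "?w i \<in> alphabet" "?w' i \<in> alphabet" for i
    using assms rho_biinf_power_alphabet by blast+
  have eq: "shift_power (int N) (rho_biinf \<alpha> ?w) = shift_power (int N') (rho_biinf \<alpha> ?w')"
    using Suc.prems(3) by simp
  have "odd N \<longleftrightarrow> odd N'"
    using arg_cong[OF fun_cong[OF eq, of 0], of snd] by (simp add: shift_power_def snd_rho_biinf)
  then obtain P P' j where N: "N = 2 * P + j" "N' = 2 * P' + j"
    by (cases "odd N") (metis oddE evenE add.right_neutral)+
  have *: "shift_power (int (2 * P + j)) (rho_biinf \<alpha> w) = shift_power (int j) (rho_biinf \<alpha> (shift_power (int P) w))" for P w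
    by (simp add: rho_biinf_shift shift_power_add add.commute)
  have "shift_power (int j) (rho_biinf \<alpha> (shift_power (int P) ?w)) = shift_power (int j) (rho_biinf \<alpha> (shift_power (int P') ?w'))"
    using eq unfolding N * .
  from arg_cong[OF this, of "shift_power (- int j)"]
  have "rho_biinf \<alpha> (shift_power (int P) ?w) = rho_biinf \<alpha> (shift_power (int P') ?w')"
    by (simp add: shift_power_add)
  moreover have "fst (shift_power (int P) ?w i) \<noteq> 0" "fst (shift_power (int P') ?w' i) \<noteq> 0" for i P P'
    using alph(1)[of "i + int P"] alph(2)[of "i + int P'"] by (auto simp: shift_power_def alphabet_def)
  moreover have "\<alpha> \<noteq> 0" using assms(1) by auto
  ultimately have "shift_power (int P) ?w = shift_power (int P') ?w'" using rho_biinf_inj by blast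
  then show ?case using Suc.IH[of P P'] Suc.prems(1,2) N by auto
qed

text \<open>The phases of the successive desubstitutions are the binary digits of the odometer
  coordinate. Unlike the definite description in \<open>odometer_coord\<close>, this form can be
  computed with and is visibly measurable.\<close>

fun residue :: "complex \<Rightarrow> (int \<Rightarrow> letter) \<Rightarrow> nat \<Rightarrow> nat" where
  "residue \<alpha> x 0 = 0"
| "residue \<alpha> x (Suc k) = residue \<alpha> x k + 2 ^ k * phase ((desub \<alpha> ^^ k) x)"

lemma phase_le_1: "phase x \<le> 1" by (simp add: phase_def)

lemma residue_less: "residue \<alpha> x k < 2 ^ k"
proof (induction k)
  case (Suc k)
  have "2 ^ k * phase ((desub \<alpha> ^^ k) x) \<le> 2 ^ k * 1" using phase_le_1 by (intro mult_left_mono) auto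
  with Suc show ?case by (simp only: residue.simps power_Suc)
qed simp

lemma desub_power_X_rho: "x \<in> X_rho \<alpha> \<Longrightarrow> norm \<alpha> = 1 \<Longrightarrow> (desub \<alpha> ^^ k) x \<in> X_rho \<alpha>"
  by (induction k) (auto intro: desub_X_rho)

lemma residue_decomposition:
  assumes "x \<in> X_rho \<alpha>" "norm \<alpha> = 1"
  shows "x = shift_power (int (residue \<alpha> x k)) ((rho_biinf \<alpha> ^^ k) ((desub \<alpha> ^^ k) x))"
proof (induction k)
  case (Suc k)
  let ?y = "(desub \<alpha> ^^ k) x"
  have "(rho_biinf \<alpha> ^^ k) ?y = (rho_biinf \<alpha> ^^ k) (shift_power (int (phase ?y)) (rho_biinf \<alpha> (desub \<alpha> ?y)))"
    using rho_biinf_desub[OF desub_power_X_rho[OF assms] assms(2)] by simp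
  then have "x = shift_power (int (residue \<alpha> x k)) (shift_power (2 ^ k * int (phase ?y)) ((rho_biinf \<alpha> ^^ k) (rho_biinf \<alpha> (desub \<alpha> ?y))))"
    using Suc by (simp add: rho_biinf_power_shift)
  then show ?case by (simp add: shift_power_add funpow_swap1)
qed simp

lemma residue_unique:
  assumes "x \<in> X_rho \<alpha>" "norm \<alpha> = 1" "y \<in> X_rho \<alpha>" "N < 2 ^ k"
    and "x = shift_power (int N) ((rho_biinf \<alpha> ^^ k) y)"
  shows "residue \<alpha> x k = N"
proof -
  have "shift_power (int (residue \<alpha> x k)) ((rho_biinf \<alpha> ^^ k) ((desub \<alpha> ^^ k) x)) = shift_power (int N) ((rho_biinf \<alpha> ^^ k) y)"
    using residue_decomposition[OF assms(1,2), of k] assms(5) by simp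
  then show ?thesis
    using recognisable[OF assms(2), of "(desub \<alpha> ^^ k) x" y "residue \<alpha> x k" k N]
      X_rho_alphabet desub_power_X_rho[OF assms(1,2)] assms(3,4) residue_less by blast
qed

text \<open>Existence comes from iterated desubstitution and uniqueness from recognisability. Level
  0, on which the description is silent, is settled because every residue modulo 1 is 0.\<close>

lemma odometer_coord_eq_residue:
  assumes "x \<in> X_rho \<alpha>" "norm \<alpha> = 1"
  shows "odometer_coord \<alpha> x = residue \<alpha> x"
  unfolding odometer_coord_def
proof (rule the_equality)
  have "residue \<alpha> x (Suc k) mod 2 ^ k = residue \<alpha> x k" for k
    using residue_less[of \<alpha> x k] by simp
  then show "residue \<alpha> x \<in> dyadic \<and> (\<forall>k\<ge>1. \<exists>y\<in>X_rho \<alpha>. x = shift_power (int (residue \<alpha> x k)) ((rho_biinf \<alpha> ^^ k) y))"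
    using residue_less residue_decomposition[OF assms] desub_power_X_rho[OF assms] unfolding dyadic_def by blast
next
  fix z assume z: "z \<in> dyadic \<and> (\<forall>k\<ge>1. \<exists>y\<in>X_rho \<alpha>. x = shift_power (int (z k)) ((rho_biinf \<alpha> ^^ k) y))"
  show "z = residue \<alpha> x"
  proof
    fix k
    have "z k < 2 ^ k" using z unfolding dyadic_def by blast
    moreover have "\<exists>y\<in>X_rho \<alpha>. x = shift_power (int (z k)) ((rho_biinf \<alpha> ^^ k) y)" if "k \<noteq> 0"
      using z that by simp
    ultimately show "z k = residue \<alpha> x k"
      using residue_unique[OF assms, of _ "z k" k] by (cases "k = 0") auto
  qed
qed

text \<open>The sum \<open>t\<close> is a remainder plus a multiple of \<open>2 ^ k\<close>; the
  multiple passes through \<open>k\<close> substitutions as a shift of the desubstituted sequence,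
  and uniqueness of the residue identifies the remainder.\<close>

lemma residue_shift:
  assumes "x \<in> X_rho \<alpha>" "norm \<alpha> = 1"
  shows "int (residue \<alpha> (shift_power n x) k) = (int (residue \<alpha> x k) + n) mod 2 ^ k"
proof -
  define t where "t = int (residue \<alpha> x k) + n"
  define r where "r = nat (t mod 2 ^ k)"
  have r: "int r = t mod 2 ^ k" "r < 2 ^ k" by (auto simp: r_def nat_less_iff)
  let ?y = "(desub \<alpha> ^^ k) x"
  have "shift_power n x = shift_power n (shift_power (int (residue \<alpha> x k)) ((rho_biinf \<alpha> ^^ k) ?y))"
    using residue_decomposition[OF assms, of k] by simp
  also have "\<dots> = shift_power t ((rho_biinf \<alpha> ^^ k) ?y)"
    by (simp add: shift_power_add t_def add.commute)
  also have "t = int r + 2 ^ k * (t div 2 ^ k)" using r by simp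
  finally have "shift_power n x = shift_power (int r) ((rho_biinf \<alpha> ^^ k) (shift_power (t div 2 ^ k) ?y))"
    by (simp only: shift_power_add rho_biinf_power_shift)
  then have "residue \<alpha> (shift_power n x) k = r"
    using residue_unique[OF shift_power_X_rho[OF assms(1)] assms(2) shift_power_X_rho[OF desub_power_X_rho[OF assms]] r(2)]
    by blast
  then show ?thesis using r by (simp add: t_def)
qed

lemma residue_mod:
  assumes "k \<le> l" shows "residue \<alpha> x l mod 2 ^ k = residue \<alpha> x k"
  using assms
proof (induction l rule: dec_induct)
  case base
  then show ?case using residue_less by simp
next
  case (step l)
  have "(2::nat) ^ k dvd 2 ^ l" using step by (simp add: le_imp_power_dvd)
  then have "(2::nat) ^ k dvd 2 ^ l * phase ((desub \<alpha> ^^ l) x)" by simp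
  then obtain c where "2 ^ l * phase ((desub \<alpha> ^^ l) x) = 2 ^ k * c" by (auto elim: dvdE)
  then show ?case using step by simp
qed

text \<open>An image starts with marker 0, and a letter with marker 0 hands its spin on unchanged,
  so \<alpha> can enter only at the innermost substitution.\<close>

lemma rho_biinf_power_start:
  "k > 0 \<Longrightarrow> (rho_biinf \<alpha> ^^ k) v (2 ^ k * m) = (fst (v m) * (if snd (v m) then \<alpha> else 1), False)"
proof (induction k arbitrary: v m rule: nat_induct_non_zero)
  case 1
  then show ?case by (cases "v m") (simp add: rho_biinf_def rho_nth)
next
  case (Suc k)
  have "(rho_biinf \<alpha> ^^ Suc k) v (2 ^ Suc k * m) = rho_biinf \<alpha> ((rho_biinf \<alpha> ^^ k) v) (2 * (2 ^ k * m))"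
    by (simp add: mult.assoc)
  also have "\<dots> = rho \<alpha> ((rho_biinf \<alpha> ^^ k) v (2 ^ k * m)) ! 0" by (simp add: rho_biinf_def)
  finally show ?case using Suc.IH by (simp add: rho_nth)
qed

text \<open>The positions 0 and \<open>2 ^ k\<close> start the two halves of a supertile of level
  \<open>k + 1\<close>, which grow from the two letters of one image. The sign records the type of
  that image; for \<open>k > 0\<close> the second letter, having marker 1, acquires a further
  \<alpha>.\<close>

lemma spin_half_block:
  assumes "x \<in> X_rho \<alpha>" "norm \<alpha> = 1" "residue \<alpha> x (Suc k) = 0"
  shows "fst (x (2 ^ k)) = (if residue \<alpha> x (Suc (Suc k)) = 0 then - 1 else 1) * (if k = 0 then 1 else \<alpha>) * fst (x 0)"
proof -
  define y where "y = (desub \<alpha> ^^ Suc k) x"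
  define v where "v = rho_biinf \<alpha> y"
  have "x = (rho_biinf \<alpha> ^^ Suc k) y"
    using residue_decomposition[OF assms(1,2), of "Suc k"] assms(3) by (simp add: y_def)
  then have x: "x = (rho_biinf \<alpha> ^^ k) v" by (simp add: v_def funpow_swap1)
  have res: "residue \<alpha> x (Suc (Suc k)) = 0 \<longleftrightarrow> \<not> snd (y 0)"
    using assms(3) by (simp add: y_def phase_def del: funpow.simps)
  obtain \<theta> d where y: "y 0 = (\<theta>, d)" by force
  have v: "v 0 = (if d then \<theta> * \<alpha> else \<theta>, False)" "v 1 = (if d then \<theta> * \<alpha> else - \<theta>, True)"
    by (simp_all add: v_def rho_biinf_def y rho_nth)
  show ?thesis
  proof (cases "k = 0")
    case True
    then show ?thesis using x v res y by auto
  next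
    case False
    then show ?thesis
      using rho_biinf_power_start[of k \<alpha> v 0] rho_biinf_power_start[of k \<alpha> v 1] v res y x by auto
  qed
qed


section \<open>Square-integrable functions and trigonometric polynomials\<close>

text \<open>Only a seminorm, because elements of \<open>L2\<close> are functions rather than
  classes.\<close>

definition L2_norm :: "'a measure \<Rightarrow> ('a \<Rightarrow> complex) \<Rightarrow> real" where
  "L2_norm M f = sqrt (\<integral>x. (cmod (f x))\<^sup>2 \<partial>M)"

lemma L2_norm_nonneg: "L2_norm M f \<ge> 0"
  by (simp add: L2_norm_def)

lemma L2_norm_power2: "(L2_norm M f)\<^sup>2 = (\<integral>x. (cmod (f x))\<^sup>2 \<partial>M)"
  by (simp add: L2_norm_def)

lemma L2_measurable: "f \<in> L2 M \<Longrightarrow> f \<in> borel_measurable M"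
  by (simp add: L2_def)

lemma L2_abs_prod_integrable:
  assumes "f \<in> L2 M" "g \<in> L2 M"
  shows "integrable M (\<lambda>x. cmod (f x) * cmod (g x))"
proof (rule Bochner_Integration.integrable_bound)
  show "integrable M (\<lambda>x. (cmod (f x))\<^sup>2 + (cmod (g x))\<^sup>2)"
    using assms by (auto simp: L2_def)
  have [measurable]: "f \<in> borel_measurable M" "g \<in> borel_measurable M" using assms by (auto simp: L2_def)
  show "(\<lambda>x. cmod (f x) * cmod (g x)) \<in> borel_measurable M" by measurable
  have "norm (a * b) \<le> norm (a\<^sup>2 + b\<^sup>2)" for a b :: real
  proof -
    have "0 \<le> \<bar>a\<bar> * \<bar>b\<bar>" by simp
    then have "\<bar>a\<bar> * \<bar>b\<bar> \<le> a\<^sup>2 + b\<^sup>2" using sum_squares_bound[of "\<bar>a\<bar>" "\<bar>b\<bar>"] unfolding power2_abs by linarith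
    then show ?thesis by (simp add: abs_mult)
  qed
  then show "AE x in M. norm (cmod (f x) * cmod (g x)) \<le> norm ((cmod (f x))\<^sup>2 + (cmod (g x))\<^sup>2)"
    by (intro AE_I2)
qed

lemma L2_inner_integrable:
  assumes "f \<in> L2 M" "g \<in> L2 M"
  shows "integrable M (\<lambda>x. cnj (f x) * g x)"
proof (rule Bochner_Integration.integrable_bound[OF L2_abs_prod_integrable[OF assms]])
  have [measurable]: "f \<in> borel_measurable M" "g \<in> borel_measurable M" using assms by (auto simp: L2_def)
  have "(\<lambda>x. cnj (f x)) \<in> borel_measurable M"
    by (rule borel_measurable_continuous_on[OF _ \<open>f \<in> borel_measurable M\<close>]) (intro continuous_intros)
  then show "(\<lambda>x. cnj (f x) * g x) \<in> borel_measurable M" by measurable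
qed (simp add: norm_mult)

lemma L2_cmult: "f \<in> L2 M \<Longrightarrow> (\<lambda>x. c * f x) \<in> L2 M"
  by (auto simp: L2_def norm_mult power_mult_distrib)

lemma L2_add:
  assumes "f \<in> L2 M" "g \<in> L2 M"
  shows "(\<lambda>x. f x + g x) \<in> L2 M"
proof -
  have [measurable]: "f \<in> borel_measurable M" "g \<in> borel_measurable M" using assms by (auto simp: L2_def)
  have "integrable M (\<lambda>x. (cmod (f x + g x))\<^sup>2)"
  proof (rule Bochner_Integration.integrable_bound)
    show "integrable M (\<lambda>x. 2 * (cmod (f x))\<^sup>2 + 2 * (cmod (g x))\<^sup>2)" using assms by (auto simp: L2_def)
    have "(cmod (a + b))\<^sup>2 \<le> 2 * (cmod a)\<^sup>2 + 2 * (cmod b)\<^sup>2" for a b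
    proof -
      have "(cmod (a + b))\<^sup>2 \<le> (cmod a + cmod b)\<^sup>2" by (intro power_mono norm_triangle_ineq) auto
      also have "\<dots> \<le> 2 * (cmod a)\<^sup>2 + 2 * (cmod b)\<^sup>2"
        using sum_squares_bound[of "cmod a" "cmod b"] by (simp add: power2_sum)
      finally show ?thesis .
    qed
    then show "AE x in M. norm ((cmod (f x + g x))\<^sup>2) \<le> norm (2 * (cmod (f x))\<^sup>2 + 2 * (cmod (g x))\<^sup>2)"
      by auto
  qed measurable
  then show ?thesis by (simp add: L2_def)
qed

lemma L2_zero: "(\<lambda>x. 0) \<in> L2 M"
  by (simp add: L2_def)

lemma L2_diff:
  assumes "f \<in> L2 M" "g \<in> L2 M"
  shows "(\<lambda>x. f x - g x) \<in> L2 M"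
  using L2_add[OF assms(1) L2_cmult[OF assms(2), of "-1"]] by simp

lemma L2_sum: "(\<And>i. i \<in> I \<Longrightarrow> f i \<in> L2 M) \<Longrightarrow> (\<lambda>x. \<Sum>i\<in>I. f i x) \<in> L2 M"
  by (induction I rule: infinite_finite_induct) (auto intro: L2_add L2_zero)

lemma L2_bounded:
  assumes "finite_measure M" "f \<in> borel_measurable M" "\<And>x. x \<in> space M \<Longrightarrow> cmod (f x) \<le> B"
  shows "f \<in> L2 M"
proof -
  have "integrable M (\<lambda>x. (cmod (f x))\<^sup>2)"
    using assms by (intro finite_measure.integrable_const_bound[where B="B\<^sup>2"]) (auto intro!: power_mono)
  then show ?thesis using assms by (simp add: L2_def)
qed

lemma L2_norm_bounded:
  assumes "prob_space M" "f \<in> borel_measurable M" "\<And>x. x \<in> space M \<Longrightarrow> cmod (f x) \<le> B" "B \<ge> 0"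
  shows "L2_norm M f \<le> B"
proof -
  interpret prob_space M by fact
  have "(\<integral>x. (cmod (f x))\<^sup>2 \<partial>M) \<le> (\<integral>x. B\<^sup>2 \<partial>M)"
    using L2_bounded[OF finite_measure_axioms assms(2,3)] assms(3)
    by (intro integral_mono) (auto intro!: power_mono simp: L2_def)
  then show ?thesis unfolding L2_norm_def using assms(4) by (intro real_le_lsqrt) (auto simp: prob_space)
qed

lemma L2_inner_add_right:
  assumes "f \<in> L2 M" "g \<in> L2 M" "h \<in> L2 M"
  shows "L2_inner M f (\<lambda>x. g x + h x) = L2_inner M f g + L2_inner M f h"
  unfolding L2_inner_def using assms
  by (simp add: distrib_left L2_inner_integrable)

lemma L2_inner_add_left:
  assumes "f \<in> L2 M" "g \<in> L2 M" "h \<in> L2 M"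
  shows "L2_inner M (\<lambda>x. f x + g x) h = L2_inner M f h + L2_inner M g h"
  unfolding L2_inner_def using assms
  by (simp add: distrib_right L2_inner_integrable)

lemma L2_inner_cmult_right: "L2_inner M f (\<lambda>x. c * g x) = c * L2_inner M f g"
  unfolding L2_inner_def by (simp add: mult.left_commute)

lemma L2_inner_cmult_left: "L2_inner M (\<lambda>x. c * f x) g = cnj c * L2_inner M f g"
  unfolding L2_inner_def by (simp add: mult.assoc)

lemma L2_inner_zero [simp]: "L2_inner M f (\<lambda>x. 0) = 0" "L2_inner M (\<lambda>x. 0) f = 0"
  by (simp_all add: L2_inner_def)

lemma L2_inner_cnj: "cnj (L2_inner M f g) = L2_inner M g f"
  unfolding L2_inner_def by (simp flip: Bochner_Integration.integral_cnj add: mult.commute)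

lemma L2_inner_diff_left:
  assumes "f \<in> L2 M" "g \<in> L2 M" "h \<in> L2 M"
  shows "L2_inner M (\<lambda>x. f x - g x) h = L2_inner M f h - L2_inner M g h"
  unfolding L2_inner_def using assms
  by (simp add: left_diff_distrib L2_inner_integrable)

lemma L2_inner_diff_right:
  assumes "f \<in> L2 M" "g \<in> L2 M" "h \<in> L2 M"
  shows "L2_inner M f (\<lambda>x. g x - h x) = L2_inner M f g - L2_inner M f h"
  unfolding L2_inner_def using assms
  by (simp add: right_diff_distrib L2_inner_integrable)

lemma L2_inner_self: "L2_inner M f f = of_real ((L2_norm M f)\<^sup>2)"
proof -
  have "cnj z * z = of_real ((cmod z)\<^sup>2)" for z by (simp only: complex_norm_square mult.commute)
  then show ?thesis unfolding L2_inner_def L2_norm_power2 by (simp only: integral_complex_of_real)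
qed

text \<open>The quadratic in \<open>t\<close> is the integral of a square, hence nonnegative.
  Working with absolute values bounds \<open>C\<close>, which dominates the complex inner
  product.\<close>

lemma L2_Cauchy_Schwarz:
  assumes "f \<in> L2 M" "g \<in> L2 M"
  shows "cmod (L2_inner M f g) \<le> L2_norm M f * L2_norm M g"
proof -
  define C where "C = (\<integral>x. cmod (f x) * cmod (g x) \<partial>M)"
  define A where "A = (L2_norm M f)\<^sup>2"
  define B where "B = (L2_norm M g)\<^sup>2"
  have C0: "C \<ge> 0" unfolding C_def by simp
  have AB: "A \<ge> 0" "B \<ge> 0" by (auto simp: A_def B_def)
  have q: "0 \<le> t\<^sup>2 * A - 2 * t * C + B" for t
  proof -
    have "0 \<le> (\<integral>x. (t * cmod (f x) - cmod (g x))\<^sup>2 \<partial>M)" by simp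
    also have "\<dots> = (\<integral>x. t\<^sup>2 * (cmod (f x))\<^sup>2 - 2 * t * (cmod (f x) * cmod (g x)) + (cmod (g x))\<^sup>2 \<partial>M)"
      by (intro Bochner_Integration.integral_cong) (auto simp: power2_diff power_mult_distrib algebra_simps)
    also have "\<dots> = t\<^sup>2 * A - 2 * t * C + B"
      using assms L2_abs_prod_integrable[OF assms]
      by (simp add: A_def B_def C_def L2_norm_power2 L2_def)
    finally show ?thesis .
  qed
  have "C\<^sup>2 \<le> A * B"
  proof (cases "A = 0")
    case True
    have "C = 0"
    proof (rule ccontr)
      assume "C \<noteq> 0"
      \<comment> \<open>For \<open>A = 0\<close> the form is linear in \<open>t\<close>, and this
        \<open>t\<close> gives it the value -1.\<close>
      then show False using q[of "(B + 1) / (2 * C)"] True by (simp add: field_simps)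
    qed
    then show ?thesis using AB True by simp
  next
    case False
    then have "A > 0" using AB by simp
    \<comment> \<open>The minimiser of the quadratic.\<close>
    then show ?thesis using q[of "C / A"] by (simp add: power2_eq_square field_simps)
  qed
  then have "C \<le> sqrt (A * B)" by (rule real_le_rsqrt)
  also have "\<dots> = L2_norm M f * L2_norm M g"
    by (simp add: A_def B_def real_sqrt_mult L2_norm_nonneg)
  finally have "C \<le> L2_norm M f * L2_norm M g" .
  moreover have "cmod (L2_inner M f g) \<le> C"
    unfolding L2_inner_def C_def by (rule order_trans[OF integral_norm_bound]) (simp add: norm_mult)
  ultimately show ?thesis by linarith
qed

lemma L2_norm_cmult: "L2_norm M (\<lambda>x. c * f x) = cmod c * L2_norm M f"
  by (simp add: L2_norm_def norm_mult power_mult_distrib real_sqrt_mult)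

lemma L2_norm_triangle:
  assumes "f \<in> L2 M" "g \<in> L2 M"
  shows "L2_norm M (\<lambda>x. f x + g x) \<le> L2_norm M f + L2_norm M g"
proof -
  have "complex_of_real ((L2_norm M (\<lambda>x. f x + g x))\<^sup>2) =
      L2_inner M f f + L2_inner M f g + L2_inner M g f + L2_inner M g g"
    using assms by (simp only: L2_inner_self[symmetric] L2_inner_add_left L2_inner_add_right L2_add add.assoc)
  then have "(L2_norm M (\<lambda>x. f x + g x))\<^sup>2 =
      Re (L2_inner M f f + L2_inner M f g + L2_inner M g f + L2_inner M g g)"
    by (metis Re_complex_of_real)
  also have "\<dots> \<le> (L2_norm M f)\<^sup>2 + L2_norm M f * L2_norm M g + L2_norm M g * L2_norm M f + (L2_norm M g)\<^sup>2"
    using complex_Re_le_cmod[of "L2_inner M f g"] L2_Cauchy_Schwarz[OF assms]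
     complex_Re_le_cmod[of "L2_inner M g f"] L2_Cauchy_Schwarz[OF assms(2,1)]
    unfolding L2_inner_self plus_complex.sel Re_complex_of_real by linarith
  also have "\<dots> = (L2_norm M f + L2_norm M g)\<^sup>2" by (simp add: power2_sum)
  finally show ?thesis by (rule power2_le_imp_le) (simp add: L2_norm_nonneg)
qed

lemma L2_norm_diff_triangle:
  assumes "f \<in> L2 M" "g \<in> L2 M"
  shows "L2_norm M (\<lambda>x. f x - g x) \<le> L2_norm M f + L2_norm M g"
  using L2_norm_triangle[OF assms(1) L2_cmult[OF assms(2), of "-1"]] L2_norm_cmult[of M "-1" g] by simp

lemma L2_norm_zero [simp]: "L2_norm M (\<lambda>x. 0) = 0"
  by (simp add: L2_norm_def)

lemma L2_norm_sum:
  assumes "\<And>i. i \<in> I \<Longrightarrow> f i \<in> L2 M"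
  shows "L2_norm M (\<lambda>x. \<Sum>i\<in>I. f i x) \<le> (\<Sum>i\<in>I. L2_norm M (f i))"
  using assms
proof (induction I rule: infinite_finite_induct)
  case (insert i I)
  then have "L2_norm M (\<lambda>x. f i x + (\<Sum>i\<in>I. f i x)) \<le> L2_norm M (f i) + L2_norm M (\<lambda>x. \<Sum>i\<in>I. f i x)"
    by (intro L2_norm_triangle L2_sum) auto
  with insert show ?case by fastforce
qed auto

text \<open>A list of pairs \<open>(c, e)\<close> represents the trigonometric polynomial with terms \<open>c z\<^sup>e\<close>.\<close>

definition tpoly :: "(complex \<times> int) list \<Rightarrow> complex \<Rightarrow> complex" where
  "tpoly q z = (\<Sum>(c, e)\<leftarrow>q. c * z powi e)"

definition tpoly_op :: "(complex \<times> int) list \<Rightarrow> ((int \<Rightarrow> 'a) \<Rightarrow> complex) \<Rightarrow> ((int \<Rightarrow> 'a) \<Rightarrow> complex)" where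
  "tpoly_op q f x = (\<Sum>(c, e)\<leftarrow>q. c * f (shift_power e x))"

text \<open>On the unit circle the conjugate of \<open>z powi e\<close> is
  \<open>z powi (- e)\<close>, so this is pointwise conjugation for functions and the adjoint for
  operators.\<close>

definition tpoly_cnj :: "(complex \<times> int) list \<Rightarrow> (complex \<times> int) list" where
  "tpoly_cnj q = map (\<lambda>(c, e). (cnj c, - e)) q"

definition tpoly_mult :: "(complex \<times> int) list \<Rightarrow> (complex \<times> int) list \<Rightarrow> (complex \<times> int) list" where
  "tpoly_mult p q = concat (map (\<lambda>(c, e). map (\<lambda>(d, l). (c * d, e + l)) q) p)"

lemma tpoly_simps [simp]: "tpoly [] z = 0" "tpoly ((c, e) # q) z = c * z powi e + tpoly q z"
  "tpoly (p @ q) z = tpoly p z + tpoly q z"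
  by (simp_all add: tpoly_def)

lemma tpoly_op_simps [simp]: "tpoly_op [] f x = 0"
  "tpoly_op ((c, e) # q) f x = c * f (shift_power e x) + tpoly_op q f x"
  "tpoly_op (p @ q) f x = tpoly_op p f x + tpoly_op q f x"
  by (simp_all add: tpoly_op_def)

lemma tpoly_mult_simps [simp]: "tpoly_mult [] q = []"
  "tpoly_mult ((c, e) # p) q = map (\<lambda>(d, l). (c * d, e + l)) q @ tpoly_mult p q"
  by (simp_all add: tpoly_mult_def)

lemma tpoly_cnj_simps [simp]: "tpoly_cnj [] = []" "tpoly_cnj ((c, e) # q) = (cnj c, - e) # tpoly_cnj q"
  by (simp_all add: tpoly_cnj_def)

lemma tpoly_shift: "z \<noteq> 0 \<Longrightarrow> tpoly (map (\<lambda>(d, l). (c * d, e + l)) q) z = c * z powi e * tpoly q z"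
  by (induction q) (auto simp: power_int_add algebra_simps)

lemma tpoly_mult: "z \<noteq> 0 \<Longrightarrow> tpoly (tpoly_mult p q) z = tpoly p z * tpoly q z"
  by (induction p) (auto simp: tpoly_shift algebra_simps)

lemma tpoly_cnj: "cmod z = 1 \<Longrightarrow> tpoly (tpoly_cnj q) z = cnj (tpoly q z)"
proof (induction q)
  case (Cons a q)
  have "cnj z = inverse z" using Cons.prems
    by (metis complex_norm_square inverse_unique mult.commute mult.right_neutral norm_one of_real_1 power_one)
  then have "cnj z powi e = z powi (- e)" for e by (simp add: power_int_minus power_int_inverse)
  with Cons show ?case by (cases a) auto
qed simp

lemma tpoly_op_shift: "tpoly_op (map (\<lambda>(d, l). (c * d, e + l)) q) f x = c * tpoly_op q f (shift_power e x)"
  by (induction q) (auto simp: shift_power_def algebra_simps)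

lemma tpoly_op_mult: "tpoly_op (tpoly_mult p q) f x = tpoly_op p (tpoly_op q f) x"
  by (induction p) (auto simp: tpoly_op_shift)


section \<open>Spectral measures of a measure-preserving shift\<close>

lemma tpoly_continuous: "continuous_on circle (tpoly q)"
proof (induction q)
  case (Cons a q)
  then show ?case by (cases a) (auto intro!: continuous_intros)
qed simp

text \<open>Powers of both signs are included, so that the Koopman operator is unitary and its
  adjoint is again a translation.\<close>

locale koopman = prob_space M for M :: "(int \<Rightarrow> 'a) measure" +
  assumes shift_measurable [measurable]: "shift_power n \<in> measurable M M"
    and shift_invariant: "distr M M (shift_power n) = M"
begin

lemma shift_L2:
  assumes "f \<in> L2 M" shows "(\<lambda>x. f (shift_power n x)) \<in> L2 M"
proof -
  have [measurable]: "f \<in> borel_measurable M" using assms by (simp add: L2_def)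
  have "integrable (distr M M (shift_power n)) (\<lambda>x. (cmod (f x))\<^sup>2)"
    unfolding shift_invariant using assms by (simp add: L2_def)
  then have "integrable M (\<lambda>x. (cmod (f (shift_power n x)))\<^sup>2)"
    by (subst (asm) integrable_distr_eq) simp_all
  then show ?thesis by (simp add: L2_def)
qed

lemma integral_shift:
  fixes f :: "_ \<Rightarrow> 'b::{banach, second_countable_topology}"
  assumes "f \<in> borel_measurable M"
  shows "(\<integral>x. f (shift_power n x) \<partial>M) = (\<integral>x. f x \<partial>M)"
  using integral_distr[OF shift_measurable assms, of n] by (simp add: shift_invariant)

lemma L2_inner_shift:
  assumes "f \<in> L2 M" "g \<in> L2 M"
  shows "L2_inner M (\<lambda>x. f (shift_power n x)) (\<lambda>x. g (shift_power n x)) = L2_inner M f g"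
  unfolding L2_inner_def
  using integral_shift[of "\<lambda>x. cnj (f x) * g x" n] borel_measurable_integrable[OF L2_inner_integrable[OF assms]] by simp

lemma L2_norm_shift:
  assumes "f \<in> L2 M"
  shows "L2_norm M (\<lambda>x. f (shift_power n x)) = L2_norm M f"
  unfolding L2_norm_def using integral_shift[of "\<lambda>x. (cmod (f x))\<^sup>2" n] L2_measurable[OF assms] by simp

text \<open>For \<open>f = g\<close> these are the Fourier coefficients of the spectral measure; by
  unitarity all inner products of translates reduce to them.\<close>

definition corr :: "((int \<Rightarrow> 'a) \<Rightarrow> complex) \<Rightarrow> ((int \<Rightarrow> 'a) \<Rightarrow> complex) \<Rightarrow> int \<Rightarrow> complex" where
  "corr f g m = L2_inner M f (\<lambda>x. g (shift_power m x))"

lemma corr_shift: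
  assumes "f \<in> L2 M" "g \<in> L2 M"
  shows "L2_inner M (\<lambda>x. f (shift_power i x)) (\<lambda>x. g (shift_power j x)) = corr f g (j - i)"
  using L2_inner_shift[OF assms(1) shift_L2[OF assms(2)], of i "j - i"]
  by (simp add: corr_def shift_power_add)

lemma corr_minus:
  assumes "f \<in> L2 M" "g \<in> L2 M"
  shows "corr f g (- m) = cnj (corr g f m)"
  using corr_shift[OF assms, of m 0] unfolding corr_def L2_inner_cnj by simp

lemma corr_bound:
  assumes "f \<in> L2 M" "g \<in> L2 M"
  shows "cmod (corr f g m) \<le> L2_norm M f * L2_norm M g"
  unfolding corr_def using L2_Cauchy_Schwarz[OF assms(1) shift_L2[OF assms(2)]] L2_norm_shift[OF assms(2)] by simp

lemma tpoly_op_eq: "tpoly_op ((c, e) # q) f = (\<lambda>x. c * f (shift_power e x) + tpoly_op q f x)"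
  "tpoly_op [] f = (\<lambda>x. 0)"
  by (auto simp: fun_eq_iff)

lemma tpoly_op_L2: "f \<in> L2 M \<Longrightarrow> tpoly_op q f \<in> L2 M"
  by (induction q) (auto simp: tpoly_op_eq L2_zero intro!: L2_add L2_cmult shift_L2)

lemma tpoly_op_adjoint:
  assumes "f \<in> L2 M" "g \<in> L2 M"
  shows "L2_inner M (tpoly_op q f) g = L2_inner M f (tpoly_op (tpoly_cnj q) g)"
proof (induction q)
  case (Cons a q)
  obtain c e where a: "a = (c, e)" by force
  have "L2_inner M (\<lambda>x. f (shift_power e x)) g = L2_inner M f (\<lambda>x. g (shift_power (- e) x))"
    using corr_shift[OF assms, of e 0] by (simp add: corr_def)
  with Cons assms show ?case unfolding a tpoly_cnj_simps tpoly_op_eq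
    by (subst L2_inner_add_left L2_inner_add_right; simp add: L2_cmult shift_L2 tpoly_op_L2 L2_inner_cmult_left)+
      (simp add: L2_inner_cmult_right)
qed (simp add: tpoly_op_eq)

lemma tpoly_op_norm:
  assumes "f \<in> L2 M" "g \<in> L2 M"
  shows "L2_inner M (tpoly_op p f) (tpoly_op q g) = L2_inner M f (tpoly_op (tpoly_mult (tpoly_cnj p) q) g)"
  using tpoly_op_adjoint[OF assms(1) tpoly_op_L2[OF assms(2)]]
  by (simp add: tpoly_op_mult[THEN ext])

context
  fixes f \<rho>
  assumes f: "f \<in> L2 M" and spec: "is_spectral_measure M f \<rho>"
begin

lemma spectral_finite: "finite_measure \<rho>" and spectral_sets: "sets \<rho> = sets circle_borel"
  and spectral_corr: "corr f f n = (\<integral>z. z powi n \<partial>\<rho>)"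
  using spec unfolding is_spectral_measure_def koopman_power_def corr_def comp_def by blast+

lemma spectral_space: "space \<rho> = circle"
  using sets_eq_imp_space_eq[OF spectral_sets] by (simp add: circle_borel_def space_restrict_space)

lemma circle_measurable:
  fixes h :: "complex \<Rightarrow> 'b::topological_space"
  assumes "continuous_on circle h" shows "h \<in> borel_measurable \<rho>"
proof -
  have "h \<in> borel_measurable (restrict_space borel circle)"
    by (rule borel_measurable_continuous_on_restrict[OF assms])
  then show ?thesis using spectral_sets measurable_cong_sets unfolding circle_borel_def by blast
qed

lemma circle_integrable:
  fixes h :: "complex \<Rightarrow> 'b::{banach, second_countable_topology}"
  assumes "continuous_on circle h" shows "integrable \<rho> h"
proof -
  have "compact (h ` circle)" by (intro compact_continuous_image assms) simp
  then obtain B where "\<And>z. z \<in> circle \<Longrightarrow> norm (h z) \<le> B"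
    by (metis bounded_iff compact_imp_bounded image_eqI)
  then show ?thesis using spectral_finite circle_measurable[OF assms] spectral_space
    by (intro finite_measure.integrable_const_bound[where B=B]) auto
qed

lemma spectral_tpoly: "L2_inner M f (tpoly_op q f) = (\<integral>z. tpoly q z \<partial>\<rho>)"
proof (induction q)
  case (Cons a q)
  obtain c e where a: "a = (c, e)" by force
  have "L2_inner M f (tpoly_op (a # q) f) = c * corr f f e + L2_inner M f (tpoly_op q f)"
    unfolding a tpoly_op_eq by (simp add: L2_inner_add_right f L2_cmult shift_L2 tpoly_op_L2 L2_inner_cmult_right corr_def)
  also have "\<dots> = (\<integral>z. c * z powi e + tpoly q z \<partial>\<rho>)"
    using Cons by (subst Bochner_Integration.integral_add)
      (auto simp: spectral_corr intro!: circle_integrable continuous_intros tpoly_continuous)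
  finally show ?case unfolding a tpoly_simps .
qed (simp add: tpoly_op_eq)

text \<open>Moving the adjoint across turns the squared norm into the integral of
  \<open>cnj q * q\<close>. This isometry on Laurent polynomials is the form in which the spectral
  theorem is used.\<close>

lemma spectral_tpoly_norm: "(L2_norm M (tpoly_op q f))\<^sup>2 = (\<integral>z. (cmod (tpoly q z))\<^sup>2 \<partial>\<rho>)"
proof -
  have "complex_of_real ((L2_norm M (tpoly_op q f))\<^sup>2) = (\<integral>z. tpoly (tpoly_mult (tpoly_cnj q) q) z \<partial>\<rho>)"
    unfolding L2_inner_self[symmetric] tpoly_op_norm[OF f f] spectral_tpoly ..
  also have "\<dots> = (\<integral>z. complex_of_real ((cmod (tpoly q z))\<^sup>2) \<partial>\<rho>)"
  proof (rule Bochner_Integration.integral_cong[OF refl])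
    fix z assume "z \<in> space \<rho>"
    then have "cmod z = 1" by (simp add: spectral_space)
    moreover from this have "z \<noteq> 0" by auto
    ultimately show "tpoly (tpoly_mult (tpoly_cnj q) q) z = complex_of_real ((cmod (tpoly q z))\<^sup>2)"
      unfolding complex_norm_square by (simp add: tpoly_mult tpoly_cnj mult.commute)
  qed
  also have "\<dots> = complex_of_real (\<integral>z. (cmod (tpoly q z))\<^sup>2 \<partial>\<rho>)"
    by (rule integral_complex_of_real)
  finally show ?thesis by (simp only: of_real_eq_iff)
qed

lemma spectral_total_mass: "measure \<rho> circle = (L2_norm M f)\<^sup>2"
proof -
  have "tpoly_op [(1, 0)] f = f" by (simp add: fun_eq_iff)
  then show ?thesis using spectral_tpoly_norm[of "[(1, 0)]"] by (simp flip: spectral_space)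
qed

end

end


section \<open>Measures on the circle\<close>

lemma average_powers_tendsto:
  fixes a :: complex
  assumes "norm a = 1"
  shows "(\<lambda>N. (\<Sum>m<N. a ^ m) / of_nat N) \<longlonglongrightarrow> of_bool (a = 1)"
proof (cases "a = 1")
  case True
  have "eventually (\<lambda>N. (\<Sum>m<N. a ^ m) / of_nat N = 1) sequentially"
    using eventually_gt_at_top[of 0] by eventually_elim (simp add: True)
  then show ?thesis using True by (simp add: tendsto_eventually)
next
  case False
  have lim: "(\<lambda>N. (2 / norm (a - 1)) * (1 / real N)) \<longlonglongrightarrow> 0"
    by (intro tendsto_mult_right_zero lim_1_over_n)
  have bd: "norm ((\<Sum>m<N. a ^ m) / of_nat N) \<le> (2 / norm (a - 1)) * (1 / real N)" for N
  proof -
    have "(\<Sum>m<N. a ^ m) = (a ^ N - 1) / (a - 1)" using False by (simp add: geometric_sum)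
    moreover have "norm (a ^ N - 1) \<le> 2"
      using norm_triangle_ineq4[of "a ^ N" 1] assms by (simp add: norm_power)
    ultimately have "norm (\<Sum>m<N. a ^ m) \<le> 2 / norm (a - 1)" by (simp add: norm_divide divide_right_mono)
    then have "norm (\<Sum>m<N. a ^ m) / real N \<le> 2 / norm (a - 1) / real N" by (rule divide_right_mono) simp
    then show ?thesis by (simp add: norm_divide)
  qed
  have "(\<lambda>N. (\<Sum>m<N. a ^ m) / of_nat N) \<longlonglongrightarrow> 0"
    using bd by (intro Lim_null_comparison[OF _ lim] always_eventually allI)
  then show ?thesis using False by simp
qed

lemma average_powers_bound:
  fixes a :: complex
  assumes "norm a = 1"
  shows "norm ((\<Sum>m<N. a ^ m) / of_nat N) \<le> 1"
proof -
  have "norm (\<Sum>m<N. a ^ m) \<le> (\<Sum>m<N. 1)"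
    by (rule order_trans[OF norm_sum]) (simp add: norm_power assms)
  then show ?thesis by (cases "N = 0") (auto simp: norm_divide divide_simps)
qed

lemma circle_borel_iff: "A \<in> sets circle_borel \<longleftrightarrow> A \<in> sets borel \<and> A \<subseteq> circle"
  by (auto simp: circle_borel_def sets_restrict_space_iff)

text \<open>By dominated convergence the averages pick out the set where the base equals 1. With
  \<open>k = 1\<close> and \<open>w = cnj z\<close> this measures the atom at \<open>z\<close>; with
  \<open>w = 1\<close> it measures the \<open>k\<close>-th roots of unity.\<close>

lemma average_powers_integral_tendsto:
  assumes "finite_measure \<rho>" "sets \<rho> = sets circle_borel" "norm w = 1"
  shows "(\<lambda>N. (\<integral>z. (\<Sum>m<N. (z ^ k * w) ^ m) / of_nat N \<partial>\<rho>)) \<longlonglongrightarrow> of_real (measure \<rho> {z \<in> circle. z ^ k * w = 1})"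
proof -
  interpret finite_measure \<rho> by fact
  have sp: "space \<rho> = circle"
    using sets_eq_imp_space_eq[OF assms(2)] by (simp add: circle_borel_def space_restrict_space)
  have n1: "norm (z ^ k * w) = 1" if "z \<in> space \<rho>" for z using that assms(3) by (simp add: sp norm_mult norm_power)
  define A where "A = {z \<in> circle. z ^ k * w = 1}"
  have "closed ({z. z ^ k * w = 1} \<inter> circle)" by (intro closed_Int closed_Collect_eq continuous_intros) simp
  then have A: "A \<in> sets \<rho>" unfolding assms(2) circle_borel_iff A_def by (auto simp: Collect_conj_eq Int_commute)
  have m: "h \<in> borel_measurable \<rho>" if "continuous_on circle h" for h :: "complex \<Rightarrow> complex"
    using borel_measurable_continuous_on_restrict[OF that] assms(2) measurable_cong_sets unfolding circle_borel_def by blast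
  have "(\<lambda>N. (\<integral>z. (\<Sum>m<N. (z ^ k * w) ^ m) / of_nat N \<partial>\<rho>)) \<longlonglongrightarrow> (\<integral>z. indicator A z \<partial>\<rho>)"
  proof (rule integral_dominated_convergence[where w = "\<lambda>_. 1"])
    show "AE z in \<rho>. (\<lambda>N. (\<Sum>m<N. (z ^ k * w) ^ m) / of_nat N) \<longlonglongrightarrow> indicator A z"
    proof (rule AE_I2)
      fix z assume "z \<in> space \<rho>"
      then show "(\<lambda>N. (\<Sum>m<N. (z ^ k * w) ^ m) / of_nat N) \<longlonglongrightarrow> indicator A z"
        using average_powers_tendsto[OF n1, of z] by (auto simp: A_def indicator_def sp)
    qed
    show "AE z in \<rho>. norm ((\<Sum>m<N. (z ^ k * w) ^ m) / of_nat N) \<le> 1" for N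
      by (intro AE_I2 average_powers_bound n1)
    show "(\<lambda>z. (\<Sum>m<N. (z ^ k * w) ^ m) / of_nat N) \<in> borel_measurable \<rho>" for N
      by (cases "N = 0") (auto intro!: m continuous_intros)
  qed (use A in auto)
  moreover have "(\<integral>z. (indicator A z :: complex) \<partial>\<rho>) = of_real (measure \<rho> A)"
  proof -
    have "(\<integral>z. (indicator A z :: complex) \<partial>\<rho>) = (\<integral>z. complex_of_real (indicator A z) \<partial>\<rho>)"
      by (intro Bochner_Integration.integral_cong) (auto simp: indicator_def)
    then show ?thesis using A sets.sets_into_space[OF A] by (simp only: integral_complex_of_real) (simp add: Int_absorb2)
  qed
  ultimately show ?thesis by (simp add: A_def)
qed

section \<open>Lebesgue measure on the circle and approximation by Laurent polynomials\<close>

lemma circle_lebesgue_sets: "sets circle_lebesgue = sets circle_borel"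
  by (simp add: circle_lebesgue_def)

lemma circle_lebesgue_map_measurable:
  "(\<lambda>t::real. cis (2 * pi * t)) \<in> measurable (restrict_space lborel {0..<1}) circle_borel"
  unfolding circle_borel_def
  by (intro measurable_restrict_space2 measurable_restrict_space1)
    (auto intro!: borel_measurable_continuous_onI continuous_intros)

lemma circle_lebesgue_prob_space: "prob_space circle_lebesgue"
  unfolding circle_lebesgue_def
  by (intro prob_space.prob_space_distr circle_lebesgue_map_measurable prob_space_restrict_space) auto

text \<open>For nonzero \<open>m\<close> the antiderivative \<open>F\<close> is 1-periodic, so the
  integral over a period vanishes. Adding the null endpoint makes the interval closed, as the
  fundamental theorem of calculus wants it.\<close>

lemma circle_lebesgue_powi: "(\<integral>z. z powi m \<partial>circle_lebesgue) = of_bool (m = 0)"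
proof (cases "m = 0")
  case True
  then show ?thesis using prob_space.prob_space[OF circle_lebesgue_prob_space] by simp
next
  case False
  define F where "F t = exp (2 * pi * m * \<i> * of_real t) / (2 * pi * m * \<i>)" for t :: real
  have F: "F t = cis (2 * pi * m * t) / (2 * pi * m * \<i>)" for t
    by (simp add: F_def cis_conv_exp mult_ac)
  have "(\<lambda>z. z powi m) \<in> borel_measurable circle_borel"
    unfolding circle_borel_def by (intro borel_measurable_continuous_on_restrict continuous_intros) auto
  then have "(\<integral>z. z powi m \<partial>circle_lebesgue) = (\<integral>t. cis (2 * pi * t) powi m \<partial>restrict_space lborel {0..<1::real})"
    unfolding circle_lebesgue_def by (intro integral_distr circle_lebesgue_map_measurable)
  also have "\<dots> = (\<integral>t. indicator {0..<1} t *\<^sub>R cis (2 * pi * m * t) \<partial>lborel)"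
    by (subst integral_restrict_space) (simp_all add: Complex.cis_power_int mult_ac)
  also have "\<dots> = (\<integral>t. indicator {0..1} t *\<^sub>R cis (2 * pi * m * t) \<partial>lborel)"
  proof (rule integral_cong_AE)
    show "AE t in lborel. indicator {0..<1} t *\<^sub>R cis (2 * pi * m * t) = indicator {0..1} t *\<^sub>R cis (2 * pi * m * t)"
      using AE_lborel_singleton[of "1::real"] by eventually_elim (auto simp: indicator_def)
    have [measurable]: "(\<lambda>t::real. cis (2 * pi * m * t)) \<in> borel_measurable borel"
      by (rule borel_measurable_continuous_onI) (intro continuous_intros)
    show "(\<lambda>t. indicator {0..<1} t *\<^sub>R cis (2 * pi * m * t)) \<in> borel_measurable lborel"
      "(\<lambda>t. indicator {0..1} t *\<^sub>R cis (2 * pi * m * t)) \<in> borel_measurable lborel"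
      by measurable
  qed
  also have "\<dots> = F 1 - F 0"
  proof (rule has_bochner_integral_integral_eq[OF has_bochner_integral_FTC_Icc])
    fix t :: real
    have "((\<lambda>z. exp (2 * pi * m * \<i> * z) / (2 * pi * m * \<i>)) has_field_derivative exp (2 * pi * m * \<i> * of_real t)) (at (of_real t))"
      using False by (auto intro!: derivative_eq_intros)
    from has_vector_derivative_real_field[OF this, of "{0..1}"]
    have "(F has_vector_derivative exp (2 * pi * m * \<i> * of_real t)) (at t within {0..1})" unfolding F_def[abs_def] .
    then show "(F has_vector_derivative cis (2 * pi * m * t)) (at t within {0..1})"
      by (simp add: cis_conv_exp mult_ac)
  qed (auto intro!: continuous_intros)
  also have "F 1 = F 0"
  proof -
    have "cis (2 * pi * of_int m) = 1" by (rule cis_multiple_2pi) simp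
    then show ?thesis by (simp add: F)
  qed
  finally show ?thesis using False by simp
qed

text \<open>On the circle the real and imaginary parts are Laurent polynomials in \<open>z\<close>,
  and these are closed under sums and products. This connects Stone-Weierstrass with the functional
  calculus.\<close>

lemma circle_tpoly_of_real_polynomial:
  assumes "real_polynomial_function p"
  shows "\<exists>q. \<forall>z\<in>circle. tpoly q z = complex_of_real (p z)"
  using assms
proof (induction rule: real_polynomial_function.induct)
  case (linear f)
  interpret bounded_linear f by fact
  have *: "f z = Re z * f 1 + Im z * f \<i>" for z
  proof -
    have "z = Re z *\<^sub>R 1 + Im z *\<^sub>R \<i>" by (simp add: complex_eq_iff)
    then show ?thesis by (metis add real_scaleR_def scale)
  qed
  \<comment> \<open>The coefficients come from \<open>Re z = (z + inverse z) / 2\<close> and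
    \<open>Im z = (z - inverse z) / (2 * \<i>)\<close>.\<close>
  have "tpoly [((f 1 - \<i> * f \<i>) / 2, 1), ((f 1 + \<i> * f \<i>) / 2, - 1)] z = of_real (f z)" if "z \<in> circle" for z
  proof -
    have "z * cnj z = 1" using that by (simp flip: complex_norm_square)
    then have "inverse z = cnj z" by (rule inverse_unique)
    then have "tpoly [((f 1 - \<i> * f \<i>) / 2, 1), ((f 1 + \<i> * f \<i>) / 2, - 1)] z =
      (f 1 - \<i> * f \<i>) / 2 * z + (f 1 + \<i> * f \<i>) / 2 * cnj z" by (simp add: power_int_minus)
    also have "\<dots> = of_real (f z)" unfolding *[of z] complex_eq_iff
      by (simp add: algebra_simps add_divide_distrib diff_divide_distrib)
    finally show ?thesis .
  qed
  then show ?case by blast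
next
  case (const c)
  have "\<forall>z\<in>circle. tpoly [(c, 0)] z = of_real c" by simp
  then show ?case by blast
next
  case (add f g)
  then obtain p q where "\<forall>z\<in>circle. tpoly p z = of_real (f z)" "\<forall>z\<in>circle. tpoly q z = of_real (g z)" by blast
  then have "\<forall>z\<in>circle. tpoly (p @ q) z = of_real (f z + g z)" by simp
  then show ?case by blast
next
  case (mult f g)
  then obtain p q where "\<forall>z\<in>circle. tpoly p z = of_real (f z)" "\<forall>z\<in>circle. tpoly q z = of_real (g z)" by blast
  then have "tpoly (tpoly_mult p q) z = of_real (f z * g z)" if "z \<in> circle" for z
    using that by (subst tpoly_mult) auto
  then show ?case by blast
qed

text \<open>The bumps \<phi> of slope \<open>j\<close> around \<open>K\<close> are approximated
  uniformly by Stone-Weierstrass. The common bound 2 serves dominated convergence; \<open>K\<close>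
  has to be nonempty because \<open>infdist\<close> to the empty set is 0.\<close>

lemma tpoly_approximates_compact:
  assumes "compact K" "K \<subseteq> circle" "K \<noteq> {}"
  obtains q where "\<And>j z. z \<in> circle \<Longrightarrow> cmod (tpoly (q j) z) \<le> 2"
    and "\<And>z. z \<in> circle \<Longrightarrow> (\<lambda>j. tpoly (q j) z) \<longlonglongrightarrow> indicator K z"
proof -
  define \<phi> where "\<phi> j z = max 0 (1 - real j * infdist z K)" for j :: nat and z :: complex
  have cont: "continuous_on circle (\<phi> j)" for j unfolding \<phi>_def by (intro continuous_intros)
  have "\<exists>q. \<forall>z\<in>circle. cmod (tpoly q z - of_real (\<phi> j z)) < 1 / real (Suc j)" for j
  proof -
    obtain p where p: "real_polynomial_function p" "\<And>z. z \<in> circle \<Longrightarrow> \<bar>\<phi> j z - p z\<bar> < 1 / real (Suc j)"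
      by (rule Stone_Weierstrass_real_polynomial_function[OF _ cont, of "1 / real (Suc j)" j]) auto
    obtain q where q: "\<forall>z\<in>circle. tpoly q z = complex_of_real (p z)"
      using circle_tpoly_of_real_polynomial[OF p(1)] by blast
    have "cmod (tpoly q z - of_real (\<phi> j z)) = \<bar>\<phi> j z - p z\<bar>" if "z \<in> circle" for z
      using q that by (simp flip: of_real_diff add: abs_minus_commute)
    then show ?thesis using p(2) by metis
  qed
  then obtain q where q: "\<And>j z. z \<in> circle \<Longrightarrow> cmod (tpoly (q j) z - of_real (\<phi> j z)) < 1 / real (Suc j)" by metis
  show ?thesis
  proof (rule that[of q])
    fix j z assume z: "z \<in> circle"
    have "0 \<le> \<phi> j z" "\<phi> j z \<le> 1" by (auto simp: \<phi>_def infdist_nonneg)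
    then have "cmod (of_real (\<phi> j z)) \<le> 1" unfolding norm_of_real by linarith
    moreover have "1 / real (Suc j) \<le> 1" by simp
    ultimately show "cmod (tpoly (q j) z) \<le> 2"
      using q[OF z, of j] norm_triangle_sub[of "tpoly (q j) z" "of_real (\<phi> j z)"] by linarith
  next
    fix z assume z: "z \<in> circle"
    have "(\<lambda>j. \<phi> j z) \<longlonglongrightarrow> indicator K z"
    proof (cases "z \<in> K")
      case True
      then show ?thesis by (simp add: \<phi>_def)
    next
      case False
      have "closed K" using assms(1) by (rule compact_imp_closed)
      then have d: "infdist z K > 0" using False assms(3) by (simp add: infdist_pos_not_in_closed)
      obtain J where J: "1 / infdist z K < real J" using reals_Archimedean2 by blast
      have "\<phi> j z = 0" if "j \<ge> J" for j
      proof -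
        have "1 / infdist z K < real j" using J that by linarith
        then show ?thesis using d by (simp add: \<phi>_def divide_less_eq)
      qed
      then have "eventually (\<lambda>j. \<phi> j z = 0) sequentially" using eventually_sequentially by blast
      then show ?thesis using False by (simp add: tendsto_eventually)
    qed
    then have "(\<lambda>j. complex_of_real (\<phi> j z)) \<longlonglongrightarrow> of_real (indicator K z)" by (rule tendsto_of_real)
    moreover have "(\<lambda>j. tpoly (q j) z - of_real (\<phi> j z)) \<longlonglongrightarrow> 0"
    proof (rule Lim_null_comparison[OF _ LIMSEQ_inverse_real_of_nat], intro always_eventually allI)
      show "cmod (tpoly (q j) z - of_real (\<phi> j z)) \<le> inverse (real (Suc j))" for j
        using q[OF z, of j] by (simp add: inverse_eq_divide)
    qed
    ultimately have "(\<lambda>j. (tpoly (q j) z - of_real (\<phi> j z)) + of_real (\<phi> j z)) \<longlonglongrightarrow> 0 + of_real (indicator K z)"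
      by (intro tendsto_add)
    then show "(\<lambda>j. tpoly (q j) z) \<longlonglongrightarrow> indicator K z"
      by (cases "z \<in> K") simp_all
  qed
qed

text \<open>One and the same sequence converges to \<open>c\<close> in square mean for \<rho> and to
  0 for Lebesgue measure. Almost everywhere convergence along a subsequence then separates the two
  measures, as no point admits both limits.\<close>

lemma mutually_singular_circle_lebesgue:
  assumes "finite_measure \<rho>" "sets \<rho> = sets circle_borel" "c \<noteq> 0"
    and "\<And>n. continuous_on circle (A n)"
    and "(\<lambda>n. \<integral>z. (cmod (A n z - c))\<^sup>2 \<partial>\<rho>) \<longlonglongrightarrow> 0"
    and "(\<lambda>n. \<integral>z. (cmod (A n z))\<^sup>2 \<partial>circle_lebesgue) \<longlonglongrightarrow> 0"
  shows "mutually_singular \<rho> circle_lebesgue"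
proof -
  have fin: "finite_measure circle_lebesgue" using circle_lebesgue_prob_space by (rule prob_space.finite_measure)
  have integ: "integrable \<tau> h" if "continuous_on circle h" "finite_measure \<tau>" "sets \<tau> = sets circle_borel"
    for h :: "complex \<Rightarrow> real" and \<tau>
  proof -
    have "space \<tau> = circle"
      using sets_eq_imp_space_eq[OF that(3)] by (simp add: circle_borel_def space_restrict_space)
    have "compact (h ` circle)" by (intro compact_continuous_image that) simp
    then obtain B where "\<And>z. z \<in> circle \<Longrightarrow> norm (h z) \<le> B"
      by (metis bounded_iff compact_imp_bounded image_eqI)
    moreover have "h \<in> borel_measurable \<tau>"
      using borel_measurable_continuous_on_restrict[OF that(1)] that(3) measurable_cong_sets unfolding circle_borel_def by blast
    ultimately show ?thesis using that(2) \<open>space \<tau> = circle\<close>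
      by (intro finite_measure.integrable_const_bound[where B=B]) auto
  qed
  have "\<exists>r::nat\<Rightarrow>nat. strict_mono r \<and> (AE z in \<rho>. (\<lambda>n. (cmod (A (r n) z - c))\<^sup>2) \<longlonglongrightarrow> 0)"
    using assms by (intro tendsto_L1_AE_subseq integ continuous_intros) auto
  then obtain r where r: "strict_mono r" "AE z in \<rho>. (\<lambda>n. (cmod (A (r n) z - c))\<^sup>2) \<longlonglongrightarrow> 0" by blast
  have "(\<lambda>n. \<integral>z. (cmod (A (r n) z))\<^sup>2 \<partial>circle_lebesgue) \<longlonglongrightarrow> 0"
    using LIMSEQ_subseq_LIMSEQ[OF assms(6) r(1)] by (simp add: comp_def)
  \<comment> \<open>The second subsequence is extracted from the first, so that both limits hold
    along a common one.\<close>
  then have "\<exists>s::nat\<Rightarrow>nat. strict_mono s \<and> (AE z in circle_lebesgue. (\<lambda>n. (cmod (A (r (s n)) z))\<^sup>2) \<longlonglongrightarrow> 0)"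
    using assms(4) fin by (intro tendsto_L1_AE_subseq integ continuous_intros circle_lebesgue_sets) auto
  then obtain s where s: "strict_mono s" "AE z in circle_lebesgue. (\<lambda>n. (cmod (A (r (s n)) z))\<^sup>2) \<longlonglongrightarrow> 0" by blast
  obtain N1 where N1: "N1 \<in> null_sets \<rho>" "{z \<in> space \<rho>. \<not> (\<lambda>n. (cmod (A (r n) z - c))\<^sup>2) \<longlonglongrightarrow> 0} \<subseteq> N1"
    using r(2) unfolding eventually_ae_filter by blast
  obtain N2 where N2: "N2 \<in> null_sets circle_lebesgue" "{z \<in> space circle_lebesgue. \<not> (\<lambda>n. (cmod (A (r (s n)) z))\<^sup>2) \<longlonglongrightarrow> 0} \<subseteq> N2"
    using s(2) unfolding eventually_ae_filter by blast
  define N where "N = space \<rho> - N1"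
  have sp: "space \<rho> = space circle_lebesgue" using assms(2) circle_lebesgue_sets sets_eq_imp_space_eq by metis
  have sets: "sets \<rho> = sets circle_lebesgue" using assms(2) circle_lebesgue_sets by simp
  have N: "N \<in> sets \<rho>" using N1(1) unfolding N_def by auto
  have "N \<subseteq> N2"
  proof
    fix z assume z: "z \<in> N"
    then have "(\<lambda>n. (cmod (A (r n) z - c))\<^sup>2) \<longlonglongrightarrow> 0" using N1(2) by (auto simp: N_def)
    then have 1: "(\<lambda>n. (cmod (A (r (s n)) z - c))\<^sup>2) \<longlonglongrightarrow> 0"
      using LIMSEQ_subseq_LIMSEQ[OF _ s(1), of "\<lambda>n. (cmod (A (r n) z - c))\<^sup>2" 0] by (simp add: comp_def)
    show "z \<in> N2"
    proof (rule ccontr)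
      assume "z \<notin> N2"
      then have 2: "(\<lambda>n. (cmod (A (r (s n)) z))\<^sup>2) \<longlonglongrightarrow> 0" using N2(2) z sp by (auto simp: N_def)
      from 1 have "(\<lambda>n. A (r (s n)) z - c) \<longlonglongrightarrow> 0" by (simp add: tendsto_norm_zero_iff)
      then have "(\<lambda>n. A (r (s n)) z) \<longlonglongrightarrow> c" by (simp add: Lim_null[symmetric])
      moreover from 2 have "(\<lambda>n. A (r (s n)) z) \<longlonglongrightarrow> 0" by (simp add: tendsto_norm_zero_iff)
      ultimately show False using assms(3) LIMSEQ_unique by blast
    qed
  qed
  moreover have "N \<in> sets circle_lebesgue" using N unfolding sets .
  ultimately have "emeasure circle_lebesgue N = 0" using null_sets_subset[OF N2(1)] by (metis null_setsD1)
  moreover have "space \<rho> - N = N1" using sets.sets_into_space[OF null_setsD2[OF N1(1)]] unfolding N_def by blast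
  ultimately show ?thesis unfolding mutually_singular_def using N null_setsD1[OF N1(1)] \<open>N \<in> sets circle_lebesgue\<close> by metis
qed


section \<open>Absolute continuity of spectral measures in the limit\<close>

lemma le_mult_sqrt_imp_zero:
  fixes m :: real
  assumes "m \<ge> 0" "\<And>\<epsilon>. \<epsilon> > 0 \<Longrightarrow> m \<le> \<epsilon> * sqrt m"
  shows "m = 0"
proof (rule ccontr)
  assume "m \<noteq> 0"
  then have m: "m > 0" using assms(1) by simp
  have "m \<le> (sqrt m / 2) * sqrt m" using m by (intro assms(2)) simp
  also have "\<dots> = m / 2" using m by simp
  finally show False using m by simp
qed

context koopman
begin

text \<open>Testing \<open>g\<close> against \<open>q(U)\<^sup>* q(U) g\<close> with \<open>q\<close> close to the indicator of \<open>K\<close> brings in only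
  \<open>\<parallel>q(U) f\<parallel>\<close> and the fourth moment of \<open>q\<close>, so no bound on the operator norm of \<open>q(U)\<close> is needed.\<close>

lemma spectral_compact_null:
  assumes g: "g \<in> L2 M" "is_spectral_measure M g \<rho>"
    and approx: "\<And>\<epsilon>. \<epsilon> > 0 \<Longrightarrow> \<exists>f\<in>L2 M. L2_norm M (\<lambda>x. g x - f x) \<le> \<epsilon> \<and>
       (\<exists>C. \<forall>q. (L2_norm M (tpoly_op q f))\<^sup>2 \<le> C * (\<integral>z. (cmod (tpoly q z))\<^sup>2 \<partial>circle_lebesgue))"
    and K: "compact K" "K \<subseteq> circle" "emeasure circle_lebesgue K = 0"
  shows "measure \<rho> K = 0"
proof (cases "K = {}")
  case False
  obtain q where q: "\<And>j z. z \<in> circle \<Longrightarrow> cmod (tpoly (q j) z) \<le> 2"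
    "\<And>z. z \<in> circle \<Longrightarrow> (\<lambda>j. tpoly (q j) z) \<longlonglongrightarrow> indicator K z"
    using tpoly_approximates_compact[OF K(1,2) False] by metis
  have fin: "finite_measure circle_lebesgue" using circle_lebesgue_prob_space by (rule prob_space.finite_measure)
  have lim: "(\<lambda>j. \<integral>z. (cmod (tpoly (q j) z)) ^ n \<partial>\<tau>) \<longlonglongrightarrow> measure \<tau> K"
    if "finite_measure \<tau>" "sets \<tau> = sets circle_borel" "n > 0" for \<tau> n
  proof -
    interpret \<tau>: finite_measure \<tau> by fact
    have sp: "space \<tau> = circle"
      using sets_eq_imp_space_eq[OF that(2)] by (simp add: circle_borel_def space_restrict_space)
    have KS: "K \<in> sets \<tau>" using K(1,2) unfolding that(2) circle_borel_iff by (simp add: borel_compact)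
    have "(\<lambda>j. \<integral>z. (cmod (tpoly (q j) z)) ^ n \<partial>\<tau>) \<longlonglongrightarrow> (\<integral>z. indicator K z \<partial>\<tau>)"
    proof (rule integral_dominated_convergence[where w = "\<lambda>_. 2 ^ n"])
      show "AE z in \<tau>. (\<lambda>j. (cmod (tpoly (q j) z)) ^ n) \<longlonglongrightarrow> indicator K z"
      proof (rule AE_I2)
        fix z assume "z \<in> space \<tau>"
        then have "(\<lambda>j. (cmod (tpoly (q j) z)) ^ n) \<longlonglongrightarrow> (cmod (indicator K z)) ^ n"
          by (intro tendsto_intros q(2)) (simp add: sp)
        then show "(\<lambda>j. (cmod (tpoly (q j) z)) ^ n) \<longlonglongrightarrow> indicator K z"
          using that(3) by (cases "z \<in> K") (auto simp: power_0_left)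
      qed
      show "AE z in \<tau>. norm ((cmod (tpoly (q j) z)) ^ n) \<le> 2 ^ n" for j
        using q(1) by (intro AE_I2) (auto simp: sp intro!: power_mono)
      have "continuous_on circle (\<lambda>z. (cmod (tpoly (q j) z)) ^ n)" for j
        by (intro continuous_intros tpoly_continuous)
      then show "(\<lambda>z. (cmod (tpoly (q j) z)) ^ n) \<in> borel_measurable \<tau>" for j
        using borel_measurable_continuous_on_restrict that(2) measurable_cong_sets unfolding circle_borel_def by blast
    qed (use KS in auto)
    then show ?thesis using KS sp K(2) by (simp add: Int_absorb2)
  qed
  define a where "a j = (\<integral>z. (cmod (tpoly (q j) z))\<^sup>2 \<partial>\<rho>)" for j
  define b where "b j = (\<integral>z. (cmod (tpoly (q j) z))\<^sup>2 \<partial>circle_lebesgue)" for j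
  define d where "d j = (\<integral>z. (cmod (tpoly (q j) z)) ^ 4 \<partial>\<rho>)" for j
  have a: "a \<longlonglongrightarrow> measure \<rho> K" and d: "d \<longlonglongrightarrow> measure \<rho> K"
    unfolding a_def[abs_def] d_def[abs_def] by (intro lim spectral_finite[OF g] spectral_sets[OF g]; simp)+
  have b: "b \<longlonglongrightarrow> 0"
    using lim[OF fin circle_lebesgue_sets, of 2] K(3) by (simp add: b_def[abs_def] measure_def)
  have "measure \<rho> K \<le> \<epsilon> * sqrt (measure \<rho> K)" if "\<epsilon> > 0" for \<epsilon>
  proof -
    obtain f C where f: "f \<in> L2 M" "L2_norm M (\<lambda>x. g x - f x) \<le> \<epsilon>"
      "\<And>q. (L2_norm M (tpoly_op q f))\<^sup>2 \<le> C * (\<integral>z. (cmod (tpoly q z))\<^sup>2 \<partial>circle_lebesgue)"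
      using approx[of \<epsilon>] \<open>\<epsilon> > 0\<close> by metis
    have ineq: "a j \<le> sqrt (C * b j) * sqrt (a j) + \<epsilon> * sqrt (d j)" for j
    proof -
      let ?q = "q j"
      let ?r = "tpoly_mult (tpoly_cnj ?q) ?q"
      note L2s = g(1) f(1) tpoly_op_L2 L2_diff
      have "a j = cmod (complex_of_real ((L2_norm M (tpoly_op ?q g))\<^sup>2))"
        unfolding spectral_tpoly_norm[OF g] by (simp add: a_def)
      also have "\<dots> = cmod (L2_inner M g (tpoly_op ?r g))"
        unfolding L2_inner_self[symmetric] tpoly_op_norm[OF g(1) g(1)] ..
      also have "L2_inner M g (tpoly_op ?r g) = L2_inner M f (tpoly_op ?r g) + L2_inner M (\<lambda>x. g x - f x) (tpoly_op ?r g)"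
        by (simp add: L2_inner_diff_left L2s)
      also have "L2_inner M f (tpoly_op ?r g) = L2_inner M (tpoly_op ?q f) (tpoly_op ?q g)"
        by (rule tpoly_op_norm[symmetric]) (rule L2s)+
      also have "cmod (L2_inner M (tpoly_op ?q f) (tpoly_op ?q g) + L2_inner M (\<lambda>x. g x - f x) (tpoly_op ?r g)) \<le>
         L2_norm M (tpoly_op ?q f) * L2_norm M (tpoly_op ?q g) + L2_norm M (\<lambda>x. g x - f x) * L2_norm M (tpoly_op ?r g)"
        by (intro order_trans[OF norm_triangle_ineq] add_mono L2_Cauchy_Schwarz L2s)
      also have "\<dots> \<le> sqrt (C * b j) * sqrt (a j) + \<epsilon> * sqrt (d j)"
      proof (intro add_mono mult_mono)
        show "L2_norm M (tpoly_op ?q f) \<le> sqrt (C * b j)" using f(3)[of ?q] by (simp add: b_def real_le_rsqrt)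
        then show "0 \<le> sqrt (C * b j)" using L2_norm_nonneg order_trans by blast
        show "L2_norm M (tpoly_op ?q g) \<le> sqrt (a j)" using spectral_tpoly_norm[OF g, of ?q] by (simp add: a_def real_le_rsqrt)
        have "(L2_norm M (tpoly_op ?r g))\<^sup>2 = d j" unfolding spectral_tpoly_norm[OF g] d_def
        proof (rule Bochner_Integration.integral_cong[OF refl])
          fix z assume "z \<in> space \<rho>"
          then have "cmod z = 1" using spectral_space[OF g] by simp
          moreover from this have "z \<noteq> 0" by auto
          ultimately show "(cmod (tpoly ?r z))\<^sup>2 = cmod (tpoly ?q z) ^ 4"
            by (simp add: tpoly_mult tpoly_cnj norm_mult power2_eq_square power4_eq_xxxx)
        qed
        then show "L2_norm M (tpoly_op ?r g) \<le> sqrt (d j)" by (simp add: real_le_rsqrt)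
      qed (use f(2) that in \<open>auto simp: L2_norm_nonneg\<close>)
      finally show ?thesis .
    qed
    \<comment> \<open>The first term vanishes in the limit because \<open>K\<close> is Lebesgue
      null; second and fourth moments have the same limit because powers of an indicator
      agree.\<close>
    have "(\<lambda>j. sqrt (C * b j) * sqrt (a j) + \<epsilon> * sqrt (d j)) \<longlonglongrightarrow> sqrt (C * 0) * sqrt (measure \<rho> K) + \<epsilon> * sqrt (measure \<rho> K)"
      by (intro tendsto_intros a b d)
    then show ?thesis using a ineq by (simp add: LIMSEQ_le)
  qed
  then show ?thesis by (intro le_mult_sqrt_imp_zero) auto
qed simp

text \<open>Inner regularity reduces a Lebesgue null set to its compact subsets, on which the
  polynomial approximation works.\<close>

lemma spectral_absolutely_continuous:
  assumes g: "g \<in> L2 M" "is_spectral_measure M g \<rho>"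
    and approx: "\<And>\<epsilon>. \<epsilon> > 0 \<Longrightarrow> \<exists>f\<in>L2 M. L2_norm M (\<lambda>x. g x - f x) \<le> \<epsilon> \<and>
       (\<exists>C. \<forall>q. (L2_norm M (tpoly_op q f))\<^sup>2 \<le> C * (\<integral>z. (cmod (tpoly q z))\<^sup>2 \<partial>circle_lebesgue))"
  shows "absolutely_continuous circle_lebesgue \<rho>"
  unfolding absolutely_continuous_def
proof
  fix E assume E: "E \<in> null_sets circle_lebesgue"
  interpret \<rho>: finite_measure \<rho> by (rule spectral_finite[OF g])
  have ES: "E \<in> sets \<rho>" using null_setsD2[OF E] spectral_sets[OF g] circle_lebesgue_sets by simp
  have Eb: "E \<in> sets borel" "E \<subseteq> circle" using ES unfolding spectral_sets[OF g] circle_borel_iff by auto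
  have id: "(\<lambda>z. z) \<in> measurable \<rho> borel" by (rule circle_measurable[OF g]) simp
  \<comment> \<open>Inner regularity concerns Borel measures on the whole plane, so \<rho> is pushed
    forward from the circle along the inclusion.\<close>
  define \<tau> where "\<tau> = distr \<rho> borel (\<lambda>z. z)"
  have \<tau>: "emeasure \<tau> A = emeasure \<rho> A" if "A \<in> sets borel" "A \<subseteq> circle" for A
    unfolding \<tau>_def using that by (subst emeasure_distr[OF id]) (auto simp: spectral_space[OF g] Int_absorb2)
  have "emeasure \<tau> (space \<tau>) \<noteq> \<infinity>"
    unfolding \<tau>_def by (subst emeasure_distr[OF id]) auto
  then have "emeasure \<tau> E = (SUP K\<in>{K. K \<subseteq> E \<and> compact K}. emeasure \<tau> K)"
    using Eb(1) by (intro inner_regular) (simp_all add: \<tau>_def)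
  also have "\<dots> = 0"
  proof -
    have "emeasure \<tau> K = 0" if K: "K \<subseteq> E" "compact K" for K
    proof -
      have Kc: "K \<subseteq> circle" "K \<in> sets borel" using K Eb borel_compact by auto
      then have "K \<in> sets circle_lebesgue" unfolding circle_lebesgue_sets circle_borel_iff by simp
      then have "emeasure circle_lebesgue K = 0" using null_sets_subset[OF E _ K(1)] by blast
      then have "measure \<rho> K = 0" using spectral_compact_null[OF g approx K(2) Kc(1)] by blast
      then show ?thesis using \<tau>[OF Kc(2,1)] \<rho>.emeasure_eq_measure[of K] by simp
    qed
    then show ?thesis by (simp add: SUP_eq_const[of _ _ 0] SUP_eqI)
  qed
  finally show "E \<in> null_sets \<rho>" using \<tau>[OF Eb] ES by auto
qed

end


section \<open>The odometer coordinate as a random variable\<close>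

lemma shift_power_continuous: "continuous_on UNIV (shift_power n :: (int \<Rightarrow> 'a::topological_space) \<Rightarrow> _)"
  unfolding shift_power_def[abs_def]
  by (intro continuous_on_coordinatewise_then_product continuous_on_product_coordinates)

locale subshift_measure =
  fixes \<alpha> :: complex and \<mu> :: "(int \<Rightarrow> letter) measure"
  assumes norm_\<alpha>: "norm \<alpha> = 1" and inv: "invariant_probability (X_rho \<alpha>) \<mu>"
begin

lemma sets_\<mu>: "sets \<mu> = sets (restrict_space borel (X_rho \<alpha>))"
  using inv by (simp add: invariant_probability_def)

lemma space_\<mu>: "space \<mu> = X_rho \<alpha>"
  using sets_eq_imp_space_eq[OF sets_\<mu>] by (simp add: space_restrict_space)

lemma measurable_\<mu>:
  assumes "f \<in> borel_measurable borel" shows "f \<in> borel_measurable \<mu>"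
  using measurable_restrict_space1[OF assms] measurable_cong_sets[OF sets_\<mu> refl] by blast

lemma shift_measurable_\<mu>: "shift_power n \<in> measurable \<mu> \<mu>"
proof -
  have "shift_power n \<in> measurable (restrict_space borel (X_rho \<alpha>)) (restrict_space borel (X_rho \<alpha>))"
    by (intro measurable_restrict_space2 measurable_restrict_space1 borel_measurable_continuous_onI shift_power_continuous)
      (auto simp: space_restrict_space shift_power_X_rho)
  then show ?thesis using measurable_cong_sets[OF sets_\<mu> sets_\<mu>] by blast
qed

text \<open>Invariance is given for a single step. Positive powers follow by induction; for a
  negative power, replace \<mu> by its image under the opposite positive power and let the two
  shifts cancel.\<close>

sublocale koopman \<mu>
proof -
  interpret prob_space \<mu> using inv by (simp add: invariant_probability_def)
  have 1: "distr \<mu> \<mu> (shift_power 1) = \<mu>" using inv by (simp add: invariant_probability_def)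
  have comp: "shift_power a \<circ> shift_power b = (shift_power (a + b) :: (int \<Rightarrow> letter) \<Rightarrow> _)" for a b
    by (simp add: fun_eq_iff shift_power_add)
  have pos: "distr \<mu> \<mu> (shift_power (int k)) = \<mu>" for k
  proof (induction k)
    case 0
    have "distr \<mu> \<mu> (shift_power 0) = distr \<mu> \<mu> (\<lambda>x. x)" by (intro distr_cong) auto
    then show ?case by (simp add: distr_id)
  next
    case (Suc k)
    have "distr (distr \<mu> \<mu> (shift_power 1)) \<mu> (shift_power (int k)) = distr \<mu> \<mu> (shift_power (int (Suc k)))"
      by (subst distr_distr[OF shift_measurable_\<mu> shift_measurable_\<mu>]) (simp add: comp add.commute)
    then show ?case using Suc by (simp add: 1)
  qed
  have neg: "distr \<mu> \<mu> (shift_power (- int k)) = \<mu>" for k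
  proof -
    have "distr (distr \<mu> \<mu> (shift_power (int k))) \<mu> (shift_power (- int k)) = distr \<mu> \<mu> (shift_power 0)"
      by (subst distr_distr[OF shift_measurable_\<mu> shift_measurable_\<mu>]) (simp add: comp)
    then show ?thesis using pos[of k] pos[of 0] by simp
  qed
  show "koopman \<mu>"
    by unfold_locales (use shift_measurable_\<mu> pos neg in \<open>metis int_cases2\<close>)+
qed

lemma spin_measurable: "(\<lambda>x. fst (x i)) \<in> borel_measurable \<mu>"
  by (intro measurable_\<mu> borel_measurable_continuous_onI continuous_intros continuous_on_product_coordinates)

text \<open>Measurability of letter-valued maps is expressed coordinatewise, since the marker type carries no
  second countability instance.\<close>

definition sequence_measurable :: "((int \<Rightarrow> letter) \<Rightarrow> (int \<Rightarrow> letter)) \<Rightarrow> bool" where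
  "sequence_measurable F \<longleftrightarrow> (\<forall>i. (\<lambda>x. fst (F x i)) \<in> borel_measurable \<mu> \<and> Measurable.pred \<mu> (\<lambda>x. snd (F x i)))"

lemma sequence_measurable_id: "sequence_measurable (\<lambda>x. x)"
proof -
  have "Measurable.pred \<mu> (\<lambda>x. snd (x i))" for i
  proof -
    have "open {x :: int \<Rightarrow> letter. snd (x i)}"
    proof -
      have "continuous_on UNIV (\<lambda>x :: int \<Rightarrow> letter. snd (x i))"
        by (intro continuous_intros continuous_on_product_coordinates)
      then have "open ((\<lambda>x :: int \<Rightarrow> letter. snd (x i)) -` {True})"
        by (rule open_vimage[rotated]) (rule discrete_topology_class.open_discrete)
      then show ?thesis by (simp add: vimage_def)
    qed
    then have "{x. snd (x i)} \<in> sets (borel :: (int \<Rightarrow> letter) measure)" by simp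
    then have "X_rho \<alpha> \<inter> {x. snd (x i)} \<in> sets \<mu>"
      unfolding sets_\<mu> sets_restrict_space by auto
    then show ?thesis unfolding pred_def space_\<mu> by (simp add: Collect_conj_eq)
  qed
  then show ?thesis using spin_measurable by (simp add: sequence_measurable_def)
qed

lemma sequence_measurable_desub:
  assumes "sequence_measurable F"
  shows "sequence_measurable (\<lambda>x. desub \<alpha> (F x))"
proof -
  have [measurable]: "(\<lambda>x. fst (F x i)) \<in> borel_measurable \<mu>" "Measurable.pred \<mu> (\<lambda>x. snd (F x i))" for i
    using assms by (auto simp: sequence_measurable_def)
  have eq: "desub \<alpha> y i = (if snd (y 0) then desub_letter \<alpha> (fst (y (2 * i - 1))) (fst (y (2 * i)))
     else desub_letter \<alpha> (fst (y (2 * i))) (fst (y (2 * i + 1))))" for y i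
    by (simp add: desub_def phase_def)
  have 1: "(\<lambda>x. fst (desub_letter \<alpha> (fst (F x i)) (fst (F x j)))) \<in> borel_measurable \<mu>" for i j
  proof -
    have "fst (desub_letter \<alpha> p q) = (if q = - p then p else p / \<alpha>)" for p q by (simp add: desub_letter_def)
    then show ?thesis by simp
  qed
  have 2: "Measurable.pred \<mu> (\<lambda>x. snd (desub_letter \<alpha> (fst (F x i)) (fst (F x j))))" for i j
  proof -
    have "snd (desub_letter \<alpha> p q) \<longleftrightarrow> q \<noteq> - p" for p q by (simp add: desub_letter_def)
    moreover have "(\<lambda>x. fst (F x j) + fst (F x i)) -` (- {0}) \<inter> space \<mu> \<in> sets \<mu>"
      by (rule measurable_sets[of _ \<mu> borel]) simp_all
    moreover have "(\<lambda>x. fst (F x j) + fst (F x i)) -` (- {0}) \<inter> space \<mu> = {x \<in> space \<mu>. fst (F x j) \<noteq> - fst (F x i)}"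
      by (auto simp: add_eq_0_iff2)
    ultimately show ?thesis unfolding pred_def by simp
  qed
  note [measurable] = 1 2
  have "fst (desub \<alpha> y i) = (if snd (y 0) then fst (desub_letter \<alpha> (fst (y (2 * i - 1))) (fst (y (2 * i))))
     else fst (desub_letter \<alpha> (fst (y (2 * i))) (fst (y (2 * i + 1)))))" for y i by (simp add: eq)
  moreover have "snd (desub \<alpha> y i) \<longleftrightarrow> (if snd (y 0) then snd (desub_letter \<alpha> (fst (y (2 * i - 1))) (fst (y (2 * i))))
     else snd (desub_letter \<alpha> (fst (y (2 * i))) (fst (y (2 * i + 1)))))" for y i by (simp add: eq)
  ultimately show ?thesis unfolding sequence_measurable_def by simp
qed

lemma residue_measurable: "(\<lambda>x. residue \<alpha> x k) \<in> measurable \<mu> (count_space UNIV)"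
proof (induction k)
  case (Suc k)
  have "sequence_measurable (\<lambda>x. (desub \<alpha> ^^ k) x)"
    by (induction k) (simp_all add: sequence_measurable_id sequence_measurable_desub)
  then have [measurable]: "Measurable.pred \<mu> (\<lambda>x. snd ((desub \<alpha> ^^ k) x 0))" by (simp add: sequence_measurable_def)
  note [measurable] = Suc
  show ?case unfolding residue.simps phase_def of_bool_def by measurable
qed simp

lemma residue_set_measurable: "{x \<in> space \<mu>. P (residue \<alpha> x k)} \<in> sets \<mu>"
  using residue_measurable[of k] by measurable

lemma residue_shift_\<mu>:
  assumes "x \<in> space \<mu>"
  shows "int (residue \<alpha> (shift_power n x) k) = (int (residue \<alpha> x k) + n) mod 2 ^ k"
  using residue_shift[OF _ norm_\<alpha>] assms by (simp add: space_\<mu>)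

text \<open>Shifting by \<open>- j\<close> carries the class of \<open>j\<close> to the class of 0,
  so the \<open>2 ^ k\<close> disjoint classes have equal probability.\<close>

lemma residue_measure:
  assumes "j < 2 ^ k"
  shows "prob {x \<in> space \<mu>. residue \<alpha> x k = j} = 1 / 2 ^ k"
proof -
  define A where "A j = {x \<in> space \<mu>. residue \<alpha> x k = j}" for j
  have A: "A j \<in> sets \<mu>" for j unfolding A_def by (rule residue_set_measurable)
  have eq: "prob (A j) = prob (A 0)" if "j < 2 ^ k" for j
  proof -
    have "shift_power (- int j) -` A 0 \<inter> space \<mu> = A j"
    proof (rule set_eqI)
      fix x
      have "residue \<alpha> (shift_power (- int j) x) k = 0 \<longleftrightarrow> residue \<alpha> x k = j" if "x \<in> space \<mu>"
      proof -
        have "residue \<alpha> (shift_power (- int j) x) k = 0 \<longleftrightarrow> (int (residue \<alpha> x k) + - int j) mod 2 ^ k = 0"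
          using residue_shift_\<mu>[OF that, of "- int j" k] by (metis of_nat_eq_0_iff)
        also have "\<dots> \<longleftrightarrow> int (residue \<alpha> x k) mod 2 ^ k = int j mod 2 ^ k"
          by (simp add: mod_eq_dvd_iff dvd_eq_mod_eq_0)
        also have "\<dots> \<longleftrightarrow> residue \<alpha> x k = j"
          using residue_less[of \<alpha> x k] \<open>j < 2 ^ k\<close> by simp
        finally show ?thesis .
      qed
      then show "x \<in> shift_power (- int j) -` A 0 \<inter> space \<mu> \<longleftrightarrow> x \<in> A j"
        using measurable_space[OF shift_measurable_\<mu>] by (auto simp: A_def)
    qed
    then show ?thesis using measure_distr[OF shift_measurable_\<mu>[of "- int j"] A[of 0]] by (simp add: shift_invariant)
  qed
  have "1 = prob (\<Union>j<2 ^ k. A j)"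
  proof -
    have "(\<Union>j<2 ^ k. A j) = space \<mu>" using residue_less by (auto simp: A_def)
    then show ?thesis by (simp add: prob_space)
  qed
  also have "\<dots> = (\<Sum>j<2 ^ k. prob (A j))"
  proof (rule finite_measure_finite_Union)
    show "disjoint_family_on A {..<2 ^ k}" unfolding disjoint_family_on_def A_def by blast
  qed (use A in blast)+
  also have "\<dots> = (\<Sum>j<(2::nat) ^ k. prob (A 0))" by (intro sum.cong refl eq) simp
  finally have "prob (A 0) = 1 / 2 ^ k" by (simp add: eq_divide_eq mult.commute)
  then show ?thesis using eq[OF assms] by (simp add: A_def)
qed

end


section \<open>Cylinder vectors\<close>

lemma lowest_bit:
  fixes j :: nat assumes "j > 0" obtains i m where "j = 2 ^ i * (2 * m + 1)"
  using assms
proof (induction j arbitrary: thesis rule: less_induct)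
  case (less j)
  show ?case
  proof (cases "even j")
    case True
    then obtain l where l: "j = 2 * l" by blast
    then obtain i m where "l = 2 ^ i * (2 * m + 1)" using less.IH[of l] less.prems(2) by auto
    then show ?thesis using less.prems(1)[of "Suc i" m] l by simp
  next
    case False
    then show ?thesis using less.prems(1)[of 0] by (auto elim: oddE)
  qed
qed

locale subshift_character = subshift_measure +
  fixes n :: int
begin

abbreviation "\<beta> \<equiv> chi n \<alpha>"
abbreviation "\<sigma> \<equiv> chi n (- 1)"

lemma chi_mult: "chi n (a * b) = chi n a * chi n b"
  by (simp add: chi_def power_int_mult_distrib)

lemma norm_chi: "norm a = 1 \<Longrightarrow> norm (chi n a) = 1"
  by (simp add: chi_def norm_power_int)

lemma norm_\<beta>: "norm \<beta> = 1" and norm_\<sigma>: "norm \<sigma> = 1"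
  by (simp_all add: norm_chi norm_\<alpha>)

lemma chi_1 [simp]: "chi n 1 = 1" by (simp add: chi_def)

definition cyl :: "nat \<Rightarrow> nat \<Rightarrow> (int \<Rightarrow> letter) \<Rightarrow> complex" where
  "cyl K j x = (if residue \<alpha> x K = j then chi n (fst (x 0)) else 0)"

lemma norm_spin: "x \<in> space \<mu> \<Longrightarrow> norm (fst (x i)) = 1"
  using X_rho_alphabet[of x \<alpha> i] by (auto simp: space_\<mu> alphabet_def)

lemma cyl_measurable: "cyl K j \<in> borel_measurable \<mu>"
proof -
  have [measurable]: "{x \<in> space \<mu>. residue \<alpha> x K = j} \<in> sets \<mu>" by (rule residue_set_measurable)
  have [measurable]: "(\<lambda>x. chi n (fst (x 0))) \<in> borel_measurable \<mu>"
  proof -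
    \<comment> \<open>For negative \<open>n\<close> the power is continuous only away from 0; spins,
      being of modulus 1, avoid this point.\<close>
    have "(\<lambda>z. z powi n) \<in> borel_measurable (restrict_space borel (- {0 :: complex}))"
      by (intro borel_measurable_continuous_on_restrict continuous_intros) auto
    moreover have "(\<lambda>x. fst (x 0)) \<in> measurable \<mu> (restrict_space borel (- {0 :: complex}))"
    proof (rule measurable_restrict_space2[OF _ spin_measurable])
      show "(\<lambda>x. fst (x 0)) \<in> space \<mu> \<rightarrow> - {0}"
      proof (rule Pi_I)
        fix x assume "x \<in> space \<mu>"
        from norm_spin[OF this, of 0] show "fst (x 0) \<in> - {0}" by auto
      qed
    qed
    ultimately show ?thesis unfolding chi_def by (rule measurable_compose_rev)
  qed
  show ?thesis unfolding cyl_def[abs_def] by measurable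
qed

lemma cyl_bound: "x \<in> space \<mu> \<Longrightarrow> cmod (cyl K j x) \<le> 1"
  by (simp add: cyl_def norm_chi norm_spin)

lemma cyl_L2: "cyl K j \<in> L2 \<mu>"
  by (rule L2_bounded[OF finite_measure_axioms cyl_measurable cyl_bound])

lemma cyl_norm:
  assumes "j < 2 ^ K" shows "(L2_norm \<mu> (cyl K j))\<^sup>2 = 1 / 2 ^ K"
proof -
  let ?A = "{x \<in> space \<mu>. residue \<alpha> x K = j}"
  have "(L2_norm \<mu> (cyl K j))\<^sup>2 = (\<integral>x. indicator ?A x \<partial>\<mu>)"
    unfolding L2_norm_power2
    by (intro Bochner_Integration.integral_cong) (auto simp: cyl_def indicator_def norm_chi norm_spin)
  also have "\<dots> = prob ?A" using residue_set_measurable[of "\<lambda>r. r = j" K] by (simp add: Int_absorb2 Collect_subset)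
  finally show ?thesis using residue_measure[OF assms] by simp
qed

lemma cyl_split:
  assumes "j < 2 ^ K"
  shows "cyl K j x = cyl (Suc K) j x + cyl (Suc K) (j + 2 ^ K) x"
proof -
  have "residue \<alpha> x K = j \<longleftrightarrow> residue \<alpha> x (Suc K) = j \<or> residue \<alpha> x (Suc K) = j + 2 ^ K"
    using residue_less[of \<alpha> x K] assms phase_le_1[of "(desub \<alpha> ^^ K) x"]
    by (cases "phase ((desub \<alpha> ^^ K) x)") auto
  then show ?thesis by (auto simp: cyl_def)
qed

text \<open>Clearing the lowest set bit of \<open>j\<close> moves from the second half of a
  supertile of level \<open>i + 1\<close> to its first half, where the spins are comparable. The
  bound on \<open>i\<close> makes bit \<open>i + 1\<close> visible modulo \<open>2 ^ K\<close>; it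
  is the parity of \<open>m\<close> and decides the sign.\<close>

lemma cyl_step:
  assumes "x \<in> space \<mu>" "j = 2 ^ i * (2 * m + 1)" "j < 2 ^ K" "i + 2 \<le> K"
  shows "cyl K j x = (if even m then \<sigma> else 1) * (if i = 0 then 1 else \<beta>) * cyl K (j - 2 ^ i) (shift_power (- (2 ^ i)) x)"
proof -
  define y where "y = shift_power (- (2 ^ i)) x"
  have xX: "x \<in> X_rho \<alpha>" using assms(1) by (simp add: space_\<mu>)
  then have yX: "y \<in> X_rho \<alpha>" unfolding y_def by (rule shift_power_X_rho)
  have jm: "j - 2 ^ i = 2 ^ Suc i * m" using assms(2) by simp
  have res: "int (residue \<alpha> y K) = (int (residue \<alpha> x K) - 2 ^ i) mod 2 ^ K"
    unfolding y_def using residue_shift_\<mu>[OF assms(1), of "- (2 ^ i)" K] by simp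
  have iff: "residue \<alpha> y K = j - 2 ^ i \<longleftrightarrow> residue \<alpha> x K = j"
  proof -
    have "residue \<alpha> y K = j - 2 ^ i \<longleftrightarrow> (int (residue \<alpha> x K) - 2 ^ i) mod 2 ^ K = (int j - 2 ^ i) mod 2 ^ K"
    proof -
      have "int (j - 2 ^ i) = (int j - 2 ^ i) mod 2 ^ K"
      proof -
        have "int (j - 2 ^ i) = int j - 2 ^ i" using assms(2) by (simp add: of_nat_diff)
        moreover have "int (j - 2 ^ i) mod 2 ^ K = int ((j - 2 ^ i) mod 2 ^ K)" by (simp add: zmod_int)
        moreover have "(j - 2 ^ i) mod 2 ^ K = j - 2 ^ i" using assms(3) by (intro mod_less) linarith
        ultimately show ?thesis by simp
      qed
      then show ?thesis using res by (metis of_nat_eq_iff)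
    qed
    also have "\<dots> \<longleftrightarrow> int (residue \<alpha> x K) mod 2 ^ K = int j mod 2 ^ K"
      by (simp add: mod_eq_dvd_iff)
    also have "\<dots> \<longleftrightarrow> residue \<alpha> x K = j" using residue_less[of \<alpha> x K] assms(3) by simp
    finally show ?thesis .
  qed
  show ?thesis
  proof (cases "residue \<alpha> x K = j")
    case True
    then have yK: "residue \<alpha> y K = 2 ^ Suc i * m" using iff jm by simp
    have r1: "residue \<alpha> y (Suc i) = 0"
      using residue_mod[of "Suc i" K \<alpha> y] assms(4) yK by simp
    have "residue \<alpha> y (Suc (Suc i)) = 2 ^ Suc i * m mod 2 ^ Suc (Suc i)"
      using residue_mod[of "Suc (Suc i)" K \<alpha> y] assms(4) yK by simp
    also have "\<dots> = 2 ^ Suc i * (m mod 2)"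
      unfolding power_Suc2[of 2 "Suc i"] by (rule mult_mod_right[symmetric])
    finally have r2: "residue \<alpha> y (Suc (Suc i)) = 0 \<longleftrightarrow> even m" by auto
    have "fst (x 0) = fst (y (2 ^ i))" by (simp add: y_def shift_power_def)
    also have "\<dots> = (if even m then - 1 else 1) * (if i = 0 then 1 else \<alpha>) * fst (y 0)"
      using spin_half_block[OF yX norm_\<alpha> r1] r2 by simp
    finally have "chi n (fst (x 0)) = (if even m then \<sigma> else 1) * (if i = 0 then 1 else \<beta>) * chi n (fst (y 0))"
      by (simp add: chi_mult)
    then show ?thesis using True iff by (simp add: cyl_def flip: y_def)
  next
    case False
    then show ?thesis using iff by (simp add: cyl_def flip: y_def)
  qed
qed

definition a where "a k = cyl (Suc k) 0"
definition b where "b k = cyl (Suc k) (2 ^ k)"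

lemma a_L2: "a k \<in> L2 \<mu>" and b_L2: "b k \<in> L2 \<mu>" by (simp_all add: a_def b_def cyl_L2)

lemma a_norm: "(L2_norm \<mu> (a k))\<^sup>2 = 1 / 2 ^ Suc k" and b_norm: "(L2_norm \<mu> (b k))\<^sup>2 = 1 / 2 ^ Suc k"
  unfolding a_def b_def by (rule cyl_norm; simp)+

lemma a_rec: "a k x = a (Suc k) x + b (Suc k) x"
  using cyl_split[of 0 "Suc k" x] by (simp add: a_def b_def)

text \<open>The class of \<open>2 ^ k\<close> splits by its next bit: a zero bit contributes
  \<sigma>, a one bit does not. Positivity of \<open>k\<close> is what brings in the common factor
  \<beta>.\<close>

lemma b_rec:
  assumes "x \<in> space \<mu>" "k > 0"
  shows "b k x = \<beta> * (\<sigma> * a (Suc k) (shift_power (- (2 ^ k)) x) + b (Suc k) (shift_power (- (2 ^ k)) x))"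
proof -
  have "b k x = cyl (Suc (Suc k)) (2 ^ k) x + cyl (Suc (Suc k)) (2 ^ k + 2 ^ Suc k) x"
    using cyl_split[of "2 ^ k" "Suc k" x] by (simp add: b_def)
  also have "cyl (Suc (Suc k)) (2 ^ k) x = \<sigma> * \<beta> * a (Suc k) (shift_power (- (2 ^ k)) x)"
    using cyl_step[OF assms(1), of "2 ^ k" k 0 "Suc (Suc k)"] assms(2) by (simp add: a_def)
  also have "cyl (Suc (Suc k)) (2 ^ k + 2 ^ Suc k) x = \<beta> * b (Suc k) (shift_power (- (2 ^ k)) x)"
    using cyl_step[OF assms(1), of "2 ^ k + 2 ^ Suc k" k 1 "Suc (Suc k)"] assms(2) by (simp add: b_def)
  finally show ?thesis by (simp add: algebra_simps)
qed

text \<open>Clearing lowest bits one at a time ends at \<open>j = 0\<close> or at the top bit alone,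
  whose sign would depend on a digit beyond level \<open>K\<close>. These two ends are why both
  \<open>a\<close> and \<open>b\<close> occur.\<close>

lemma cyl_reduce:
  assumes "j < 2 ^ K" "K > 0"
  shows "\<exists>c e. \<exists>f\<in>{a (K - 1), b (K - 1)}. \<forall>x\<in>space \<mu>. cyl K j x = c * f (shift_power e x)"
  using assms(1)
proof (induction j rule: less_induct)
  case (less j)
  show ?case
  proof (cases "j = 0")
    case True
    then have "\<forall>x\<in>space \<mu>. cyl K j x = 1 * a (K - 1) (shift_power 0 x)" using assms(2) by (simp add: a_def)
    then show ?thesis by blast
  next
    case False
    then obtain i m where j: "j = 2 ^ i * (2 * m + 1)" using lowest_bit by auto
    then have "2 ^ i \<le> j" by simp
    then have "(2::nat) ^ i < 2 ^ K" using less.prems by linarith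
    then have "i < K" by simp
    show ?thesis
    proof (cases "i + 2 \<le> K")
      case True
      have lt: "j - 2 ^ i < j" using False by simp
      then have "j - 2 ^ i < 2 ^ K" using less.prems by linarith
      from less.IH[OF lt this] obtain c e f where f: "f \<in> {a (K - 1), b (K - 1)}"
        "\<And>x. x \<in> space \<mu> \<Longrightarrow> cyl K (j - 2 ^ i) x = c * f (shift_power e x)" by blast
      let ?d = "(if even m then \<sigma> else 1) * (if i = 0 then 1 else \<beta>)"
      have "cyl K j x = (?d * c) * f (shift_power (e + - (2 ^ i)) x)" if "x \<in> space \<mu>" for x
        using cyl_step[OF that j less.prems True] f(2)[OF measurable_space[OF shift_measurable_\<mu> that]]
        by (simp add: shift_power_add mult.assoc)
      then show ?thesis using f(1) by blast
    next
      case False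
      then have K: "K = Suc i" using \<open>i < K\<close> by simp
      have "m = 0" using less.prems unfolding j K by simp
      then have "\<forall>x\<in>space \<mu>. cyl K j x = 1 * b (K - 1) (shift_power 0 x)" by (simp add: b_def j K)
      then show ?thesis by blast
    qed
  qed
qed

end


section \<open>Density of the cylinder vectors\<close>

context subshift_measure
begin

lemma residue_borel: "residue \<alpha> \<in> measurable \<mu> borel"
proof (rule measurable_coordinatewise_then_product)
  fix k
  have "(\<lambda>r::nat. r) \<in> measurable (count_space UNIV) borel" by simp
  from measurable_compose[OF residue_measurable this]
  show "(\<lambda>x. residue \<alpha> x k) \<in> borel_measurable \<mu>" .
qed

definition mismatch :: "(nat \<Rightarrow> nat) set \<Rightarrow> nat \<Rightarrow> nat set \<Rightarrow> (int \<Rightarrow> letter) set" where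
  "mismatch A K J = {x \<in> space \<mu>. (residue \<alpha> x \<in> A) \<noteq> (residue \<alpha> x K \<in> J)}"

lemma residue_vimage_measurable: "A \<in> sets borel \<Longrightarrow> {x \<in> space \<mu>. residue \<alpha> x \<in> A} \<in> sets \<mu>"
  using measurable_sets[OF residue_borel, of A] by (simp add: vimage_def Int_def conj_commute)

lemma mismatch_measurable:
  assumes "A \<in> sets borel" shows "mismatch A K J \<in> sets \<mu>"
proof -
  have [measurable]: "{x \<in> space \<mu>. residue \<alpha> x \<in> A} \<in> sets \<mu>" "{x \<in> space \<mu>. residue \<alpha> x K \<in> J} \<in> sets \<mu>"

    using residue_vimage_measurable[OF assms] residue_set_measurable[of "\<lambda>r. r \<in> J" K] by blast+
  have "mismatch A K J = ({x \<in> space \<mu>. residue \<alpha> x \<in> A} - {x \<in> space \<mu>. residue \<alpha> x K \<in> J}) \<union>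
     ({x \<in> space \<mu>. residue \<alpha> x K \<in> J} - {x \<in> space \<mu>. residue \<alpha> x \<in> A})"
    unfolding mismatch_def by blast
  then show ?thesis by simp
qed

text \<open>Sets approximable by conditions on a single residue form a sigma-algebra containing the
  generators. For a countable union, a finite part suffices up to half of \<epsilon>, and one fine
  residue determines the finitely many coarser ones.\<close>

lemma cylinder_approximation:
  assumes "A \<in> sets borel" "\<epsilon> > 0"
  shows "\<exists>K J. prob (mismatch A K J) < \<epsilon>"
proof -
  let ?G = "{{f \<in> \<Pi>\<^sub>E i\<in>UNIV. space (borel :: nat measure). f i \<in> B} | (i::nat) B. i \<in> UNIV \<and> B \<in> sets (borel :: nat measure)}"
  have sets_eq: "sets (borel :: (nat \<Rightarrow> nat) measure) = sigma_sets (\<Pi>\<^sub>E i\<in>UNIV. space (borel :: nat measure)) ?G"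
    by (simp only: sets_PiM_equal_borel[symmetric] sets_PiM_single)
  have "A \<in> sigma_sets (\<Pi>\<^sub>E i\<in>UNIV. space (borel :: nat measure)) ?G" using assms(1) sets_eq by blast
  then show ?thesis using assms(2)
  proof (induction arbitrary: \<epsilon> rule: sigma_sets.induct)
    case (Basic A)
    then obtain i B where "A = {f. f i \<in> B}" by (auto simp: PiE_def)
    then have "mismatch A i B = {}" by (simp add: mismatch_def)
    then show ?case using Basic by (metis measure_empty)
  next
    case Empty
    have "mismatch {} 0 {} = {}" by (simp add: mismatch_def)
    then show ?case using Empty by (metis measure_empty)
  next
    case (Compl A)
    then obtain K J where "prob (mismatch A K J) < \<epsilon>" by blast
    moreover have "mismatch ((\<Pi>\<^sub>E i\<in>UNIV. space (borel :: nat measure)) - A) K (- J) = mismatch A K J"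
      by (auto simp: mismatch_def PiE_def)
    ultimately show ?case by metis
  next
    case (Union A)
    have Ab: "A i \<in> sets borel" for i using Union(1) sets_eq by blast
    let ?G = "\<lambda>i. {x \<in> space \<mu>. residue \<alpha> x \<in> A i}"
    define T where "T I = (\<Union>i<I. ?G i)" for I :: nat
    have Gm: "?G i \<in> sets \<mu>" for i by (rule residue_vimage_measurable[OF Ab])
    have Tm: "T I \<in> sets \<mu>" for I unfolding T_def using Gm by auto
    have "(\<lambda>I. prob (T I)) \<longlonglongrightarrow> prob (\<Union>I. T I)"
    proof (rule finite_Lim_measure_incseq)
      show "incseq T" unfolding T_def by (intro monoI UN_mono) auto
    qed (use Tm in auto)
    then have "eventually (\<lambda>I. prob (\<Union>I. T I) - \<epsilon> / 2 < prob (T I)) sequentially"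
      using Union(3) by (intro order_tendstoD(1)) auto
    then obtain I where I: "prob (\<Union>I. T I) - \<epsilon> / 2 < prob (T I)"
      unfolding eventually_sequentially by blast
    have U: "(\<Union>I. T I) = {x \<in> space \<mu>. residue \<alpha> x \<in> \<Union>(range A)}" unfolding T_def by auto
    have Um: "(\<Union>I. T I) \<in> sets \<mu>" using Tm by auto
    have "prob ((\<Union>I. T I) - T I) = prob (\<Union>I. T I) - prob (T I)"
      using Um Tm by (intro finite_measure_Diff) auto
    then have tail: "prob ((\<Union>I. T I) - T I) < \<epsilon> / 2" using I by simp
    \<comment> \<open>The 1 in the denominator avoids dividing by zero when \<open>I = 0\<close>;
      the \<open>I\<close> errors still add up to at most half of \<epsilon>.\<close>
    define \<delta> where "\<delta> = \<epsilon> / (2 * (real I + 1))"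
    have "\<delta> > 0" using Union(3) by (simp add: \<delta>_def)
    then have "\<forall>i. \<exists>K J. prob (mismatch (A i) K J) < \<delta>" using Union(2) by blast
    then obtain K J where KJ: "\<And>i. prob (mismatch (A i) (K i) (J i)) < \<delta>" by metis
    \<comment> \<open>The sum serves as a common upper bound that also makes sense for an empty
      family.\<close>
    define L where "L = (\<Sum>i<I. K i)"
    have KL: "K i \<le> L" if "i < I" for i unfolding L_def using that by (intro member_le_sum) auto
    define R where "R = {r. \<exists>i<I. r mod 2 ^ K i \<in> J i}"
    have "mismatch (\<Union>(range A)) L R \<subseteq> ((\<Union>I. T I) - T I) \<union> (\<Union>i<I. mismatch (A i) (K i) (J i))"
    proof
      fix x assume x: "x \<in> mismatch (\<Union>(range A)) L R"
      show "x \<in> ((\<Union>I. T I) - T I) \<union> (\<Union>i<I. mismatch (A i) (K i) (J i))"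
      proof (rule ccontr)
        assume neg: "x \<notin> ((\<Union>I. T I) - T I) \<union> (\<Union>i<I. mismatch (A i) (K i) (J i))"
        have xs: "x \<in> space \<mu>" using x by (simp add: mismatch_def)
        have "residue \<alpha> x \<in> \<Union>(range A) \<longleftrightarrow> (\<exists>i<I. residue \<alpha> x \<in> A i)"
          using neg xs unfolding U by (auto simp: T_def)
        also have "\<dots> \<longleftrightarrow> (\<exists>i<I. residue \<alpha> x (K i) \<in> J i)"
          using neg xs by (auto simp: mismatch_def)
        also have "\<dots> \<longleftrightarrow> residue \<alpha> x L \<in> R"
          unfolding R_def mem_Collect_eq using residue_mod[OF KL, of _ \<alpha> x] by metis
        finally show False using x by (simp add: mismatch_def)
      qed
    qed
    then have "prob (mismatch (\<Union>(range A)) L R) \<le> prob (((\<Union>I. T I) - T I) \<union> (\<Union>i<I. mismatch (A i) (K i) (J i)))"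
      using Um Tm mismatch_measurable[OF Ab] by (intro finite_measure_mono) auto
    also have "\<dots> \<le> prob ((\<Union>I. T I) - T I) + prob (\<Union>i<I. mismatch (A i) (K i) (J i))"
      using Um Tm mismatch_measurable[OF Ab] by (intro measure_Un_le) auto
    also have "prob (\<Union>i<I. mismatch (A i) (K i) (J i)) \<le> (\<Sum>i<I. prob (mismatch (A i) (K i) (J i)))"
      using mismatch_measurable[OF Ab] by (intro measure_UNION_le) auto
    also have "\<dots> \<le> (\<Sum>i<I. \<delta>)" using KJ by (intro sum_mono less_imp_le)
    also have "\<dots> \<le> \<epsilon> / 2" using Union(3) by (simp add: \<delta>_def field_simps)
    finally have "prob (mismatch (\<Union>(range A)) L R) < \<epsilon>" using tail by simp
    then show ?case by blast
  qed
qed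

definition step_approximable :: "((nat \<Rightarrow> nat) \<Rightarrow> complex) \<Rightarrow> bool" where
  "step_approximable u \<longleftrightarrow> (\<forall>\<epsilon>>0. \<exists>K h. L2_norm \<mu> (\<lambda>x. u (residue \<alpha> x) - h (residue \<alpha> x K)) \<le> \<epsilon>)"

lemma residue_L2:
  fixes h :: "nat \<Rightarrow> complex" shows "(\<lambda>x. h (residue \<alpha> x K)) \<in> L2 \<mu>"
proof (rule L2_bounded[OF finite_measure_axioms])
  show "(\<lambda>x. h (residue \<alpha> x K)) \<in> borel_measurable \<mu>"
    using measurable_compose[OF residue_measurable[of K], of h borel] by simp
  show "cmod (h (residue \<alpha> x K)) \<le> (\<Sum>j<2 ^ K. cmod (h j))" if "x \<in> space \<mu>" for x
    using residue_less[of \<alpha> x K] by (intro member_le_sum) auto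
qed

lemma step_approximable_add:
  assumes "step_approximable u" "step_approximable v"
    and "(\<lambda>x. u (residue \<alpha> x)) \<in> L2 \<mu>" "(\<lambda>x. v (residue \<alpha> x)) \<in> L2 \<mu>"
  shows "step_approximable (\<lambda>z. u z + v z)"
  unfolding step_approximable_def
proof (intro allI impI)
  fix \<epsilon> :: real assume "\<epsilon> > 0"
  then have "\<epsilon> / 2 > 0" by simp
  from assms(1)[unfolded step_approximable_def, rule_format, OF this] obtain K h where
    h: "L2_norm \<mu> (\<lambda>x. u (residue \<alpha> x) - h (residue \<alpha> x K)) \<le> \<epsilon> / 2" by blast
  from assms(2)[unfolded step_approximable_def, rule_format, OF \<open>\<epsilon> / 2 > 0\<close>] obtain K' h' where
    h': "L2_norm \<mu> (\<lambda>x. v (residue \<alpha> x) - h' (residue \<alpha> x K')) \<le> \<epsilon> / 2" by blast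
  define L where "L = max K K'"
  define w where "w r = h (r mod 2 ^ K) + h' (r mod 2 ^ K')" for r
  have w: "w (residue \<alpha> x L) = h (residue \<alpha> x K) + h' (residue \<alpha> x K')" for x
    by (simp add: w_def L_def residue_mod)
  have eq: "(\<lambda>x. u (residue \<alpha> x) + v (residue \<alpha> x) - w (residue \<alpha> x L)) =
    (\<lambda>x. (u (residue \<alpha> x) - h (residue \<alpha> x K)) + (v (residue \<alpha> x) - h' (residue \<alpha> x K')))"
    by (simp add: w fun_eq_iff)
  have "L2_norm \<mu> (\<lambda>x. u (residue \<alpha> x) + v (residue \<alpha> x) - w (residue \<alpha> x L)) \<le> \<epsilon> / 2 + \<epsilon> / 2"
    unfolding eq using h h' assms(3,4) residue_L2
    by (intro order_trans[OF L2_norm_triangle] add_mono L2_diff)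
  then show "\<exists>K h. L2_norm \<mu> (\<lambda>x. u (residue \<alpha> x) + v (residue \<alpha> x) - h (residue \<alpha> x K)) \<le> \<epsilon>" by auto
qed

lemma step_approximable_cmult:
  assumes "step_approximable u"
  shows "step_approximable (\<lambda>z. c * u z)"
  unfolding step_approximable_def
proof (intro allI impI)
  fix \<epsilon> :: real assume "\<epsilon> > 0"
  then have "\<epsilon> / (cmod c + 1) > 0" by (simp add: add_nonneg_pos)
  from assms[unfolded step_approximable_def, rule_format, OF this] obtain K h where
    h: "L2_norm \<mu> (\<lambda>x. u (residue \<alpha> x) - h (residue \<alpha> x K)) \<le> \<epsilon> / (cmod c + 1)" by blast
  define w where "w r = c * h r" for r
  have "L2_norm \<mu> (\<lambda>x. c * u (residue \<alpha> x) - w (residue \<alpha> x K)) =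
     cmod c * L2_norm \<mu> (\<lambda>x. u (residue \<alpha> x) - h (residue \<alpha> x K))"
    unfolding L2_norm_cmult[symmetric] by (simp add: right_diff_distrib w_def)
  also have "\<dots> \<le> cmod c * (\<epsilon> / (cmod c + 1))" using h by (intro mult_left_mono) auto
  also have "\<dots> \<le> (cmod c + 1) * (\<epsilon> / (cmod c + 1))" using \<open>\<epsilon> / (cmod c + 1) > 0\<close> by (intro mult_right_mono) auto
  also have "\<dots> = \<epsilon>" using add_nonneg_pos[OF norm_ge_zero[of c] zero_less_one] by simp
  finally show "\<exists>K h. L2_norm \<mu> (\<lambda>x. c * u (residue \<alpha> x) - h (residue \<alpha> x K)) \<le> \<epsilon>" by blast
qed

lemma step_approximable_indicator:
  assumes "A \<in> sets borel"
  shows "step_approximable (indicator A)"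
  unfolding step_approximable_def
proof (intro allI impI)
  fix \<epsilon> :: real assume "\<epsilon> > 0"
  \<comment> \<open>The squared distance between two indicators is the probability that they
    disagree, hence the square of \<epsilon>.\<close>
  then obtain K J where KJ: "prob (mismatch A K J) < \<epsilon>\<^sup>2"
    using cylinder_approximation[OF assms, of "\<epsilon>\<^sup>2"] by auto
  have "(L2_norm \<mu> (\<lambda>x. indicator A (residue \<alpha> x) - indicator J (residue \<alpha> x K)))\<^sup>2 = (\<integral>x. indicator (mismatch A K J) x \<partial>\<mu>)"
    unfolding L2_norm_power2 by (intro Bochner_Integration.integral_cong) (auto simp: mismatch_def indicator_def)
  also have "\<dots> = prob (mismatch A K J)"
    using mismatch_measurable[OF assms] sets.sets_into_space[OF mismatch_measurable[OF assms]] by (simp add: Int_absorb2)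
  finally have "(L2_norm \<mu> (\<lambda>x. indicator A (residue \<alpha> x) - indicator J (residue \<alpha> x K)))\<^sup>2 \<le> \<epsilon>\<^sup>2" using KJ by simp
  then have "L2_norm \<mu> (\<lambda>x. indicator A (residue \<alpha> x) - indicator J (residue \<alpha> x K)) \<le> \<epsilon>"
    by (rule power2_le_imp_le) (use \<open>\<epsilon> > 0\<close> in simp)
  then show "\<exists>K h. L2_norm \<mu> (\<lambda>x. indicator A (residue \<alpha> x) - h (residue \<alpha> x K)) \<le> \<epsilon>" by blast
qed

lemma step_approximable_simple:
  assumes "simple_function borel u"
  shows "step_approximable u"
proof -
  have fin: "finite (range u)" and m: "u \<in> borel_measurable borel"
    using simple_functionD(1)[OF assms] borel_measurable_simple_function[OF assms] by simp_all
  have ind: "(\<lambda>x. indicator A (residue \<alpha> x) :: complex) \<in> L2 \<mu>" if A: "A \<in> sets borel" for A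
  proof (rule L2_bounded[OF finite_measure_axioms, where B=1])
    show "(\<lambda>x. indicator A (residue \<alpha> x) :: complex) \<in> borel_measurable \<mu>"
      using measurable_compose[OF residue_borel borel_measurable_indicator[OF A]] .
  qed (auto simp: indicator_def)
  have V: "u -` {y} \<in> sets borel" for y using measurable_sets[OF m, of "{y}"] by simp
  have "step_approximable (\<lambda>z. \<Sum>y\<in>Y. y * indicator (u -` {y}) z) \<and> (\<lambda>x. \<Sum>y\<in>Y. y * indicator (u -` {y}) (residue \<alpha> x)) \<in> L2 \<mu>"
    if "finite Y" for Y
    using that
  proof induction
    case empty
    have "step_approximable (\<lambda>z. 0)"
      unfolding step_approximable_def by (intro allI impI exI[of _ 0] exI[of _ "\<lambda>_. 0"]) simp
    then show ?case by (simp add: L2_zero)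
  next
    case (insert y Y)
    have p: "step_approximable (\<lambda>z. y * indicator (u -` {y}) z)"
      by (intro step_approximable_cmult step_approximable_indicator V)
    have pL: "(\<lambda>x. y * indicator (u -` {y}) (residue \<alpha> x)) \<in> L2 \<mu>" by (intro L2_cmult ind V)
    show ?case unfolding sum.insert[OF insert(1,2)]
      using step_approximable_add[OF p conjunct1[OF insert(3)] pL conjunct2[OF insert(3)]]
        L2_add[OF pL conjunct2[OF insert(3)]] by blast
  qed
  from this[OF fin] have "step_approximable (\<lambda>z. \<Sum>y\<in>range u. y * indicator (u -` {y}) z)" by blast
  moreover have "(\<Sum>y\<in>range u. y * indicator (u -` {y}) z) = u z" for z
    using fin by (subst sum.remove[of _ "u z"]) (auto simp: indicator_def intro!: sum.neutral)
  ultimately show ?thesis by simp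
qed

text \<open>The approximating simple functions stay below twice the modulus of \<open>u\<close>, so
  the error is at most three times that modulus; its square, with factor 9, is the dominating
  function.\<close>

lemma step_approximable_L2:
  assumes "u \<in> borel_measurable borel" "(\<lambda>x. u (residue \<alpha> x)) \<in> L2 \<mu>"
  shows "step_approximable u"
  unfolding step_approximable_def
proof (intro allI impI)
  fix \<epsilon> :: real assume \<epsilon>: "\<epsilon> > 0"
  obtain F where F: "\<And>i. simple_function borel (F i)" "\<And>z. (\<lambda>i. F i z) \<longlonglongrightarrow> u z" "\<And>i z. cmod (F i z) \<le> 2 * cmod (u z)"
    using borel_measurable_implies_sequence_metric[OF assms(1), of 0] by auto
  have Fm: "(\<lambda>x. F i (residue \<alpha> x)) \<in> borel_measurable \<mu>" for i
    using measurable_compose[OF residue_borel borel_measurable_simple_function[OF F(1)]] .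
  have um: "(\<lambda>x. u (residue \<alpha> x)) \<in> borel_measurable \<mu>" using L2_measurable[OF assms(2)] .
  have bd: "(cmod (u z - F i z))\<^sup>2 \<le> 9 * (cmod (u z))\<^sup>2" for i z
  proof -
    have "cmod (u z - F i z) \<le> 3 * cmod (u z)" using norm_triangle_ineq4[of "u z" "F i z"] F(3)[of i z] by linarith
    then have "(cmod (u z - F i z))\<^sup>2 \<le> (3 * cmod (u z))\<^sup>2" by (rule power_mono) simp
    then show ?thesis by (simp add: power_mult_distrib)
  qed
  have "(\<lambda>i. \<integral>x. (cmod (u (residue \<alpha> x) - F i (residue \<alpha> x)))\<^sup>2 \<partial>\<mu>) \<longlonglongrightarrow> (\<integral>x. 0 \<partial>\<mu>)"
  proof (rule integral_dominated_convergence[where w = "\<lambda>x. 9 * (cmod (u (residue \<alpha> x)))\<^sup>2"])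
    show "integrable \<mu> (\<lambda>x. 9 * (cmod (u (residue \<alpha> x)))\<^sup>2)" using assms(2) by (simp add: L2_def)
    show "AE x in \<mu>. (\<lambda>i. (cmod (u (residue \<alpha> x) - F i (residue \<alpha> x)))\<^sup>2) \<longlonglongrightarrow> 0"
    proof (rule AE_I2)
      fix x
      have "(\<lambda>i. (cmod (u (residue \<alpha> x) - F i (residue \<alpha> x)))\<^sup>2) \<longlonglongrightarrow> (cmod (u (residue \<alpha> x) - u (residue \<alpha> x)))\<^sup>2"
        by (intro tendsto_intros F(2))
      then show "(\<lambda>i. (cmod (u (residue \<alpha> x) - F i (residue \<alpha> x)))\<^sup>2) \<longlonglongrightarrow> 0" by simp
    qed
    show "AE x in \<mu>. norm ((cmod (u (residue \<alpha> x) - F i (residue \<alpha> x)))\<^sup>2) \<le> 9 * (cmod (u (residue \<alpha> x)))\<^sup>2" for i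
      using bd by (intro AE_I2) simp
  qed (use Fm um in measurable)
  then have "(\<lambda>i. L2_norm \<mu> (\<lambda>x. u (residue \<alpha> x) - F i (residue \<alpha> x))) \<longlonglongrightarrow> 0"
    unfolding L2_norm_def by (intro tendsto_eq_intros) auto
  then have "eventually (\<lambda>i. L2_norm \<mu> (\<lambda>x. u (residue \<alpha> x) - F i (residue \<alpha> x)) < \<epsilon> / 2) sequentially"
    using \<epsilon> by (intro order_tendstoD(2)) auto
  then obtain i where i: "L2_norm \<mu> (\<lambda>x. u (residue \<alpha> x) - F i (residue \<alpha> x)) < \<epsilon> / 2"
    unfolding eventually_sequentially by blast
  from step_approximable_simple[OF F(1)[of i], unfolded step_approximable_def, rule_format, OF half_gt_zero[OF \<epsilon>]]
  obtain K h where h: "L2_norm \<mu> (\<lambda>x. F i (residue \<alpha> x) - h (residue \<alpha> x K)) \<le> \<epsilon> / 2" by blast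
  have FL2: "(\<lambda>x. F i (residue \<alpha> x)) \<in> L2 \<mu>"
  proof -
    have "integrable \<mu> (\<lambda>x. (cmod (F i (residue \<alpha> x)))\<^sup>2)"
    proof (rule Bochner_Integration.integrable_bound)
      show "integrable \<mu> (\<lambda>x. 4 * (cmod (u (residue \<alpha> x)))\<^sup>2)" using assms(2) by (simp add: L2_def)
      have "(cmod (F i z))\<^sup>2 \<le> 4 * (cmod (u z))\<^sup>2" for z
        using power_mono[OF F(3)[of i z], of 2] by (simp add: power_mult_distrib)
      then show "AE x in \<mu>. norm ((cmod (F i (residue \<alpha> x)))\<^sup>2) \<le> norm (4 * (cmod (u (residue \<alpha> x)))\<^sup>2)"
        by (intro AE_I2) simp
    qed (use Fm in measurable)
    then show ?thesis using Fm by (simp add: L2_def)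
  qed
  have "L2_norm \<mu> (\<lambda>x. (u (residue \<alpha> x) - F i (residue \<alpha> x)) + (F i (residue \<alpha> x) - h (residue \<alpha> x K))) \<le> \<epsilon> / 2 + \<epsilon> / 2"
    using i h by (intro order_trans[OF L2_norm_triangle] add_mono L2_diff assms FL2 residue_L2) auto
  then show "\<exists>K h. L2_norm \<mu> (\<lambda>x. u (residue \<alpha> x) - h (residue \<alpha> x K)) \<le> \<epsilon>" by auto
qed

end

lemma dyadic_borel: "dyadic \<in> sets borel"
proof -
  have [measurable]: "(\<lambda>z :: nat \<Rightarrow> nat. z k) \<in> measurable borel (count_space UNIV)" for k
  proof -
    have "(\<lambda>z :: nat \<Rightarrow> nat. z k) \<in> borel_measurable borel"
      by (rule measurable_product_then_coordinatewise) simp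
    then show ?thesis by (simp add: measurable_def sets_borel_eq_count_space)
  qed
  have "dyadic = {z \<in> space borel. (\<forall>k. z k < 2 ^ k) \<and> (\<forall>k. z (Suc k) mod 2 ^ k = z k)}" by (simp add: dyadic_def)
  also have "\<dots> \<in> sets borel" by measurable
  finally show ?thesis .
qed

context subshift_character
begin

text \<open>The character of the spin has modulus 1, so multiplying by it is isometric and the
  approximation takes place among functions of the odometer coordinate. The bound \<open>K0\<close>
  lets callers ask for a level at which the recursions apply.\<close>

lemma H_chi_approximation:
  assumes "g \<in> H_chi \<alpha> \<mu> \<nu> n" "sets \<nu> = sets (restrict_space borel dyadic)" "\<epsilon> > 0"
  shows "\<exists>K\<ge>K0. \<exists>h. L2_norm \<mu> (\<lambda>x. g x - (\<Sum>j<2 ^ K. h j * cyl K j x)) \<le> \<epsilon>"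
proof -
  obtain h where g: "g \<in> L2 \<mu>" and h: "h \<in> L2 \<nu>"
    and AE: "AE x in \<mu>. g x = h (odometer_coord \<alpha> x) * chi n (spin (x 0))"
    using assms(1) unfolding H_chi_def by blast
  \<comment> \<open>Extension by 0 makes \<open>h\<close> a Borel function on all sequences of
    naturals, the setting of the approximation by steps.\<close>
  define u where "u z = (if z \<in> dyadic then h z else 0)" for z
  have "h \<in> borel_measurable (restrict_space borel dyadic)"
    using L2_measurable[OF h] measurable_cong_sets[OF assms(2) refl] by blast
  then have um: "u \<in> borel_measurable borel"
    unfolding u_def[abs_def] using dyadic_borel by (intro measurable_restrict_space_iff[THEN iffD1]) auto
  have coord: "odometer_coord \<alpha> x = residue \<alpha> x" if "x \<in> space \<mu>" for x
    using odometer_coord_eq_residue[OF _ norm_\<alpha>] that by (simp add: space_\<mu>)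
  have dy: "residue \<alpha> x \<in> dyadic" for x
    using residue_less residue_mod[of k "Suc k" \<alpha> x for k] unfolding dyadic_def by simp
  have AE': "AE x in \<mu>. g x = u (residue \<alpha> x) * chi n (fst (x 0))"
    using AE AE_space by eventually_elim (simp add: coord u_def dy spin_def)
  have um': "(\<lambda>x. u (residue \<alpha> x)) \<in> borel_measurable \<mu>" using measurable_compose[OF residue_borel um] .
  \<comment> \<open>Square integrability under \<mu> is inherited from \<open>g\<close>, which has
    the same modulus almost everywhere.\<close>
  have "integrable \<mu> (\<lambda>x. (cmod (u (residue \<alpha> x)))\<^sup>2)"
  proof (rule integrable_cong_AE_imp[where g="\<lambda>x. (cmod (g x))\<^sup>2"])
    show "AE x in \<mu>. (cmod (g x))\<^sup>2 = (cmod (u (residue \<alpha> x)))\<^sup>2"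
      using AE' AE_space by eventually_elim (simp add: norm_mult norm_chi norm_spin)
  qed (use g um' in \<open>auto simp: L2_def\<close>)
  then have "(\<lambda>x. u (residue \<alpha> x)) \<in> L2 \<mu>" using um' by (simp add: L2_def)
  from step_approximable_L2[OF um this] assms(3) obtain K v where
    v: "L2_norm \<mu> (\<lambda>x. u (residue \<alpha> x) - v (residue \<alpha> x K)) \<le> \<epsilon>" unfolding step_approximable_def by blast
  define L where "L = max K K0"
  define w where "w r = v (r mod 2 ^ K)" for r
  have w: "v (residue \<alpha> x K) = w (residue \<alpha> x L)" for x by (simp add: w_def L_def residue_mod)
  have sum: "(\<Sum>j<2 ^ L. w j * cyl L j x) = w (residue \<alpha> x L) * chi n (fst (x 0))" for x
  proof -
    have "(\<Sum>j<2 ^ L. w j * cyl L j x) = (\<Sum>j<2 ^ L. if j = residue \<alpha> x L then w j * chi n (fst (x 0)) else 0)"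
      by (intro sum.cong) (auto simp: cyl_def)
    also have "\<dots> = w (residue \<alpha> x L) * chi n (fst (x 0))" using residue_less[of \<alpha> x L] by (simp add: sum.delta)
    finally show ?thesis .
  qed
  have gm: "g \<in> borel_measurable \<mu>" using g by (rule L2_measurable)
  have sm: "(\<lambda>x. \<Sum>j<2 ^ L. w j * cyl L j x) \<in> borel_measurable \<mu>"
    using cyl_measurable by (intro borel_measurable_sum borel_measurable_times) auto
  have wm: "(\<lambda>x. w (residue \<alpha> x L)) \<in> borel_measurable \<mu>" using residue_L2 by (rule L2_measurable)
  have "(\<integral>x. (cmod (g x - (\<Sum>j<2 ^ L. w j * cyl L j x)))\<^sup>2 \<partial>\<mu>) = (\<integral>x. (cmod (u (residue \<alpha> x) - w (residue \<alpha> x L)))\<^sup>2 \<partial>\<mu>)"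
  proof (rule integral_cong_AE)
    show "AE x in \<mu>. (cmod (g x - (\<Sum>j<2 ^ L. w j * cyl L j x)))\<^sup>2 = (cmod (u (residue \<alpha> x) - w (residue \<alpha> x L)))\<^sup>2"
      using AE' AE_space
    proof eventually_elim
      case (elim x)
      then have "g x - (\<Sum>j<2 ^ L. w j * cyl L j x) = (u (residue \<alpha> x) - w (residue \<alpha> x L)) * chi n (fst (x 0))"
        unfolding sum by (simp add: left_diff_distrib)
      then show ?case using elim by (simp add: norm_mult norm_chi norm_spin)
    qed
  qed (use gm sm um' wm in measurable)
  then have "L2_norm \<mu> (\<lambda>x. g x - (\<Sum>j<2 ^ L. w j * cyl L j x)) \<le> \<epsilon>"
    using v by (simp add: L2_norm_def w)
  moreover have "L \<ge> K0" by (simp add: L_def)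
  ultimately show ?thesis by blast
qed

lemma cyl_in_H_chi:
  assumes "sets \<nu> = sets (restrict_space borel dyadic)" "finite_measure \<nu>"
  shows "(\<lambda>x. c * cyl K j x) \<in> H_chi \<alpha> \<mu> \<nu> n"
proof -
  define h :: "(nat \<Rightarrow> nat) \<Rightarrow> complex" where "h z = (if z K = j then c else 0)" for z
  have m: "h \<in> borel_measurable borel"
  proof -
    have 1: "(\<lambda>z :: nat \<Rightarrow> nat. z K) \<in> borel_measurable borel"
      by (rule measurable_product_then_coordinatewise) simp
    have 2: "(\<lambda>r::nat. if r = j then c else 0) \<in> borel_measurable borel"
      by (simp add: measurable_def sets_borel_eq_count_space)
    show ?thesis unfolding h_def[abs_def] using measurable_compose[OF 1 2] by simp
  qed
  have "h \<in> borel_measurable \<nu>"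
    using measurable_restrict_space1[OF m] measurable_cong_sets[OF assms(1) refl] by blast
  then have "h \<in> L2 \<nu>" by (rule L2_bounded[OF assms(2), where B="cmod c"]) (simp add: h_def)
  moreover have "AE x in \<mu>. c * cyl K j x = h (odometer_coord \<alpha> x) * chi n (spin (x 0))"
    using odometer_coord_eq_residue[OF _ norm_\<alpha>]
    by (intro AE_I2) (simp add: space_\<mu> cyl_def h_def spin_def)
  ultimately show ?thesis unfolding H_chi_def using L2_cmult[OF cyl_L2] by blast
qed

end


section \<open>Pure point and Lebesgue spectrum\<close>

lemma L2_norm_cong: "(\<And>x. x \<in> space M \<Longrightarrow> f x = g x) \<Longrightarrow> L2_norm M f = L2_norm M g"
  unfolding L2_norm_def by (auto intro!: arg_cong[where f=sqrt] Bochner_Integration.integral_cong)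

lemma L2_inner_cong:
  "(\<And>x. x \<in> space M \<Longrightarrow> f x = f' x) \<Longrightarrow> (\<And>x. x \<in> space M \<Longrightarrow> g x = g' x) \<Longrightarrow> L2_inner M f g = L2_inner M f' g'"
  unfolding L2_inner_def by (intro Bochner_Integration.integral_cong) auto

lemma tpoly_op_cmult: "tpoly_op q (\<lambda>x. c * f x) x = c * tpoly_op q f x"
  by (induction q) (auto simp: algebra_simps)

lemma tpoly_op_sum: "finite I \<Longrightarrow> tpoly_op q (\<lambda>x. \<Sum>i\<in>I. f i x) x = (\<Sum>i\<in>I. tpoly_op q (f i) x)"
  by (induction q) (auto simp: sum_distrib_left sum.distrib)

lemma tpoly_op_shift_power: "tpoly_op q (\<lambda>x. f (shift_power e x)) x = tpoly_op q f (shift_power e x)"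
  by (induction q) (auto simp: shift_power_add add.commute)

context koopman
begin

lemma shift_space: "x \<in> space M \<Longrightarrow> shift_power e x \<in> space M"
  using measurable_space[OF shift_measurable] .

lemma corr_cong:
  "(\<And>x. x \<in> space M \<Longrightarrow> f x = f' x) \<Longrightarrow> (\<And>x. x \<in> space M \<Longrightarrow> g x = g' x) \<Longrightarrow> corr f g m = corr f' g' m"
  unfolding corr_def by (intro L2_inner_cong) (auto simp: shift_space)

lemma tpoly_op_cong: "(\<And>x. x \<in> space M \<Longrightarrow> f x = g x) \<Longrightarrow> x \<in> space M \<Longrightarrow> tpoly_op q f x = tpoly_op q g x"
  by (induction q) (auto simp: shift_space)

lemma corr_add_left: "f \<in> L2 M \<Longrightarrow> g \<in> L2 M \<Longrightarrow> h \<in> L2 M \<Longrightarrow> corr (\<lambda>x. f x + g x) h m = corr f h m + corr g h m"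
  unfolding corr_def by (intro L2_inner_add_left shift_L2)

lemma corr_add_right: "f \<in> L2 M \<Longrightarrow> g \<in> L2 M \<Longrightarrow> h \<in> L2 M \<Longrightarrow> corr f (\<lambda>x. g x + h x) m = corr f g m + corr f h m"
  unfolding corr_def by (rule L2_inner_add_right[OF _ shift_L2 shift_L2])

lemma corr_cmult_left: "corr (\<lambda>x. c * f x) g m = cnj c * corr f g m"
  unfolding corr_def by (rule L2_inner_cmult_left)

lemma corr_cmult_right: "corr f (\<lambda>x. c * g x) m = c * corr f g m"
  unfolding corr_def by (rule L2_inner_cmult_right)

lemma corr_shift_right: "corr f (\<lambda>x. g (shift_power e x)) m = corr f g (m + e)"
  unfolding corr_def by (simp add: shift_power_add add.commute)

lemma corr_shift_left:
  assumes "f \<in> L2 M" "g \<in> L2 M"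
  shows "corr (\<lambda>x. f (shift_power e x)) g m = corr f g (m - e)"
  unfolding corr_def using corr_shift[OF assms, of e m] by (simp add: corr_def)

lemma corr_self_0: "corr f f 0 = of_real ((L2_norm M f)\<^sup>2)"
  unfolding corr_def using L2_inner_self[of M f] by simp

text \<open>Expanding the powers turns the averages that detect mass on a set of roots into averages
  of correlations.\<close>

lemma spectral_average:
  assumes g: "g \<in> L2 M" "is_spectral_measure M g \<rho>" and w: "norm w = 1"
  shows "(\<lambda>N. (\<Sum>m<N. w ^ m * corr g g (int (k * m))) / of_nat N) \<longlonglongrightarrow> of_real (measure \<rho> {z \<in> circle. z ^ k * w = 1})"
proof -
  have "(\<integral>z. (\<Sum>m<N. (z ^ k * w) ^ m) / of_nat N \<partial>\<rho>) = (\<Sum>m<N. w ^ m * corr g g (int (k * m))) / of_nat N" for N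
  proof -
    have i: "integrable \<rho> (\<lambda>z. w ^ m * z ^ (k * m))" for m
      by (rule circle_integrable[OF g]) (intro continuous_intros)
    have "(\<integral>z. (\<Sum>m<N. (z ^ k * w) ^ m) / of_nat N \<partial>\<rho>) = (\<integral>z. (\<Sum>m<N. w ^ m * z ^ (k * m)) \<partial>\<rho>) / of_nat N"
      by (simp add: power_mult_distrib mult.commute flip: power_mult)
    also have "(\<integral>z. (\<Sum>m<N. w ^ m * z ^ (k * m)) \<partial>\<rho>) = (\<Sum>m<N. \<integral>z. w ^ m * z ^ (k * m) \<partial>\<rho>)"
      by (intro Bochner_Integration.integral_sum i)
    also have "\<dots> = (\<Sum>m<N. w ^ m * corr g g (int (k * m)))"
    proof (rule sum.cong[OF refl])
      fix m
      have "(\<integral>z. z ^ (k * m) \<partial>\<rho>) = corr g g (int (k * m))" unfolding spectral_corr[OF g] power_int_of_nat ..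
      then show "(\<integral>z. w ^ m * z ^ (k * m) \<partial>\<rho>) = w ^ m * corr g g (int (k * m))" by simp
    qed
    finally show ?thesis .
  qed
  then show ?thesis using average_powers_integral_tendsto[OF spectral_finite[OF g] spectral_sets[OF g] w, of k] by (simp only:)
qed

lemma lebesgue_spectral_measure:
  assumes "\<And>m. corr f f m = of_bool (m = 0)"
  shows "is_spectral_measure M f circle_lebesgue"
  unfolding is_spectral_measure_def koopman_power_def comp_def
  using assms circle_lebesgue_sets prob_space.finite_measure[OF circle_lebesgue_prob_space]
  by (simp add: circle_lebesgue_powi corr_def)

end

lemma eps_bound_zero:
  fixes x C :: real assumes "x \<ge> 0" "\<And>\<epsilon>. \<epsilon> > 0 \<Longrightarrow> x \<le> C * \<epsilon>" shows "x = 0"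
proof (rule ccontr)
  assume "x \<noteq> 0"
  then have x: "x > 0" using assms(1) by simp
  have "\<bar>C\<bar> + 1 > 0" by simp
  then have "x \<le> C * (x / (2 * (\<bar>C\<bar> + 1)))" using x by (intro assms(2)) (simp add: add_nonneg_pos)
  also have "\<dots> \<le> (\<bar>C\<bar> + 1) * (x / (2 * (\<bar>C\<bar> + 1)))" using x by (intro mult_right_mono) auto
  also have "\<dots> = x / 2"
  proof -
    have "d * (x / (2 * d)) = x / 2" if "d > 0" for d :: real using that by simp
    then show ?thesis using \<open>\<bar>C\<bar> + 1 > 0\<close> by blast
  qed
  finally show False using x by simp
qed

context subshift_character
begin

text \<open>The trivial character forgets the spin, so an approximant \<open>f\<close> is exactly
  periodic and the correlations of \<open>g\<close> at multiples of \<open>2 ^ K\<close> stay close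
  to their value at 0. Averaging shows that almost all mass sits on \<open>D K\<close>.\<close>

lemma pure_point_case:
  assumes g: "g \<in> H_chi \<alpha> \<mu> \<nu> n" and spec: "is_spectral_measure \<mu> g \<rho>"
    and \<nu>: "sets \<nu> = sets (restrict_space borel dyadic)" and n: "n = 0"
  shows "pure_point \<rho>"
proof -
  have gL: "g \<in> L2 \<mu>" using g by (simp add: H_chi_def)
  note gs = gL spec
  interpret \<rho>: finite_measure \<rho> by (rule spectral_finite[OF gs])
  define D where "D K = {z \<in> circle. z ^ (2 ^ K) = 1}" for K
  have finD: "finite (D K)" for K
    by (rule finite_subset[OF _ finite_roots_unity[of "2 ^ K"]]) (auto simp: D_def)
  have DS: "D K \<in> sets \<rho>" for K
    unfolding spectral_sets[OF gs] circle_borel_iff using finite_imp_closed[OF finD] by (auto simp: D_def)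
  define C where "C = (\<Union>K. D K)"
  have CS: "C \<in> sets \<rho>" unfolding C_def using DS by auto
  have "countable C" unfolding C_def using finD by (simp add: countable_finite)
  have "measure \<rho> (space \<rho> - C) \<le> (2 * L2_norm \<mu> g) * \<epsilon>" if \<epsilon>: "\<epsilon> > 0" for \<epsilon>
  proof -
    obtain K h where h: "L2_norm \<mu> (\<lambda>x. g x - (\<Sum>j<2 ^ K. h j * cyl K j x)) \<le> \<epsilon>"
      using H_chi_approximation[OF g \<nu> \<epsilon>, of 0] by blast
    define f where "f x = (\<Sum>j<2 ^ K. h j * cyl K j x)" for x
    have fL: "f \<in> L2 \<mu>" unfolding f_def[abs_def] by (intro L2_sum L2_cmult cyl_L2)
    have per: "f (shift_power (int (2 ^ K * m)) x) = f x" if "x \<in> space \<mu>" for x m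
    proof -
      have "int (residue \<alpha> (shift_power (int (2 ^ K * m)) x) K) = (int (residue \<alpha> x K) + 2 ^ K * int m) mod 2 ^ K"
        using residue_shift_\<mu>[OF that, of "int (2 ^ K * m)" K] by simp
      also have "\<dots> = int (residue \<alpha> x K)" using residue_less[of \<alpha> x K] by simp
      finally have "residue \<alpha> (shift_power (int (2 ^ K * m)) x) K = residue \<alpha> x K" by (simp only: of_nat_eq_iff)
      then show ?thesis unfolding f_def cyl_def chi_def unfolding n by (simp only: power_int_0_right)
    qed
    have c: "cmod (corr g g (int (2 ^ K * m)) - of_real ((L2_norm \<mu> g)\<^sup>2)) \<le> 2 * L2_norm \<mu> g * \<epsilon>" for m
    proof -
      let ?e = "int (2 ^ K * m)"
      have "corr g g ?e - of_real ((L2_norm \<mu> g)\<^sup>2) = L2_inner \<mu> g (\<lambda>x. g (shift_power ?e x) - g x)"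
        unfolding corr_def L2_inner_self[symmetric] by (rule L2_inner_diff_right[symmetric]) (intro gL shift_L2)+
      also have "cmod \<dots> \<le> L2_norm \<mu> g * L2_norm \<mu> (\<lambda>x. g (shift_power ?e x) - g x)"
        by (intro L2_Cauchy_Schwarz gL L2_diff shift_L2)
      also have "L2_norm \<mu> (\<lambda>x. g (shift_power ?e x) - g x) =
         L2_norm \<mu> (\<lambda>x. (g (shift_power ?e x) - f (shift_power ?e x)) - (g x - f x))"
        by (intro L2_norm_cong) (simp add: per del: of_nat_mult of_nat_power)
      also have "\<dots> \<le> L2_norm \<mu> (\<lambda>x. g (shift_power ?e x) - f (shift_power ?e x)) + L2_norm \<mu> (\<lambda>x. g x - f x)"
        by (intro L2_norm_diff_triangle L2_diff shift_L2 gL fL)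
      also have "L2_norm \<mu> (\<lambda>x. g (shift_power ?e x) - f (shift_power ?e x)) = L2_norm \<mu> (\<lambda>x. g x - f x)"
        by (rule L2_norm_shift[OF L2_diff[OF gL fL]])
      finally have "cmod (corr g g ?e - of_real ((L2_norm \<mu> g)\<^sup>2)) \<le> L2_norm \<mu> g * (L2_norm \<mu> (\<lambda>x. g x - f x) + L2_norm \<mu> (\<lambda>x. g x - f x))"
        by (simp add: mult_left_mono L2_norm_nonneg)
      also have "\<dots> \<le> L2_norm \<mu> g * (\<epsilon> + \<epsilon>)" using h unfolding f_def by (intro mult_left_mono add_mono L2_norm_nonneg) auto
      finally show ?thesis by (simp add: algebra_simps)
    qed
    have lim: "(\<lambda>N. (\<Sum>m<N. corr g g (int (2 ^ K * m))) / of_nat N) \<longlonglongrightarrow> of_real (measure \<rho> (D K))"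
      using spectral_average[OF gs, of 1 "2 ^ K"] by (simp add: D_def)
    have "(\<lambda>N. cmod ((\<Sum>m<N. corr g g (int (2 ^ K * m))) / of_nat N - of_real ((L2_norm \<mu> g)\<^sup>2))) \<longlonglongrightarrow>
        cmod (of_real (measure \<rho> (D K)) - of_real ((L2_norm \<mu> g)\<^sup>2))"
      by (intro tendsto_intros lim)
    moreover have "cmod ((\<Sum>m<N. corr g g (int (2 ^ K * m))) / of_nat N - of_real ((L2_norm \<mu> g)\<^sup>2)) \<le> 2 * L2_norm \<mu> g * \<epsilon>" if "N > 0" for N
    proof -
      have "(\<Sum>m<N. corr g g (int (2 ^ K * m))) / of_nat N - of_real ((L2_norm \<mu> g)\<^sup>2) =
         (\<Sum>m<N. corr g g (int (2 ^ K * m)) - of_real ((L2_norm \<mu> g)\<^sup>2)) / of_nat N"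
        using that by (simp add: sum_subtractf diff_divide_distrib)
      also have "cmod \<dots> \<le> (\<Sum>m<N. 2 * L2_norm \<mu> g * \<epsilon>) / real N"
        unfolding norm_divide norm_of_nat by (intro divide_right_mono sum_norm_le c) simp
      also have "\<dots> = 2 * L2_norm \<mu> g * \<epsilon>" using that by simp
      finally show ?thesis .
    qed
    ultimately have "cmod (of_real (measure \<rho> (D K)) - of_real ((L2_norm \<mu> g)\<^sup>2)) \<le> 2 * L2_norm \<mu> g * \<epsilon>"
      by (intro LIMSEQ_le_const2[of _ _ "2 * L2_norm \<mu> g * \<epsilon>"] exI[of _ 1]) auto
    then have "\<bar>measure \<rho> (D K) - (L2_norm \<mu> g)\<^sup>2\<bar> \<le> 2 * L2_norm \<mu> g * \<epsilon>"
      by (simp flip: of_real_diff of_real_power)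
    moreover have "measure \<rho> (space \<rho> - C) \<le> measure \<rho> (space \<rho> - D K)"
      using CS DS by (intro \<rho>.finite_measure_mono) (auto simp: C_def)
    moreover have "measure \<rho> (space \<rho> - D K) = (L2_norm \<mu> g)\<^sup>2 - measure \<rho> (D K)"
      using \<rho>.finite_measure_compl[OF DS] spectral_total_mass[OF gs] spectral_space[OF gs] by simp
    ultimately show ?thesis by linarith
  qed
  then have "measure \<rho> (space \<rho> - C) = 0" by (intro eps_bound_zero) auto
  then have "emeasure \<rho> (space \<rho> - C) = 0" by (simp add: \<rho>.emeasure_eq_measure)
  then show ?thesis unfolding pure_point_def using \<open>countable C\<close> CS by blast
qed

section \<open>Correlations of the two supertile vectors and the odd case\<close>

lemma corr_cyl_zero:
  assumes "\<not> 2 ^ K dvd (int i + m - int j)"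
  shows "corr (cyl K i) (cyl K j) m = 0"
proof -
  have "cnj (cyl K i x) * cyl K j (shift_power m x) = 0" if "x \<in> space \<mu>" for x
  proof (rule ccontr)
    assume "cnj (cyl K i x) * cyl K j (shift_power m x) \<noteq> 0"
    then have "residue \<alpha> x K = i" "residue \<alpha> (shift_power m x) K = j" by (auto simp: cyl_def split: if_splits)
    then have "int j = (int i + m) mod 2 ^ K" using residue_shift_\<mu>[OF that, of m K] by simp
    then show False using assms by (metis dvd_minus_mod)
  qed
  then have "corr (cyl K i) (cyl K j) m = (\<integral>x. 0 \<partial>\<mu>)"
    unfolding corr_def L2_inner_def by (intro Bochner_Integration.integral_cong) auto
  then show ?thesis by simp
qed

lemma corr_aa_zero: "\<not> 2 ^ Suc k dvd m \<Longrightarrow> corr (a k) (a k) m = 0"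
  unfolding a_def by (intro corr_cyl_zero) simp

lemma corr_bb_zero: "\<not> 2 ^ Suc k dvd m \<Longrightarrow> corr (b k) (b k) m = 0"
  unfolding b_def by (intro corr_cyl_zero) simp

lemma corr_ab_zero: "\<not> 2 ^ Suc k dvd (m - 2 ^ k) \<Longrightarrow> corr (a k) (b k) m = 0"
  unfolding a_def b_def by (intro corr_cyl_zero) simp

text \<open>The term with \<open>b\<close> on the left is written as a conjugate at the opposite
  time, so that the families \<open>aa\<close>, \<open>ab\<close>, \<open>bb\<close> are closed
  under the recursion.\<close>

lemma corr_aa_rec:
  "corr (a k) (a k) m = corr (a (Suc k)) (a (Suc k)) m + corr (a (Suc k)) (b (Suc k)) m
     + cnj (corr (a (Suc k)) (b (Suc k)) (- m)) + corr (b (Suc k)) (b (Suc k)) m"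
proof -
  have "corr (a k) (a k) m = corr (\<lambda>x. a (Suc k) x + b (Suc k) x) (\<lambda>x. a (Suc k) x + b (Suc k) x) m"
    by (rule corr_cong) (rule a_rec)+
  then show ?thesis
    using corr_minus[OF b_L2 a_L2, of "Suc k" "Suc k" "- m"]
    by (simp add: corr_add_left corr_add_right L2_add a_L2 b_L2)
qed

lemma corr_ab_rec:
  assumes "k > 0"
  shows "corr (a k) (b k) m = \<beta> * (\<sigma> * corr (a (Suc k)) (a (Suc k)) (m - 2 ^ k) + corr (a (Suc k)) (b (Suc k)) (m - 2 ^ k)
     + \<sigma> * cnj (corr (a (Suc k)) (b (Suc k)) (2 ^ k - m)) + corr (b (Suc k)) (b (Suc k)) (m - 2 ^ k))"
proof -
  let ?S = "shift_power (- (2 ^ k)) :: (int \<Rightarrow> letter) \<Rightarrow> _"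
  have "corr (a k) (b k) m = corr (\<lambda>x. a (Suc k) x + b (Suc k) x) (\<lambda>x. \<beta> * (\<sigma> * a (Suc k) (?S x) + b (Suc k) (?S x))) m"
    by (rule corr_cong) (rule a_rec b_rec assms | assumption)+
  then show ?thesis
    using corr_minus[OF b_L2 a_L2, of "Suc k" "Suc k" "2 ^ k - m"]
    by (simp add: corr_add_left corr_add_right L2_add a_L2 b_L2 L2_cmult shift_L2 corr_cmult_right corr_shift_right algebra_simps)
qed

text \<open>Up to the unimodular factor \<beta> and a shift, which drop out of an autocorrelation,
  \<open>b k\<close> is the difference of \<open>b\<close> and \<open>a\<close> one level
  up.\<close>

lemma corr_bb_rec:
  assumes "k > 0" "\<sigma> = - 1"
  shows "corr (b k) (b k) m = corr (a (Suc k)) (a (Suc k)) m - corr (a (Suc k)) (b (Suc k)) m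
     - cnj (corr (a (Suc k)) (b (Suc k)) (- m)) + corr (b (Suc k)) (b (Suc k)) m"
proof -
  let ?S = "shift_power (- (2 ^ k)) :: (int \<Rightarrow> letter) \<Rightarrow> _"
  define u where "u x = - 1 * a (Suc k) x + b (Suc k) x" for x
  have uL: "u \<in> L2 \<mu>" unfolding u_def[abs_def] by (intro L2_add L2_cmult a_L2 b_L2)
  have "corr (b k) (b k) m = corr (\<lambda>x. \<beta> * u (?S x)) (\<lambda>x. \<beta> * u (?S x)) m"
    using b_rec[OF _ assms(1)] by (intro corr_cong) (simp_all add: assms(2) u_def)
  also have "\<dots> = cnj \<beta> * (\<beta> * corr (\<lambda>x. u (?S x)) (\<lambda>x. u (?S x)) m)"
    by (simp only: corr_cmult_left corr_cmult_right)
  also have "corr (\<lambda>x. u (?S x)) (\<lambda>x. u (?S x)) m = corr u u m"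
    unfolding corr_shift_left[OF uL shift_L2[OF uL]] corr_shift_right by simp
  also have "cnj \<beta> * (\<beta> * corr u u m) = (cnj \<beta> * \<beta>) * corr u u m" by (simp only: mult.assoc)
  also have "cnj \<beta> * \<beta> = 1" using norm_\<beta> complex_norm_square[of \<beta>] by (simp add: mult.commute)
  finally show ?thesis
    using corr_minus[OF b_L2 a_L2, of "Suc k" "Suc k" "- m"] unfolding u_def[abs_def]
    by (simp only: corr_add_left corr_add_right L2_add L2_cmult a_L2 b_L2 corr_cmult_left corr_cmult_right) simp
qed

text \<open>At this time the recursion refers to time 0 one level up: the diagonal terms cancel, as
  they have opposite signs and equal norms, and the mixed terms vanish by disjoint supports.\<close>

lemma corr_ab_one:
  assumes "\<sigma> = - 1" "k > 0"
  shows "corr (a k) (b k) (2 ^ k) = 0"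
proof -
  have "corr (a (Suc k)) (b (Suc k)) 0 = 0" by (rule corr_ab_zero) (auto dest!: zdvd_imp_le)
  moreover have "corr (a (Suc k)) (a (Suc k)) 0 = corr (b (Suc k)) (b (Suc k)) 0"
    unfolding corr_self_0 a_norm b_norm ..
  ultimately show ?thesis using corr_ab_rec[OF assms(2), of "2 ^ k"] by (simp add: assms(1))
qed

lemma not_dvd_odd_multiple: "odd r \<Longrightarrow> \<not> (2::int) ^ Suc k dvd 2 ^ k * r"
  by simp

text \<open>All other terms vanish, so the recursion reproduces this correlation one level up with
  the same modulus. By Cauchy-Schwarz it is also bounded by the product of the norms, which tends to
  0 with the level.\<close>

lemma corr_ab_minus_one:
  assumes \<sigma>: "\<sigma> = - 1" and "k > 0"
  shows "corr (a k) (b k) (- (2 ^ k)) = 0"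
proof -
  have step: "cmod (corr (a k) (b k) (- (2 ^ k))) = cmod (corr (a (Suc k)) (b (Suc k)) (- (2 ^ Suc k)))" if "k > 0" for k
  proof -
    have "corr (a (Suc k)) (a (Suc k)) (2 ^ Suc k * (- 1)) = 0" "corr (b (Suc k)) (b (Suc k)) (2 ^ Suc k * (- 1)) = 0"
      by (intro corr_aa_zero corr_bb_zero not_dvd_odd_multiple; simp)+
    moreover have "corr (a (Suc k)) (b (Suc k)) (2 ^ Suc k) = 0" by (intro corr_ab_one \<sigma>) simp
    moreover have "- (2 ^ k) - 2 ^ k = 2 ^ Suc k * (- 1 :: int)" "2 ^ k - - (2 ^ k) = (2 ^ Suc k :: int)" by simp_all
    ultimately have "corr (a k) (b k) (- (2 ^ k)) = \<beta> * corr (a (Suc k)) (b (Suc k)) (2 ^ Suc k * (- 1))"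
      using corr_ab_rec[OF that, of "- (2 ^ k)"] by (simp only:) simp
    then show ?thesis by (simp add: norm_mult norm_\<beta>)
  qed
  have eq: "cmod (corr (a k) (b k) (- (2 ^ k))) = cmod (corr (a (k + l)) (b (k + l)) (- (2 ^ (k + l))))" for l
    by (induction l) (use step assms(2) in auto)
  have le: "cmod (corr (a (k + l)) (b (k + l)) (- (2 ^ (k + l)))) \<le> 1 / 2 ^ l" for l
  proof -
    have "cmod (corr (a (k + l)) (b (k + l)) (- (2 ^ (k + l)))) \<le> L2_norm \<mu> (a (k + l)) * L2_norm \<mu> (b (k + l))"
      by (rule corr_bound[OF a_L2 b_L2])
    also have "L2_norm \<mu> (a (k + l)) = L2_norm \<mu> (b (k + l))"
      using a_norm[of "k + l"] b_norm[of "k + l"] L2_norm_nonneg by (metis power2_eq_imp_eq)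
    also have "L2_norm \<mu> (b (k + l)) * L2_norm \<mu> (b (k + l)) = 1 / 2 ^ Suc (k + l)"
      using b_norm[of "k + l"] by (simp add: power2_eq_square)
    also have "\<dots> \<le> 1 / 2 ^ l" by (intro divide_left_mono power_increasing) auto
    finally show ?thesis .
  qed
  have bd: "cmod (corr (a k) (b k) (- (2 ^ k))) \<le> (1 / 2) ^ l" for l
    using eq[of l] le[of l] by (simp add: power_divide)
  have "(\<lambda>l. (1 / 2 :: real) ^ l) \<longlonglongrightarrow> 0" by (intro LIMSEQ_power_zero) simp
  then have "cmod (corr (a k) (b k) (- (2 ^ k))) \<le> 0"
    using bd by (intro LIMSEQ_le_const) auto
  then show ?thesis by simp
qed

text \<open>The recursions send the time \<open>2\<^sup>k r\<close> at level \<open>k\<close> to times \<open>2\<^sup>k\<^sup>+\<^sup>1 s\<close> at level \<open>k + 1\<close> with \<open>|s| < |r|\<close>,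
  except for the fixed point \<open>r = s = -1\<close>, where the correlations decay with the level.\<close>

lemma odd_correlations_vanish:
  assumes \<sigma>: "\<sigma> = - 1" and "k > 0"
  shows "corr (a k) (b k) (2 ^ k * r) = 0 \<and> (r \<noteq> 0 \<longrightarrow> corr (a k) (a k) (2 ^ k * r) = 0 \<and> corr (b k) (b k) (2 ^ k * r) = 0)"
  using assms(2)
proof (induction "nat \<bar>r\<bar>" arbitrary: r k rule: less_induct)
  case less
  have IH: "corr (a (Suc k)) (b (Suc k)) (2 ^ Suc k * s) = 0"
    "s \<noteq> 0 \<Longrightarrow> corr (a (Suc k)) (a (Suc k)) (2 ^ Suc k * s) = 0"
    "s \<noteq> 0 \<Longrightarrow> corr (b (Suc k)) (b (Suc k)) (2 ^ Suc k * s) = 0" if "\<bar>s\<bar> < \<bar>r\<bar>" for s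
    using less.hyps[of s "Suc k"] that by auto
  show ?case
  proof (cases "even r")
    case True
    then obtain s where s: "r = 2 * s" by blast
    have eq: "2 ^ k * r = 2 ^ Suc k * s" by (simp add: s)
    have "\<not> (2::int) ^ Suc k dvd 2 ^ k * (r - 1)" using True by (intro not_dvd_odd_multiple) simp
    then have "corr (a k) (b k) (2 ^ k * r) = 0" by (intro corr_ab_zero) (simp add: right_diff_distrib)
    moreover have "corr (a k) (a k) (2 ^ k * r) = 0 \<and> corr (b k) (b k) (2 ^ k * r) = 0" if "r \<noteq> 0"
    proof -
      have s': "\<bar>s\<bar> < \<bar>r\<bar>" "\<bar>- s\<bar> < \<bar>r\<bar>" "s \<noteq> 0" using that s by auto
      have m: "- (2 ^ Suc k * s) = 2 ^ Suc k * (- s)" by simp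
      note z = IH(1)[OF s'(1)] IH(1)[OF s'(2)] IH(2)[OF s'(1,3)] IH(3)[OF s'(1,3)]
      show ?thesis
        unfolding eq corr_aa_rec[of k] corr_bb_rec[OF less.prems \<sigma>] m z by simp
    qed
    ultimately show ?thesis by blast
  next
    case False
    then obtain s where s: "r = 2 * s + 1" by (elim oddE)
    have "corr (a k) (a k) (2 ^ k * r) = 0" "corr (b k) (b k) (2 ^ k * r) = 0"
      by (intro corr_aa_zero corr_bb_zero not_dvd_odd_multiple False)+
    moreover have "corr (a k) (b k) (2 ^ k * r) = 0"
    proof -
      \<comment> \<open>The recursion passes from \<open>r\<close> to \<open>s\<close>. For
        \<open>r = 1\<close> it meets the nonzero diagonal terms at \<open>s = 0\<close>, and for
        \<open>r = - 1\<close> nothing decreases; both values were treated separately.\<close>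
      consider "r = - 1" | "r = 1" | "\<bar>s\<bar> < \<bar>r\<bar>" "s \<noteq> 0" using s by linarith
      then show ?thesis
      proof cases
        case 1
        then show ?thesis using corr_ab_minus_one[OF \<sigma> less.prems] by simp
      next
        case 2
        then show ?thesis using corr_ab_one[OF \<sigma> less.prems] by simp
      next
        case 3
        have m: "2 ^ k * r - 2 ^ k = 2 ^ Suc k * s" "2 ^ k - 2 ^ k * r = 2 ^ Suc k * (- s)"
          by (simp_all add: s algebra_simps)
        have "\<bar>- s\<bar> < \<bar>r\<bar>" using 3 by simp
        note z = IH(1)[OF 3(1)] IH(1)[OF this] IH(2)[OF 3] IH(3)[OF 3]
        show ?thesis unfolding corr_ab_rec[OF less.prems] m z by simp
      qed
    qed
    ultimately show ?thesis by blast
  qed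
qed

lemma odd_corr_a:
  assumes "\<sigma> = - 1" "k > 0"
  shows "corr (a k) (a k) m = of_bool (m = 0) / 2 ^ Suc k" "corr (b k) (b k) m = of_bool (m = 0) / 2 ^ Suc k"
proof -
  have 0: "corr (a k) (a k) m = 0 \<and> corr (b k) (b k) m = 0" if "m \<noteq> 0"
  proof (cases "2 ^ k dvd m")
    case True
    then obtain r where "m = 2 ^ k * r" by blast
    then show ?thesis using odd_correlations_vanish[OF assms, of r] that by auto
  next
    case False
    then have "\<not> 2 ^ Suc k dvd m" using power_le_dvd[of 2 "Suc k" m k] by auto
    then show ?thesis using corr_aa_zero corr_bb_zero by blast
  qed
  show "corr (a k) (a k) m = of_bool (m = 0) / 2 ^ Suc k" "corr (b k) (b k) m = of_bool (m = 0) / 2 ^ Suc k"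
    using 0 corr_self_0[of "a k"] corr_self_0[of "b k"] a_norm[of k] b_norm[of k] by (cases "m = 0"; simp)+
qed

lemma odd_lebesgue_vector:
  assumes "\<sigma> = - 1" "k > 0" "f \<in> {a k, b k}"
  shows "is_spectral_measure \<mu> (\<lambda>x. of_real (sqrt (2 ^ Suc k)) * f x) circle_lebesgue"
proof (rule lebesgue_spectral_measure)
  fix m
  have "corr f f m = of_bool (m = 0) / 2 ^ Suc k" using odd_corr_a[OF assms(1,2)] assms(3) by blast
  moreover have "complex_of_real (sqrt (2 ^ Suc k)) * of_real (sqrt (2 ^ Suc k)) = 2 ^ Suc k"
    by (simp only: of_real_mult[symmetric] real_sqrt_mult_self) simp
  ultimately show "corr (\<lambda>x. of_real (sqrt (2 ^ Suc k)) * f x) (\<lambda>x. of_real (sqrt (2 ^ Suc k)) * f x) m = of_bool (m = 0)"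
    by (simp only: corr_cmult_left corr_cmult_right complex_cnj_complex_of_real mult.assoc[symmetric]) simp
qed

text \<open>Having Lebesgue spectral measure is not preserved under sums, whereas this domination
  is. Norms rather than squares are compared, so that the triangle inequality simply adds the
  constants.\<close>

definition lebesgue_bounded :: "((int \<Rightarrow> letter) \<Rightarrow> complex) \<Rightarrow> bool" where
  "lebesgue_bounded f \<longleftrightarrow> (\<exists>C. \<forall>q. L2_norm \<mu> (tpoly_op q f) \<le> C * sqrt (\<integral>z. (cmod (tpoly q z))\<^sup>2 \<partial>circle_lebesgue))"

lemma lebesgue_bounded_cmult_shift:
  assumes "lebesgue_bounded f" "f \<in> L2 \<mu>" "\<And>x. x \<in> space \<mu> \<Longrightarrow> g x = c * f (shift_power e x)"
  shows "lebesgue_bounded g"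
proof -
  obtain C where C: "\<And>q. L2_norm \<mu> (tpoly_op q f) \<le> C * sqrt (\<integral>z. (cmod (tpoly q z))\<^sup>2 \<partial>circle_lebesgue)"
    using assms(1) unfolding lebesgue_bounded_def by blast
  have "L2_norm \<mu> (tpoly_op q g) \<le> (cmod c * C) * sqrt (\<integral>z. (cmod (tpoly q z))\<^sup>2 \<partial>circle_lebesgue)" for q
  proof -
    have "L2_norm \<mu> (tpoly_op q g) = L2_norm \<mu> (\<lambda>x. c * tpoly_op q f (shift_power e x))"
      using tpoly_op_cong[of g "\<lambda>x. c * f (shift_power e x)", OF assms(3)]
      by (intro L2_norm_cong) (simp add: tpoly_op_cmult tpoly_op_shift_power)
    also have "\<dots> = cmod c * L2_norm \<mu> (tpoly_op q f)"
      unfolding L2_norm_cmult L2_norm_shift[OF tpoly_op_L2[OF assms(2)]] ..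
    also have "\<dots> \<le> cmod c * (C * sqrt (\<integral>z. (cmod (tpoly q z))\<^sup>2 \<partial>circle_lebesgue))"
      by (intro mult_left_mono C) simp
    finally show ?thesis by (simp add: mult.assoc)
  qed
  then show ?thesis unfolding lebesgue_bounded_def by blast
qed

lemma lebesgue_bounded_sum:
  assumes "finite I" "\<And>i. i \<in> I \<Longrightarrow> lebesgue_bounded (f i)" "\<And>i. i \<in> I \<Longrightarrow> f i \<in> L2 \<mu>"
  shows "lebesgue_bounded (\<lambda>x. \<Sum>i\<in>I. f i x)"
proof -
  obtain C where C: "\<And>i q. i \<in> I \<Longrightarrow> L2_norm \<mu> (tpoly_op q (f i)) \<le> C i * sqrt (\<integral>z. (cmod (tpoly q z))\<^sup>2 \<partial>circle_lebesgue)"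
    using assms(2) unfolding lebesgue_bounded_def by metis
  have "L2_norm \<mu> (tpoly_op q (\<lambda>x. \<Sum>i\<in>I. f i x)) \<le> (\<Sum>i\<in>I. C i) * sqrt (\<integral>z. (cmod (tpoly q z))\<^sup>2 \<partial>circle_lebesgue)" for q
  proof -
    have "L2_norm \<mu> (tpoly_op q (\<lambda>x. \<Sum>i\<in>I. f i x)) = L2_norm \<mu> (\<lambda>x. \<Sum>i\<in>I. tpoly_op q (f i) x)"
      by (intro L2_norm_cong tpoly_op_sum assms(1))
    also have "\<dots> \<le> (\<Sum>i\<in>I. L2_norm \<mu> (tpoly_op q (f i)))" by (intro L2_norm_sum tpoly_op_L2 assms(3))
    also have "\<dots> \<le> (\<Sum>i\<in>I. C i * sqrt (\<integral>z. (cmod (tpoly q z))\<^sup>2 \<partial>circle_lebesgue))" by (intro sum_mono C)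
    finally show ?thesis by (simp add: sum_distrib_right)
  qed
  then show ?thesis unfolding lebesgue_bounded_def by blast
qed

lemma odd_lebesgue_bounded:
  assumes "\<sigma> = - 1" "k > 0" "f \<in> {a k, b k}"
  shows "lebesgue_bounded f"
proof -
  have fL: "f \<in> L2 \<mu>" using assms(3) a_L2 b_L2 by blast
  let ?c = "complex_of_real (sqrt (2 ^ Suc k))"
  have "L2_norm \<mu> (tpoly_op q (\<lambda>x. ?c * f x)) = sqrt (\<integral>z. (cmod (tpoly q z))\<^sup>2 \<partial>circle_lebesgue)" for q
    using spectral_tpoly_norm[OF L2_cmult[OF fL] odd_lebesgue_vector[OF assms], of q] L2_norm_nonneg
    by (metis real_sqrt_abs abs_of_nonneg)
  then have "lebesgue_bounded (\<lambda>x. ?c * f x)"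
    unfolding lebesgue_bounded_def by (intro exI[of _ 1]) simp
  then show ?thesis
    by (rule lebesgue_bounded_cmult_shift[of _ _ "inverse ?c" 0, OF _ L2_cmult[OF fL]]) (simp add: mult.assoc[symmetric])
qed

text \<open>Finite combinations of cylinder vectors are dominated by Lebesgue measure, with
  constants that may blow up along the approximation; the passage to the limit tolerates
  this.\<close>

lemma odd_case_absolutely_continuous:
  assumes g: "g \<in> H_chi \<alpha> \<mu> \<nu> n" and spec: "is_spectral_measure \<mu> g \<rho>"
    and \<nu>: "sets \<nu> = sets (restrict_space borel dyadic)" and \<sigma>: "\<sigma> = - 1"
  shows "absolutely_continuous circle_lebesgue \<rho>"
proof (rule spectral_absolutely_continuous[OF _ spec])
  show "g \<in> L2 \<mu>" using g by (simp add: H_chi_def)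
  fix \<epsilon> :: real assume "\<epsilon> > 0"
  \<comment> \<open>Level at least 2 makes \<open>K - 1\<close> positive, as the odd correlations
    require.\<close>
  then obtain K h where K: "K \<ge> 2" and h: "L2_norm \<mu> (\<lambda>x. g x - (\<Sum>j<2 ^ K. h j * cyl K j x)) \<le> \<epsilon>"
    using H_chi_approximation[OF g \<nu>, of \<epsilon> 2] by blast
  define f where "f x = (\<Sum>j<2 ^ K. h j * cyl K j x)" for x
  have fL: "f \<in> L2 \<mu>" unfolding f_def[abs_def] by (intro L2_sum L2_cmult cyl_L2)
  have "lebesgue_bounded (\<lambda>x. h j * cyl K j x)" if j: "j < 2 ^ K" for j
  proof -
    obtain c e u where u: "u \<in> {a (K - 1), b (K - 1)}" "\<And>x. x \<in> space \<mu> \<Longrightarrow> cyl K j x = c * u (shift_power e x)"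
      using cyl_reduce[OF j] K by auto
    have "lebesgue_bounded u" using odd_lebesgue_bounded[OF \<sigma> _ u(1)] K by simp
    moreover have "u \<in> L2 \<mu>" using u(1) a_L2 b_L2 by blast
    ultimately show ?thesis by (rule lebesgue_bounded_cmult_shift[of _ _ "h j * c" e]) (simp add: u(2))
  qed
  then have "lebesgue_bounded f" unfolding f_def[abs_def] by (intro lebesgue_bounded_sum L2_cmult cyl_L2) auto
  then obtain C where C: "\<And>q. L2_norm \<mu> (tpoly_op q f) \<le> C * sqrt (\<integral>z. (cmod (tpoly q z))\<^sup>2 \<partial>circle_lebesgue)"
    unfolding lebesgue_bounded_def by blast
  have "(L2_norm \<mu> (tpoly_op q f))\<^sup>2 \<le> C\<^sup>2 * (\<integral>z. (cmod (tpoly q z))\<^sup>2 \<partial>circle_lebesgue)" for q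
    using power_mono[OF C[of q] L2_norm_nonneg, of 2] by (simp add: power_mult_distrib)
  then show "\<exists>f\<in>L2 \<mu>. L2_norm \<mu> (\<lambda>x. g x - f x) \<le> \<epsilon> \<and>
       (\<exists>C. \<forall>q. (L2_norm \<mu> (tpoly_op q f))\<^sup>2 \<le> C * (\<integral>z. (cmod (tpoly q z))\<^sup>2 \<partial>circle_lebesgue))"
    using fL h unfolding f_def[symmetric] by blast
qed

end


section \<open>Absence of atoms\<close>

context koopman
begin

definition weighted_sum :: "nat \<Rightarrow> complex \<Rightarrow> ((int \<Rightarrow> 'a) \<Rightarrow> complex) \<Rightarrow> (int \<Rightarrow> 'a) \<Rightarrow> complex" where
  "weighted_sum N w f x = (\<Sum>m<N. w ^ m * f (shift_power (int m) x))"

lemma weighted_sum_L2: "f \<in> L2 M \<Longrightarrow> weighted_sum N w f \<in> L2 M"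
  unfolding weighted_sum_def[abs_def] by (intro L2_sum L2_cmult shift_L2)

lemma weighted_sum_norm:
  assumes "f \<in> L2 M" "norm w = 1"
  shows "L2_norm M (weighted_sum N w f) \<le> real N * L2_norm M f"
proof -
  have "L2_norm M (weighted_sum N w f) \<le> (\<Sum>m<N. L2_norm M (\<lambda>x. w ^ m * f (shift_power (int m) x)))"
    unfolding weighted_sum_def[abs_def] by (intro L2_norm_sum L2_cmult shift_L2 assms)
  also have "\<dots> = real N * L2_norm M f"
    unfolding L2_norm_cmult L2_norm_shift[OF assms(1)] by (simp add: norm_power assms(2))
  finally show ?thesis .
qed

lemma L2_inner_weighted_sum:
  assumes "f \<in> L2 M" "g \<in> L2 M"
  shows "L2_inner M f (weighted_sum N w g) = (\<Sum>m<N. w ^ m * corr f g (int m))"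
proof (induction N)
  case (Suc N)
  have "L2_inner M f (\<lambda>x. weighted_sum N w g x + w ^ N * g (shift_power (int N) x)) =
     L2_inner M f (weighted_sum N w g) + w ^ N * corr f g (int N)"
    using assms by (simp add: L2_inner_add_right weighted_sum_L2 L2_cmult shift_L2 L2_inner_cmult_right corr_def)
  then show ?case using Suc by (simp add: weighted_sum_def[abs_def])
qed (simp add: weighted_sum_def[abs_def])

text \<open>Shifting by one step multiplies the sum by \<open>w\<close> except for one term at each
  end, and these are bounded by 1.\<close>

lemma weighted_sum_shift_1:
  assumes "x \<in> space M" "norm w = 1" "\<And>x. x \<in> space M \<Longrightarrow> cmod (f x) \<le> 1"
  shows "cmod (weighted_sum N w (\<lambda>x. f (shift_power (- 1) x)) x - w * weighted_sum N w f x) \<le> 2"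
proof (cases N)
  case 0
  then show ?thesis by (simp add: weighted_sum_def)
next
  case (Suc N')
  have 1: "weighted_sum N w (\<lambda>x. f (shift_power (- 1) x)) x =
      f (shift_power (- 1) x) + (\<Sum>m<N'. w * (w ^ m * f (shift_power (int m) x)))"
    unfolding weighted_sum_def Suc sum.lessThan_Suc_shift by (simp add: shift_power_add mult.assoc)
  have 2: "w * weighted_sum N w f x = (\<Sum>m<N'. w * (w ^ m * f (shift_power (int m) x))) + w ^ Suc N' * f (shift_power (int N') x)"
    unfolding weighted_sum_def Suc by (simp add: sum_distrib_left distrib_left)
  have "weighted_sum N w (\<lambda>x. f (shift_power (- 1) x)) x - w * weighted_sum N w f x =
     f (shift_power (- 1) x) - w ^ Suc N' * f (shift_power (int N') x)"
    unfolding 1 2 by simp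
  also have "cmod \<dots> \<le> cmod (f (shift_power (- 1) x)) + cmod (w ^ Suc N' * f (shift_power (int N') x))"
    by (rule norm_triangle_ineq4)
  also have "\<dots> \<le> 1 + 1"
    using assms(3)[OF shift_space[OF assms(1)]] by (intro add_mono) (simp_all add: norm_mult norm_power assms(2))
  finally show ?thesis by simp
qed

lemma weighted_sum_shift:
  assumes "x \<in> space M" "norm w = 1" "\<And>x. x \<in> space M \<Longrightarrow> cmod (f x) \<le> 1"
  shows "cmod (weighted_sum N w (\<lambda>x. f (shift_power (- int P) x)) x - w ^ P * weighted_sum N w f x) \<le> 2 * real P"
proof (induction P)
  case (Suc P)
  define h where "h x = f (shift_power (- int P) x)" for x
  have eq: "(\<lambda>x. f (shift_power (- int (Suc P)) x)) = (\<lambda>x. h (shift_power (- 1) x))"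
  proof -
    have "- int (Suc P) = - int P + - 1" by simp
    then show ?thesis by (simp only: h_def shift_power_add)
  qed
  have 1: "cmod (weighted_sum N w (\<lambda>x. h (shift_power (- 1) x)) x - w * weighted_sum N w h x) \<le> 2"
    using assms(3)[OF shift_space] by (intro weighted_sum_shift_1 assms) (simp add: h_def)
  have 2: "cmod (w * (weighted_sum N w h x - w ^ P * weighted_sum N w f x)) \<le> 2 * real P"
    using Suc by (simp add: norm_mult assms(2) h_def[abs_def])
  have 3: "weighted_sum N w (\<lambda>x. h (shift_power (- 1) x)) x - w ^ Suc P * weighted_sum N w f x =
      (weighted_sum N w (\<lambda>x. h (shift_power (- 1) x)) x - w * weighted_sum N w h x) +
      w * (weighted_sum N w h x - w ^ P * weighted_sum N w f x)"
    by (simp add: algebra_simps)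
  show ?case unfolding eq 3
    by (rule order_trans[OF norm_triangle_ineq order_trans[OF add_mono[OF 1 2]]]) simp
qed simp

end

section \<open>Elementary estimates for the Riesz product\<close>

lemma card_multiples_shifted:
  fixes P r N :: nat
  assumes "P > 0" "r < P"
  shows "card {m. m < N \<and> P dvd (r + m)} \<le> N div P + 2"
proof -
  let ?S = "{m. m < N \<and> P dvd (r + m)}"
  have "inj_on (\<lambda>m. (r + m) div P) ?S"
  proof (rule inj_onI)
    fix m m' assume "m \<in> ?S" "m' \<in> ?S" "(r + m) div P = (r + m') div P"
    then show "m = m'" by (metis (no_types, lifting) dvd_div_mult_self mem_Collect_eq add_left_cancel)
  qed
  moreover have "(\<lambda>m. (r + m) div P) ` ?S \<subseteq> {..(P + N) div P}"
  proof
    fix l assume "l \<in> (\<lambda>m. (r + m) div P) ` ?S"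
    then obtain m where m: "l = (r + m) div P" "m < N" by blast
    have "(r + m) div P \<le> (P + N) div P" by (rule div_le_mono) (use m assms in linarith)
    then show "l \<in> {..(P + N) div P}" using m by blast
  qed
  ultimately have "card ?S \<le> card {..(P + N) div P}" by (intro card_inj_on_le) auto
  also have "\<dots> = N div P + 2" using assms by simp
  finally show ?thesis .
qed

lemma prod_pairs_bound:
  fixes F :: "nat \<Rightarrow> real"
  assumes "\<And>i. F i \<ge> 0" "\<And>i. F i * F (Suc i) \<le> \<kappa>"
  shows "(\<Prod>i<2 * j. F i) \<le> \<kappa> ^ j"
proof (induction j)
  case (Suc j)
  have nn: "0 \<le> F i * F (Suc i)" for i by (rule mult_nonneg_nonneg) (rule assms(1))+
  have "\<kappa> \<ge> 0" using nn[of 0] assms(2)[of 0] by (rule order_trans)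
  have "(\<Prod>i<2 * Suc j. F i) = (\<Prod>i<2 * j. F i) * (F (2 * j) * F (Suc (2 * j)))" by (simp add: mult.assoc)
  also have "\<dots> \<le> \<kappa> ^ j * \<kappa>"
    by (rule mult_mono[OF Suc assms(2) zero_le_power[OF \<open>\<kappa> \<ge> 0\<close>] nn])
  finally show ?case by (simp add: mult.commute)
qed simp

lemma norm_one_plus_eq_2:
  fixes u :: complex
  assumes "norm u = 1" "norm (1 + u) = 2" shows "u = 1"
proof -
  have "(norm (1 + u))\<^sup>2 = 2 + 2 * Re u"
  proof -
    have "(Re u)\<^sup>2 + (Im u)\<^sup>2 = 1" using assms(1) cmod_power2[of u] by simp
    then show ?thesis unfolding cmod_power2 by (simp add: power2_sum algebra_simps)
  qed
  then have "Re u = 1" using assms(2) by simp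
  moreover have "(Re u)\<^sup>2 + (Im u)\<^sup>2 = 1" using assms(1) cmod_power2[of u] by simp
  ultimately show ?thesis by (simp add: complex_eq_iff)
qed

text \<open>By compactness a maximum is attained. The value 1 would force equality in both triangle
  inequalities, hence \<open>\<beta> * v = 1\<close> and \<open>\<beta> * v\<^sup>2 = 1\<close>, so
  \<open>v = 1\<close> and then \<open>\<beta> = 1\<close>.\<close>

lemma double_angle_contraction:
  fixes \<beta> :: complex
  assumes "norm \<beta> = 1" "\<beta> \<noteq> 1"
  obtains \<kappa> where "\<kappa> < 1" "\<kappa> \<ge> 0" "\<And>v. norm v = 1 \<Longrightarrow> norm (1 + \<beta> * v) / 2 * (norm (1 + \<beta> * v\<^sup>2) / 2) \<le> \<kappa>"
proof -
  define F where "F v = norm (1 + \<beta> * v) / 2 * (norm (1 + \<beta> * v\<^sup>2) / 2)" for v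
  have "\<exists>v0\<in>circle. \<forall>v\<in>circle. F v \<le> F v0"
    unfolding F_def by (intro continuous_attains_sup continuous_intros) auto
  then obtain v0 where v0: "norm v0 = 1" "\<And>v. norm v = 1 \<Longrightarrow> F v \<le> F v0" by auto
  have le: "norm (1 + \<beta> * v) / 2 \<le> 1" if "norm v = 1" for v
    using norm_triangle_ineq[of 1 "\<beta> * v"] that assms(1) by (simp add: norm_mult)
  have "F v0 < 1"
  proof (rule ccontr)
    assume neg: "\<not> F v0 < 1"
    define p q where "p = norm (1 + \<beta> * v0) / 2" and "q = norm (1 + \<beta> * v0\<^sup>2) / 2"
    have pq: "p \<le> 1" "q \<le> 1" unfolding p_def q_def by (intro le; simp add: v0 norm_power)+
    have pq': "p \<ge> 0" "q \<ge> 0" by (simp_all add: p_def q_def)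
    have "F v0 = p * q" by (simp only: F_def p_def q_def)
    then have 1: "1 \<le> p * q" using neg by simp
    have "p * q \<le> p" "p * q \<le> q" using pq pq' by (simp_all add: mult_left_le mult_left_le_one_le)
    then have "p = 1" "q = 1" using pq 1 by linarith+
    then have "\<beta> * v0 = 1" "\<beta> * v0\<^sup>2 = 1"
      by (intro norm_one_plus_eq_2; simp add: p_def q_def norm_mult norm_power v0 assms)+
    then have "v0 = 1" by (simp add: power2_eq_square flip: mult.assoc)
    then show False using \<open>\<beta> * v0 = 1\<close> assms(2) by simp
  qed
  moreover have "F v0 \<ge> 0" by (simp add: F_def)
  ultimately show ?thesis using that v0(2) unfolding F_def by blast
qed

context subshift_character
begin

text \<open>For \<sigma> = 1 the bracket in the recursion for \<open>b\<close> is exactly the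
  splitting of \<open>a\<close>, so \<open>b (Suc k)\<close> is a shifted multiple of
  \<open>a (Suc k)\<close> and can be eliminated.\<close>

lemma even_a_rec:
  assumes "\<sigma> = 1" "x \<in> space \<mu>"
  shows "a k x = a (Suc k) x + \<beta> * a (Suc k) (shift_power (- (2 ^ Suc k)) x)"
  using a_rec[of k x] b_rec[OF assms(2), of "Suc k"] a_rec[of "Suc k"] by (simp add: assms(1))

lemma even_b:
  assumes "\<sigma> = 1" "x \<in> space \<mu>" "k > 0"
  shows "b k x = \<beta> * a k (shift_power (- (2 ^ k)) x)"
  using b_rec[OF assms(2,3)] a_rec[of k] by (simp add: assms(1))

lemma cyl_reduce_even:
  assumes "\<sigma> = 1" "j < 2 ^ K" "K \<ge> 2"
  shows "\<exists>c e. \<forall>x\<in>space \<mu>. cyl K j x = c * a (K - 1) (shift_power e x)"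
proof -
  obtain c e f where f: "f \<in> {a (K - 1), b (K - 1)}" "\<And>x. x \<in> space \<mu> \<Longrightarrow> cyl K j x = c * f (shift_power e x)"
    using cyl_reduce[OF assms(2)] assms(3) by fastforce
  show ?thesis
  proof (cases "f = a (K - 1)")
    case True
    then show ?thesis using f(2) by blast
  next
    case False
    then have "f = b (K - 1)" using f(1) by blast
    then have "cyl K j x = (c * \<beta>) * a (K - 1) (shift_power (- (2 ^ (K - 1)) + e) x)" if "x \<in> space \<mu>" for x
      using f(2)[OF that] even_b[OF assms(1) shift_space[OF that], of "K - 1"] assms(3) by (simp add: shift_power_add)
    then show ?thesis by blast
  qed
qed

lemma a_bound: "x \<in> space \<mu> \<Longrightarrow> cmod (a k x) \<le> 1"
  unfolding a_def by (rule cyl_bound)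

text \<open>Inside a twisted sum the shift acts as a power of \<open>w\<close>, up to boundary terms
  whose number depends on the level but not on \<open>N\<close>.\<close>

lemma weighted_sum_a_rec:
  assumes "\<sigma> = 1" "x \<in> space \<mu>" "norm w = 1"
  shows "cmod (weighted_sum N w (a k) x) \<le> cmod (1 + \<beta> * w ^ 2 ^ Suc k) * cmod (weighted_sum N w (a (Suc k)) x) + 2 * 2 ^ Suc k"
proof -
  let ?h = "\<lambda>x. a (Suc k) (shift_power (- int (2 ^ Suc k)) x)"
  have "weighted_sum N w (a k) x = weighted_sum N w (a (Suc k)) x + \<beta> * weighted_sum N w ?h x"
    unfolding weighted_sum_def sum_distrib_left sum.distrib[symmetric]
    by (intro sum.cong refl) (simp add: even_a_rec[OF assms(1) shift_space[OF assms(2)], where k = k] algebra_simps)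
  also have "\<dots> = (1 + \<beta> * w ^ 2 ^ Suc k) * weighted_sum N w (a (Suc k)) x +
     \<beta> * (weighted_sum N w ?h x - w ^ 2 ^ Suc k * weighted_sum N w (a (Suc k)) x)"
    by (simp add: algebra_simps)
  also have "cmod \<dots> \<le> cmod (1 + \<beta> * w ^ 2 ^ Suc k) * cmod (weighted_sum N w (a (Suc k)) x) + 2 * real (2 ^ Suc k)"
    using weighted_sum_shift[of x w "a (Suc k)" N "2 ^ Suc k", OF assms(2,3) a_bound]
    by (intro order_trans[OF norm_triangle_ineq] add_mono) (simp_all only: norm_mult norm_\<beta> mult_1_left order_refl)
  finally show ?thesis by simp
qed

text \<open>The orbit meets the support of \<open>a k\<close> along a single residue class, so only
  about one term in \<open>2 ^ (k + 1)\<close> is nonzero.\<close>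

lemma weighted_sum_a_trivial:
  assumes "x \<in> space \<mu>" "norm w = 1"
  shows "cmod (weighted_sum N w (a k) x) \<le> real N / 2 ^ Suc k + 2"
proof -
  let ?r = "residue \<alpha> x (Suc k)" and ?P = "2 ^ Suc k :: nat"
  have "cmod (weighted_sum N w (a k) x) \<le> (\<Sum>m<N. of_bool (?P dvd (?r + m)))"
    unfolding weighted_sum_def
  proof (intro sum_norm_le)
    fix m
    have "int (residue \<alpha> (shift_power (int m) x) (Suc k)) = int ((?r + m) mod ?P)"
      using residue_shift_\<mu>[OF assms(1), of "int m" "Suc k"] by (simp add: zmod_int)
    then have "residue \<alpha> (shift_power (int m) x) (Suc k) = (?r + m) mod ?P" by (simp only: of_nat_eq_iff)
    then have "a k (shift_power (int m) x) = 0" if "\<not> ?P dvd (?r + m)"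
      using that unfolding a_def cyl_def by (simp add: dvd_eq_mod_eq_0)
    then show "cmod (w ^ m * a k (shift_power (int m) x)) \<le> of_bool (?P dvd (?r + m))"
      using a_bound[OF shift_space[OF assms(1)], of k "int m"] by (simp add: norm_mult norm_power assms(2) del: power_Suc)
  qed
  also have "\<dots> = real (card {m. m < N \<and> ?P dvd (?r + m)})"
    by (simp add: sum.If_cases of_bool_def lessThan_def Collect_conj_eq del: power_Suc)
  also have "\<dots> \<le> real (N div ?P + 2)"
    using card_multiples_shifted[of ?P ?r N] residue_less[of \<alpha> x "Suc k"] by (intro of_nat_mono) simp
  also have "\<dots> \<le> real N / 2 ^ Suc k + 2" using of_nat_div_le_of_nat[of N ?P, where 'a=real] by simp
  finally show ?thesis .
qed

text \<open>Each use of the recursion costs a factor of at most 2, while the support one level up is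
  half as dense; the halves in the product express this balance. The constant \<open>C\<close>
  collects the boundary terms and is uniform in \<open>N\<close> and \<open>x\<close>.\<close>

lemma weighted_sum_a_bound:
  assumes "\<sigma> = 1" "norm w = 1"
  shows "\<exists>C. \<forall>N. \<forall>x\<in>space \<mu>. cmod (weighted_sum N w (a k) x) \<le>
     (\<Prod>i<j. cmod (1 + \<beta> * w ^ 2 ^ Suc (k + i)) / 2) * real N / 2 ^ Suc k + C"
proof (induction j arbitrary: k)
  case 0
  then show ?case using weighted_sum_a_trivial[OF _ assms(2)] by (intro exI[of _ 2]) auto
next
  case (Suc j)
  obtain C where C: "\<And>N x. x \<in> space \<mu> \<Longrightarrow> cmod (weighted_sum N w (a (Suc k)) x) \<le>
     (\<Prod>i<j. cmod (1 + \<beta> * w ^ 2 ^ Suc (Suc k + i)) / 2) * real N / 2 ^ Suc (Suc k) + C" using Suc by blast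
  let ?F = "cmod (1 + \<beta> * w ^ 2 ^ Suc k)" and ?Q = "\<Prod>i<j. cmod (1 + \<beta> * w ^ 2 ^ Suc (Suc k + i)) / 2"
  have "cmod (weighted_sum N w (a k) x) \<le> (\<Prod>i<Suc j. cmod (1 + \<beta> * w ^ 2 ^ Suc (k + i)) / 2) * real N / 2 ^ Suc k + (?F * C + 2 * 2 ^ Suc k)"
    if "x \<in> space \<mu>" for N x
  proof -
    have "cmod (weighted_sum N w (a k) x) \<le> ?F * cmod (weighted_sum N w (a (Suc k)) x) + 2 * 2 ^ Suc k"
      by (rule weighted_sum_a_rec[OF assms(1) that assms(2)])
    also have "\<dots> \<le> ?F * (?Q * real N / 2 ^ Suc (Suc k) + C) + 2 * 2 ^ Suc k"
      using C[OF that] by (intro add_right_mono mult_left_mono) auto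
    also have "\<dots> = (?F / 2 * ?Q) * real N / 2 ^ Suc k + (?F * C + 2 * 2 ^ Suc k)"
      by (simp add: field_simps)
    also have "?F / 2 * ?Q = (\<Prod>i<Suc j. cmod (1 + \<beta> * w ^ 2 ^ Suc (k + i)) / 2)"
      unfolding prod.lessThan_Suc_shift by simp
    finally show ?thesis .
  qed
  then show ?case by blast
qed

definition averages_vanish :: "complex \<Rightarrow> ((int \<Rightarrow> letter) \<Rightarrow> complex) \<Rightarrow> bool" where
  "averages_vanish w f \<longleftrightarrow> (\<forall>\<epsilon>>0. \<exists>N0. \<forall>N\<ge>N0. \<forall>x\<in>space \<mu>. cmod (weighted_sum N w f x) \<le> \<epsilon> * real N)"

text \<open>Consecutive factors of the product are evaluated at a point of the circle and at its
  square, so each pair gains the contraction factor \<kappa>. Choose the number of pairs, then let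
  \<open>N\<close> absorb the constant.\<close>

lemma averages_vanish_a:
  assumes "\<sigma> = 1" "\<beta> \<noteq> 1" "norm w = 1"
  shows "averages_vanish w (a k)"
  unfolding averages_vanish_def
proof (intro allI impI)
  fix \<epsilon> :: real assume \<epsilon>: "\<epsilon> > 0"
  obtain \<kappa> where \<kappa>: "\<kappa> < 1" "\<kappa> \<ge> 0" "\<And>v. norm v = 1 \<Longrightarrow> cmod (1 + \<beta> * v) / 2 * (cmod (1 + \<beta> * v\<^sup>2) / 2) \<le> \<kappa>"
    using double_angle_contraction[OF norm_\<beta> assms(2)] by blast
  define F where "F i = cmod (1 + \<beta> * w ^ 2 ^ Suc (k + i)) / 2" for i
  have "F i * F (Suc i) \<le> \<kappa>" for i
  proof -
    have "w ^ 2 ^ Suc (k + Suc i) = (w ^ 2 ^ Suc (k + i))\<^sup>2" by (simp add: mult.commute flip: power_mult)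
    then show ?thesis using \<kappa>(3)[of "w ^ 2 ^ Suc (k + i)"] assms(3) unfolding F_def by (simp add: norm_power del: power_Suc)
  qed
  then have F: "(\<Prod>i<2 * j. F i) \<le> \<kappa> ^ j" for j by (intro prod_pairs_bound) (simp_all add: F_def)
  obtain j where j: "\<kappa> ^ j < \<epsilon> / 2" using real_arch_pow_inv[of "\<epsilon> / 2" \<kappa>] \<epsilon> \<kappa>(1) by auto
  obtain C where C: "\<And>N x. x \<in> space \<mu> \<Longrightarrow> cmod (weighted_sum N w (a k) x) \<le> (\<Prod>i<2 * j. F i) * real N / 2 ^ Suc k + C"
    using weighted_sum_a_bound[OF assms(1,3), of k "2 * j"] unfolding F_def by blast
  obtain N0 :: nat where N0: "2 * C / \<epsilon> < real N0" using reals_Archimedean2 by blast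
  have "cmod (weighted_sum N w (a k) x) \<le> \<epsilon> * real N" if "N \<ge> N0" "x \<in> space \<mu>" for N x
  proof -
    have "cmod (weighted_sum N w (a k) x) \<le> (\<Prod>i<2 * j. F i) * real N / 2 ^ Suc k + C" by (rule C[OF that(2)])
    also have "(\<Prod>i<2 * j. F i) * real N / 2 ^ Suc k \<le> (\<Prod>i<2 * j. F i) * real N / 1"
      by (intro divide_left_mono mult_nonneg_nonneg prod_nonneg one_le_power) (simp_all add: F_def)
    also have "\<dots> \<le> \<epsilon> / 2 * real N / 1" using F[of j] j by (intro divide_right_mono mult_right_mono) linarith+
    also have "C \<le> \<epsilon> / 2 * real N"
    proof -
      have "2 * C / \<epsilon> < real N" using N0 that(1) by linarith
      then show ?thesis using \<epsilon> by (simp add: field_simps)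
    qed
    finally show ?thesis by (simp add: field_simps)
  qed
  then show "\<exists>N0. \<forall>N\<ge>N0. \<forall>x\<in>space \<mu>. cmod (weighted_sum N w (a k) x) \<le> \<epsilon> * real N" by blast
qed

lemma averages_vanish_cmult_shift:
  assumes "averages_vanish w f" "\<And>x. x \<in> space \<mu> \<Longrightarrow> g x = c * f (shift_power e x)"
  shows "averages_vanish w g"
  unfolding averages_vanish_def
proof (intro allI impI)
  fix \<epsilon> :: real assume \<epsilon>: "\<epsilon> > 0"
  then have "\<epsilon> / (cmod c + 1) > 0" by (simp add: add_nonneg_pos)
  from assms(1)[unfolded averages_vanish_def, rule_format, OF this] obtain N0 where
    N0: "\<And>N x. N \<ge> N0 \<Longrightarrow> x \<in> space \<mu> \<Longrightarrow> cmod (weighted_sum N w f x) \<le> \<epsilon> / (cmod c + 1) * real N" by blast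
  have "cmod (weighted_sum N w g x) \<le> \<epsilon> * real N" if N: "N \<ge> N0" and x: "x \<in> space \<mu>" for N x
  proof -
    have "weighted_sum N w g x = c * weighted_sum N w f (shift_power e x)"
      unfolding weighted_sum_def sum_distrib_left
      by (intro sum.cong refl) (simp add: assms(2) shift_space[OF x] shift_power_add add.commute)
    then have "cmod (weighted_sum N w g x) = cmod c * cmod (weighted_sum N w f (shift_power e x))" by (simp add: norm_mult)
    also have "\<dots> \<le> (cmod c + 1) * (\<epsilon> / (cmod c + 1) * real N)"
      using N0[OF N shift_space[OF x]] by (intro mult_mono) auto
    also have "\<dots> = \<epsilon> * real N" using add_nonneg_pos[OF norm_ge_zero[of c] zero_less_one] by simp
    finally show ?thesis .
  qed
  then show "\<exists>N0. \<forall>N\<ge>N0. \<forall>x\<in>space \<mu>. cmod (weighted_sum N w g x) \<le> \<epsilon> * real N" by blast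
qed

lemma averages_vanish_add:
  assumes "averages_vanish w f" "averages_vanish w g"
  shows "averages_vanish w (\<lambda>x. f x + g x)"
  unfolding averages_vanish_def
proof (intro allI impI)
  fix \<epsilon> :: real assume "\<epsilon> > 0"
  then have \<epsilon>: "\<epsilon> / 2 > 0" by simp
  from assms(1)[unfolded averages_vanish_def, rule_format, OF \<epsilon>] obtain N1 where
    N1: "\<And>N x. N \<ge> N1 \<Longrightarrow> x \<in> space \<mu> \<Longrightarrow> cmod (weighted_sum N w f x) \<le> \<epsilon> / 2 * real N" by blast
  from assms(2)[unfolded averages_vanish_def, rule_format, OF \<epsilon>] obtain N2 where
    N2: "\<And>N x. N \<ge> N2 \<Longrightarrow> x \<in> space \<mu> \<Longrightarrow> cmod (weighted_sum N w g x) \<le> \<epsilon> / 2 * real N" by blast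
  have "cmod (weighted_sum N w (\<lambda>x. f x + g x) x) \<le> \<epsilon> * real N" if "N \<ge> max N1 N2" "x \<in> space \<mu>" for N x
  proof -
    have "weighted_sum N w (\<lambda>x. f x + g x) x = weighted_sum N w f x + weighted_sum N w g x"
      unfolding weighted_sum_def by (simp add: sum.distrib distrib_left)
    then have "cmod (weighted_sum N w (\<lambda>x. f x + g x) x) \<le> \<epsilon> / 2 * real N + \<epsilon> / 2 * real N"
      using norm_triangle_ineq[of "weighted_sum N w f x" "weighted_sum N w g x"] N1[of N x] N2[of N x] that by simp
    then show ?thesis by (simp add: field_simps)
  qed
  then show "\<exists>N0. \<forall>N\<ge>N0. \<forall>x\<in>space \<mu>. cmod (weighted_sum N w (\<lambda>x. f x + g x) x) \<le> \<epsilon> * real N" by blast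
qed

lemma averages_vanish_sum:
  "finite I \<Longrightarrow> (\<And>i. i \<in> I \<Longrightarrow> averages_vanish w (f i)) \<Longrightarrow> averages_vanish w (\<lambda>x. \<Sum>i\<in>I. f i x)"
proof (induction I rule: finite_induct)
  case empty
  then show ?case by (simp add: averages_vanish_def weighted_sum_def)
next
  case (insert i I)
  then show ?case by (simp add: averages_vanish_add)
qed

text \<open>Twisting by \<open>cnj z\<close> makes the atom at \<open>z\<close> the limit of twisted
  averages. These vanish uniformly on approximants, and the remainder contributes at most its
  norm.\<close>

lemma even_case_no_atoms:
  assumes g: "g \<in> H_chi \<alpha> \<mu> \<nu> n" and spec: "is_spectral_measure \<mu> g \<rho>"
    and \<nu>: "sets \<nu> = sets (restrict_space borel dyadic)" and \<sigma>: "\<sigma> = 1" and \<beta>: "\<beta> \<noteq> 1" and z: "z \<in> circle"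
  shows "measure \<rho> {z} = 0"
proof -
  have gL: "g \<in> L2 \<mu>" using g by (simp add: H_chi_def)
  define w where "w = cnj z"
  have w: "norm w = 1" using z by (simp add: w_def)
  have "{y \<in> circle. y ^ 1 * w = 1} = {z}"
  proof -
    have zw: "z * w = 1" using z complex_norm_square[of z] by (simp add: w_def)
    moreover have "y = z" if "y * w = 1" for y
      using that zw by (metis mult.assoc mult.commute mult.right_neutral)
    ultimately show ?thesis unfolding power_one_right using z by blast
  qed
  then have lim: "(\<lambda>N. L2_inner \<mu> g (weighted_sum N w g) / of_nat N) \<longlonglongrightarrow> of_real (measure \<rho> {z})"
    using spectral_average[OF gL spec w, of 1] by (simp add: L2_inner_weighted_sum[OF gL gL])
  have "measure \<rho> {z} \<le> (2 * L2_norm \<mu> g) * \<epsilon>" if \<epsilon>: "\<epsilon> > 0" for \<epsilon>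
  proof -
    obtain K h where K: "K \<ge> 2" and h: "L2_norm \<mu> (\<lambda>x. g x - (\<Sum>j<2 ^ K. h j * cyl K j x)) \<le> \<epsilon>"
      using H_chi_approximation[OF g \<nu> \<epsilon>, of 2] by blast
    define f where "f x = (\<Sum>j<2 ^ K. h j * cyl K j x)" for x
    have fL: "f \<in> L2 \<mu>" unfolding f_def[abs_def] by (intro L2_sum L2_cmult cyl_L2)
    have "averages_vanish w (\<lambda>x. h j * cyl K j x)" if j: "j < 2 ^ K" for j
    proof -
      obtain c e where "\<And>x. x \<in> space \<mu> \<Longrightarrow> cyl K j x = c * a (K - 1) (shift_power e x)"
        using cyl_reduce_even[OF \<sigma> j K] by blast
      then show ?thesis
        by (intro averages_vanish_cmult_shift[OF averages_vanish_a[OF \<sigma> \<beta> w], of _ "h j * c" "K - 1" e]) simp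
    qed
    then have "averages_vanish w f" unfolding f_def[abs_def] by (intro averages_vanish_sum) auto
    from this[unfolded averages_vanish_def, rule_format, OF \<epsilon>] obtain N0 where
      N0: "\<And>N x. N \<ge> N0 \<Longrightarrow> x \<in> space \<mu> \<Longrightarrow> cmod (weighted_sum N w f x) \<le> \<epsilon> * real N" by blast
    have bd: "cmod (L2_inner \<mu> g (weighted_sum N w g) / of_nat N) \<le> (2 * L2_norm \<mu> g) * \<epsilon>" if N: "N \<ge> max N0 1" for N
    proof -
      have 1: "L2_norm \<mu> (weighted_sum N w f) \<le> \<epsilon> * real N"
        using N0[of N] N \<epsilon> by (intro L2_norm_bounded prob_space_axioms L2_measurable weighted_sum_L2 fL) auto
      have 2: "L2_norm \<mu> (weighted_sum N w (\<lambda>x. g x - f x)) \<le> real N * \<epsilon>"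
        using h weighted_sum_norm[OF L2_diff[OF gL fL] w, of N] unfolding f_def[symmetric]
        by (meson mult_left_mono of_nat_0_le_iff order_trans)
      have eq: "weighted_sum N w g = (\<lambda>x. weighted_sum N w f x + weighted_sum N w (\<lambda>x. g x - f x) x)"
        by (simp add: fun_eq_iff weighted_sum_def right_diff_distrib sum_subtractf)
      have "L2_norm \<mu> (weighted_sum N w g) \<le> \<epsilon> * real N + real N * \<epsilon>" unfolding eq
        by (rule order_trans[OF L2_norm_triangle[OF weighted_sum_L2[OF fL] weighted_sum_L2[OF L2_diff[OF gL fL]]] add_mono[OF 1 2]])
      then have "cmod (L2_inner \<mu> g (weighted_sum N w g)) \<le> L2_norm \<mu> g * (\<epsilon> * real N + real N * \<epsilon>)"
        using L2_Cauchy_Schwarz[OF gL weighted_sum_L2[OF gL]] by (meson L2_norm_nonneg mult_left_mono order_trans)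
      then have "cmod (L2_inner \<mu> g (weighted_sum N w g)) / real N \<le> L2_norm \<mu> g * (\<epsilon> * real N + real N * \<epsilon>) / real N"
        by (rule divide_right_mono) simp
      also have "\<dots> = (2 * L2_norm \<mu> g) * \<epsilon>" using N by (simp add: field_simps)
      finally show ?thesis by (simp add: norm_divide)
    qed
    have "cmod (of_real (measure \<rho> {z})) \<le> (2 * L2_norm \<mu> g) * \<epsilon>"
      using bd by (intro LIMSEQ_le_const2[OF tendsto_norm[OF lim]]) blast
    then show ?thesis by simp
  qed
  then show ?thesis by (intro eps_bound_zero) auto
qed

end


section \<open>Means along powers of two\<close>

text \<open>Distinct characters of the circle are orthonormal. With \<open>K\<close> summands the
  mean therefore has squared norm \<open>1 / K\<close>, which is the decay wanted for Lebesgue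
  measure.\<close>

lemma lebesgue_sum_norm:
  fixes e :: "nat \<Rightarrow> nat"
  assumes "inj e"
  shows "(\<integral>z. (cmod (\<Sum>i<K. z ^ e i))\<^sup>2 \<partial>circle_lebesgue) = real K"
proof -
  have sp: "space circle_lebesgue = circle"
    using sets_eq_imp_space_eq[OF circle_lebesgue_sets] by (simp add: circle_borel_def space_restrict_space)
  have integ: "integrable circle_lebesgue (\<lambda>z. z powi m)" for m
  proof (rule finite_measure.integrable_const_bound[OF prob_space.finite_measure[OF circle_lebesgue_prob_space], where B=1])
    show "AE z in circle_lebesgue. cmod (z powi m) \<le> 1"
      by (rule AE_I2) (simp add: sp norm_power_int)
    have "continuous_on circle (\<lambda>z. z powi m)" by (intro continuous_intros) auto
    then show "(\<lambda>z. z powi m) \<in> borel_measurable circle_lebesgue"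
      using borel_measurable_continuous_on_restrict circle_lebesgue_sets measurable_cong_sets unfolding circle_borel_def by blast
  qed
  have "complex_of_real (\<integral>z. (cmod (\<Sum>i<K. z ^ e i))\<^sup>2 \<partial>circle_lebesgue) =
      (\<integral>z. complex_of_real ((cmod (\<Sum>i<K. z ^ e i))\<^sup>2) \<partial>circle_lebesgue)"
    by (rule integral_complex_of_real[symmetric])
  also have "\<dots> = (\<integral>z. (\<Sum>i<K. \<Sum>j<K. z powi (int (e i) - int (e j))) \<partial>circle_lebesgue)"
  proof (rule Bochner_Integration.integral_cong[OF refl])
    fix z assume "z \<in> space circle_lebesgue"
    then have z: "cmod z = 1" "z \<noteq> 0" by (auto simp: sp)
    have "cnj z = inverse z"
      using z complex_norm_square[of z] by (intro inverse_unique[symmetric]) simp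
    then have t: "z ^ e i * cnj (z ^ e j) = z powi (int (e i) - int (e j))" for i j
      using z(2) by (simp add: power_int_diff power_inverse divide_inverse)
    have "complex_of_real ((cmod (\<Sum>i<K. z ^ e i))\<^sup>2) = (\<Sum>i<K. z ^ e i) * cnj (\<Sum>j<K. z ^ e j)"
      by (rule complex_norm_square)
    also have "\<dots> = (\<Sum>i<K. \<Sum>j<K. z ^ e i * cnj (z ^ e j))"
      unfolding cnj_sum by (rule sum_product)
    finally show "complex_of_real ((cmod (\<Sum>i<K. z ^ e i))\<^sup>2) = (\<Sum>i<K. \<Sum>j<K. z powi (int (e i) - int (e j)))"
      unfolding t .
  qed
  also have "\<dots> = (\<Sum>i<K. \<Sum>j<K. \<integral>z. z powi (int (e i) - int (e j)) \<partial>circle_lebesgue)"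
    by (subst Bochner_Integration.integral_sum, intro Bochner_Integration.integrable_sum integ)
      (subst Bochner_Integration.integral_sum, intro integ, rule refl)
  also have "\<dots> = (\<Sum>i<K. \<Sum>j<K. if i = j then 1 else 0)"
    unfolding circle_lebesgue_powi using assms by (intro sum.cong refl) (auto simp: inj_eq)
  also have "\<dots> = of_nat K" by simp
  finally have "complex_of_real (\<integral>z. (cmod (\<Sum>i<K. z ^ e i))\<^sup>2 \<partial>circle_lebesgue) = complex_of_real (real K)"
    by (simp only: of_real_of_nat_eq)
  then show ?thesis by (simp only: of_real_eq_iff)
qed

lemma sum_geometric_half_le: "(\<Sum>i<L. (1 / 2 :: real) ^ (L - i)) \<le> 1"
proof (induction L)
  case (Suc L)
  have "(\<Sum>i<Suc L. (1 / 2 :: real) ^ (Suc L - i)) = (\<Sum>i<L. 1 / 2 * (1 / 2) ^ (L - i)) + 1 / 2"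
    by (simp add: Suc_diff_le less_imp_le)
  also have "\<dots> = 1 / 2 * (\<Sum>i<L. (1 / 2) ^ (L - i)) + 1 / 2" by (simp only: sum_distrib_left)
  finally show ?case using Suc by simp
qed simp

text \<open>Iterating upwards bounds \<open>d k\<close> by \<open>B\<close> times arbitrarily high
  powers of 1/2. Applied to nonnegative \<open>d\<close>, it shows that a bounded solution of a
  contracting recursion vanishes.\<close>

lemma halving_tendsto_zero:
  fixes d :: "nat \<Rightarrow> real"
  assumes "\<And>k. d k \<le> d (Suc k) / 2" "\<And>k. d k \<le> B"
  shows "d k \<le> 0"
proof -
  have "d k \<le> d (k + l) * (1 / 2) ^ l" for l
  proof (induction l)
    case (Suc l)
    then have "d k \<le> d (k + l) * (1 / 2) ^ l" by simp
    also have "\<dots> \<le> d (Suc (k + l)) / 2 * (1 / 2) ^ l" by (intro mult_right_mono assms) simp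
    finally show ?case by simp
  qed simp
  moreover have "d (k + l) * (1 / 2) ^ l \<le> B * (1 / 2) ^ l" for l by (intro mult_right_mono assms) simp
  ultimately have "d k \<le> B * (1 / 2) ^ l" for l using order_trans by blast
  moreover have "(\<lambda>l. B * (1 / 2) ^ l) \<longlonglongrightarrow> 0" by (intro tendsto_mult_right_zero LIMSEQ_power_zero) simp
  ultimately show ?thesis by (intro LIMSEQ_le_const) auto
qed

lemma L2_norm_add_power2:
  assumes "f \<in> L2 M" "g \<in> L2 M"
  shows "(L2_norm M (\<lambda>x. f x + g x))\<^sup>2 \<le> (L2_norm M f)\<^sup>2 + 2 * cmod (L2_inner M f g) + (L2_norm M g)\<^sup>2"
proof -
  have "complex_of_real ((L2_norm M (\<lambda>x. f x + g x))\<^sup>2) =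
      L2_inner M f f + L2_inner M f g + L2_inner M g f + L2_inner M g g"
    using assms by (simp only: L2_inner_self[symmetric] L2_inner_add_left L2_inner_add_right L2_add add.assoc)
  then have "(L2_norm M (\<lambda>x. f x + g x))\<^sup>2 =
      Re (L2_inner M f f + L2_inner M f g + L2_inner M g f + L2_inner M g g)"
    by (metis Re_complex_of_real)
  moreover have "cmod (L2_inner M g f) = cmod (L2_inner M f g)"
    using L2_inner_cnj[of M f g] by (metis complex_mod_cnj)
  ultimately show ?thesis
    using complex_Re_le_cmod[of "L2_inner M f g"] complex_Re_le_cmod[of "L2_inner M g f"]
    unfolding L2_inner_self plus_complex.sel Re_complex_of_real by linarith
qed

context koopman
begin

definition dyadic_sum :: "complex \<Rightarrow> nat \<Rightarrow> ((int \<Rightarrow> 'a) \<Rightarrow> complex) \<Rightarrow> (int \<Rightarrow> 'a) \<Rightarrow> complex" where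
  "dyadic_sum c K f x = (\<Sum>i<K. f (shift_power (2 ^ i) x) - c * f x)"

text \<open>Strong convergence at \<open>f\<close> of the means of the powers 1, 2, 4, ... of the
  Koopman operator to the scalar \<open>c\<close>.\<close>

definition dyadic_mean :: "complex \<Rightarrow> ((int \<Rightarrow> 'a) \<Rightarrow> complex) \<Rightarrow> bool" where
  "dyadic_mean c f \<longleftrightarrow> (\<lambda>K. L2_norm M (dyadic_sum c K f) / real K) \<longlonglongrightarrow> 0"

lemma dyadic_sum_L2: "f \<in> L2 M \<Longrightarrow> dyadic_sum c K f \<in> L2 M"
  unfolding dyadic_sum_def[abs_def] by (intro L2_sum L2_diff L2_cmult shift_L2)

lemma dyadic_sum_norm:
  assumes "f \<in> L2 M" "norm c \<le> 1"
  shows "L2_norm M (dyadic_sum c K f) \<le> 2 * real K * L2_norm M f"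
proof -
  have "L2_norm M (dyadic_sum c K f) \<le> (\<Sum>i<K. L2_norm M (\<lambda>x. f (shift_power (2 ^ i) x) - c * f x))"
    unfolding dyadic_sum_def[abs_def] by (intro L2_norm_sum L2_diff L2_cmult shift_L2 assms)
  also have "\<dots> \<le> (\<Sum>i<K. L2_norm M f + L2_norm M f)"
  proof (rule sum_mono)
    fix i
    have "L2_norm M (\<lambda>x. f (shift_power (2 ^ i) x) - c * f x) \<le> L2_norm M (\<lambda>x. f (shift_power (2 ^ i) x)) + L2_norm M (\<lambda>x. c * f x)"
      by (intro L2_norm_diff_triangle shift_L2 L2_cmult assms)
    also have "\<dots> \<le> L2_norm M f + L2_norm M f"
      unfolding L2_norm_shift[OF assms(1)] L2_norm_cmult using assms(2) L2_norm_nonneg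
      by (intro add_left_mono mult_left_le_one_le) auto
    finally show "L2_norm M (\<lambda>x. f (shift_power (2 ^ i) x) - c * f x) \<le> L2_norm M f + L2_norm M f" .
  qed
  finally show ?thesis by simp
qed

lemma dyadic_sum_add: "dyadic_sum c K (\<lambda>x. f x + g x) = (\<lambda>x. dyadic_sum c K f x + dyadic_sum c K g x)"
  unfolding dyadic_sum_def sum.distrib[symmetric] by (intro ext sum.cong refl) (simp add: algebra_simps)

lemma dyadic_mean_add:
  assumes "dyadic_mean c f" "dyadic_mean c g" "f \<in> L2 M" "g \<in> L2 M"
  shows "dyadic_mean c (\<lambda>x. f x + g x)"
  unfolding dyadic_mean_def
proof (rule tendsto_sandwich[OF _ _ tendsto_const])
  show "(\<lambda>K. L2_norm M (dyadic_sum c K f) / real K + L2_norm M (dyadic_sum c K g) / real K) \<longlonglongrightarrow> 0"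
    using tendsto_add[OF assms(1,2)[unfolded dyadic_mean_def]] by simp
  show "\<forall>\<^sub>F K in sequentially. L2_norm M (dyadic_sum c K (\<lambda>x. f x + g x)) / real K \<le>
     L2_norm M (dyadic_sum c K f) / real K + L2_norm M (dyadic_sum c K g) / real K"
    unfolding dyadic_sum_add add_divide_distrib[symmetric]
    by (intro always_eventually allI divide_right_mono L2_norm_triangle dyadic_sum_L2 assms) simp
qed (simp add: L2_norm_nonneg)

lemma dyadic_mean_sum:
  "finite I \<Longrightarrow> (\<And>i. i \<in> I \<Longrightarrow> dyadic_mean c (f i)) \<Longrightarrow> (\<And>i. i \<in> I \<Longrightarrow> f i \<in> L2 M) \<Longrightarrow> dyadic_mean c (\<lambda>x. \<Sum>i\<in>I. f i x)"
proof (induction I rule: finite_induct)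
  case empty
  then show ?case by (simp add: dyadic_mean_def dyadic_sum_def[abs_def])
next
  case (insert i I)
  then show ?case by (simp add: dyadic_mean_add L2_sum)
qed

lemma dyadic_mean_cmult_shift:
  assumes "dyadic_mean c f" "f \<in> L2 M" "\<And>x. x \<in> space M \<Longrightarrow> g x = d * f (shift_power e x)"
  shows "dyadic_mean c g"
proof -
  have "L2_norm M (dyadic_sum c K g) = cmod d * L2_norm M (dyadic_sum c K f)" for K
  proof -
    have "L2_norm M (dyadic_sum c K g) = L2_norm M (\<lambda>x. d * dyadic_sum c K f (shift_power e x))"
    proof (rule L2_norm_cong)
      fix x assume x: "x \<in> space M"
      show "dyadic_sum c K g x = d * dyadic_sum c K f (shift_power e x)"
        unfolding dyadic_sum_def sum_distrib_left
        by (intro sum.cong refl) (simp add: assms(3) x shift_space shift_power_add add.commute right_diff_distrib)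
    qed
    then show ?thesis unfolding L2_norm_cmult L2_norm_shift[OF dyadic_sum_L2[OF assms(2)]] .
  qed
  then show ?thesis using tendsto_mult_right_zero[OF assms(1)[unfolded dyadic_mean_def], of "cmod d"]
    unfolding dyadic_mean_def by simp
qed

text \<open>The operators \<open>dyadic_sum c K\<close>, divided by \<open>K\<close>, have norm at
  most 2, so strong convergence extends from a dense set.\<close>

lemma dyadic_mean_limit:
  assumes "g \<in> L2 M" "norm c \<le> 1"
    and approx: "\<And>\<epsilon>. \<epsilon> > 0 \<Longrightarrow> \<exists>f\<in>L2 M. L2_norm M (\<lambda>x. g x - f x) \<le> \<epsilon> \<and> dyadic_mean c f"
  shows "dyadic_mean c g"
  unfolding dyadic_mean_def
proof (rule LIMSEQ_I)
  fix r :: real assume r: "r > 0"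
  then have "r / 4 > 0" by simp
  from approx[OF this] obtain f where f: "f \<in> L2 M" "L2_norm M (\<lambda>x. g x - f x) \<le> r / 4" "dyadic_mean c f" by blast
  obtain N0 where N0: "\<And>K. K \<ge> N0 \<Longrightarrow> norm (L2_norm M (dyadic_sum c K f) / real K - 0) < r / 2"
    using LIMSEQ_D[OF f(3)[unfolded dyadic_mean_def], of "r / 2"] r by auto
  have "norm (L2_norm M (dyadic_sum c K g) / real K - 0) < r" if K: "K \<ge> N0" for K
  proof (cases "K = 0")
    case False
    have gf: "(\<lambda>x. g x - f x) \<in> L2 M" by (intro L2_diff assms f)
    have "dyadic_sum c K g = (\<lambda>x. dyadic_sum c K (\<lambda>x. g x - f x) x + dyadic_sum c K f x)"
      unfolding dyadic_sum_add[symmetric] by simp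
    then have "L2_norm M (dyadic_sum c K g) \<le> L2_norm M (dyadic_sum c K (\<lambda>x. g x - f x)) + L2_norm M (dyadic_sum c K f)"
      using L2_norm_triangle[OF dyadic_sum_L2[OF gf] dyadic_sum_L2[OF f(1)]] by metis
    also have "L2_norm M (dyadic_sum c K (\<lambda>x. g x - f x)) \<le> 2 * real K * (r / 4)"
      using f(2) by (intro order_trans[OF dyadic_sum_norm[OF gf assms(2)]] mult_left_mono) auto
    finally have "L2_norm M (dyadic_sum c K g) / real K \<le> (2 * real K * (r / 4) + L2_norm M (dyadic_sum c K f)) / real K"
      by (simp add: divide_right_mono)
    also have "\<dots> = r / 2 + L2_norm M (dyadic_sum c K f) / real K" using False by (simp add: field_simps)
    also have "L2_norm M (dyadic_sum c K f) / real K < r / 2"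
      using N0[OF K] unfolding diff_zero real_norm_def by linarith
    finally have "L2_norm M (dyadic_sum c K g) / real K < r" by simp
    then show ?thesis by (simp add: L2_norm_nonneg)
  qed (use r in simp)
  then show "\<exists>N0. \<forall>K\<ge>N0. norm (L2_norm M (dyadic_sum c K g) / real K - 0) < r" by blast
qed

text \<open>The isometry turns the operator means into convergence to \<open>c\<close> in square
  mean for \<rho>, whereas orthogonality sends the same polynomials to 0 for Lebesgue
  measure.\<close>

lemma dyadic_mean_mutually_singular:
  assumes g: "g \<in> L2 M" "is_spectral_measure M g \<rho>" and c: "c \<noteq> 0" and mean: "dyadic_mean c g"
  shows "mutually_singular \<rho> circle_lebesgue"
proof (rule mutually_singular_circle_lebesgue[OF spectral_finite[OF g] spectral_sets[OF g] c])
  \<comment> \<open>Starting at \<open>Suc K\<close> keeps the denominator nonzero.\<close>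
  define A where "A K z = (\<Sum>i<Suc K. z ^ 2 ^ i) / of_nat (Suc K)" for K and z :: complex
  show "continuous_on circle (A K)" for K unfolding A_def[abs_def] by (intro continuous_intros) (simp del: of_nat_Suc)
  have "(\<integral>z. (cmod (A K z - c))\<^sup>2 \<partial>\<rho>) = (L2_norm M (dyadic_sum c (Suc K) g) / real (Suc K))\<^sup>2" for K
  proof -
    define q :: "(complex \<times> int) list" where "q = map (\<lambda>i. (1 / of_nat (Suc K), 2 ^ i)) [0..<Suc K] @ [(- c, 0)]"
    have "tpoly q z = (\<Sum>i<Suc K. z powi (2 ^ i) / of_nat (Suc K)) - c" for z
      unfolding q_def tpoly_def by (simp add: comp_def sum_list_distinct_conv_sum_set atLeast0LessThan del: upt_Suc sum.lessThan_Suc)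
    moreover have "z powi (2 ^ i) = z ^ 2 ^ i" for z :: complex and i
      using power_int_of_nat[of z "2 ^ i"] by simp
    ultimately have 1: "tpoly q z = A K z - c" for z unfolding A_def sum_divide_distrib by simp
    have "tpoly_op q g x = (\<Sum>i<Suc K. 1 / of_nat (Suc K) * g (shift_power (2 ^ i) x)) - c * g x" for x
      unfolding q_def tpoly_op_def by (simp add: comp_def sum_list_distinct_conv_sum_set atLeast0LessThan del: upt_Suc sum.lessThan_Suc)
    moreover have "(\<Sum>i<Suc K. 1 / of_nat (Suc K) * g (shift_power (2 ^ i) x)) - c * g x = 1 / of_nat (Suc K) * dyadic_sum c (Suc K) g x" for x
      unfolding dyadic_sum_def sum_subtractf sum_distrib_left[symmetric] right_diff_distrib
      by (simp del: sum.lessThan_Suc of_nat_Suc)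
    ultimately have 2: "tpoly_op q g = (\<lambda>x. 1 / of_nat (Suc K) * dyadic_sum c (Suc K) g x)" by (intro ext) simp
    show ?thesis
      using spectral_tpoly_norm[OF g, of q] unfolding 1 2 L2_norm_cmult by (simp add: norm_divide del: of_nat_Suc)
  qed
  moreover have "(\<lambda>K. (L2_norm M (dyadic_sum c (Suc K) g) / real (Suc K))\<^sup>2) \<longlonglongrightarrow> 0\<^sup>2"
    by (intro tendsto_power LIMSEQ_Suc mean[unfolded dyadic_mean_def])
  ultimately show "(\<lambda>K. \<integral>z. (cmod (A K z - c))\<^sup>2 \<partial>\<rho>) \<longlonglongrightarrow> 0" by simp
  have "(\<integral>z. (cmod (A K z))\<^sup>2 \<partial>circle_lebesgue) = 1 / real (Suc K)" for K
  proof -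
    have "(\<integral>z. (cmod (A K z))\<^sup>2 \<partial>circle_lebesgue) = (\<integral>z. (cmod (\<Sum>i<Suc K. z ^ 2 ^ i))\<^sup>2 / (real (Suc K))\<^sup>2 \<partial>circle_lebesgue)"
      unfolding A_def norm_divide power_divide norm_of_nat ..
    also have "\<dots> = real (Suc K) / (real (Suc K))\<^sup>2"
      using lebesgue_sum_norm[of "\<lambda>i. 2 ^ i" "Suc K"] by (simp add: inj_on_def del: sum.lessThan_Suc of_nat_Suc)
    finally show ?thesis by (simp add: power2_eq_square del: of_nat_Suc)
  qed
  then show "(\<lambda>K. \<integral>z. (cmod (A K z))\<^sup>2 \<partial>circle_lebesgue) \<longlonglongrightarrow> 0"
    using LIMSEQ_Suc[OF lim_1_over_n[where 'a=real]] by simp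
qed

end


section \<open>Singularity\<close>

context subshift_character
begin

text \<open>The factor is the inverse of the squared norm of \<open>a k\<close>, so the value at
  time 0 is 1 at every level.\<close>

definition acorr :: "nat \<Rightarrow> int \<Rightarrow> complex" where
  "acorr k m = 2 ^ Suc k * corr (a k) (a k) m"

definition limit_mean :: complex where
  "limit_mean = \<beta> / (2 - cnj \<beta>)"

lemma two_minus_\<beta>: "2 - cnj \<beta> \<noteq> 0" "2 - \<beta> \<noteq> 0" "cmod (2 - cnj \<beta>) \<ge> 1"
proof -
  show 1: "cmod (2 - cnj \<beta>) \<ge> 1"
    using norm_triangle_ineq2[of 2 "cnj \<beta>"] norm_\<beta> by simp
  then show "2 - cnj \<beta> \<noteq> 0" by auto
  show "2 - \<beta> \<noteq> 0" using norm_\<beta> by auto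
qed

lemma norm_limit_mean: "cmod limit_mean \<le> 1" "limit_mean \<noteq> 0"
proof -
  show "cmod limit_mean \<le> 1"
    unfolding limit_mean_def norm_divide norm_\<beta> using two_minus_\<beta>(3) by (simp add: divide_le_eq)
  show "limit_mean \<noteq> 0" using norm_\<beta> two_minus_\<beta>(1) by (auto simp: limit_mean_def)
qed

text \<open>The two fixed-point equations mirror the recursion for correlations at a power of two
  and at a difference of two powers of two.\<close>

lemma limit_mean_fixed: "(\<beta> + cnj \<beta> * limit_mean) / 2 = limit_mean"
  "(\<beta> * (limit_mean * cnj limit_mean) + cnj \<beta> * limit_mean) / 2 = limit_mean * cnj limit_mean"
proof -
  have 1: "limit_mean * (2 - cnj \<beta>) = \<beta>" using two_minus_\<beta>(1) by (simp add: limit_mean_def)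
  then show "(\<beta> + cnj \<beta> * limit_mean) / 2 = limit_mean" by (simp add: algebra_simps)
  have "cnj limit_mean * (2 - \<beta>) = cnj \<beta>" using arg_cong[OF 1, of cnj] by simp
  then have "cnj \<beta> * limit_mean = limit_mean * cnj limit_mean * (2 - \<beta>)" by (metis mult.assoc mult.commute)
  then show "(\<beta> * (limit_mean * cnj limit_mean) + cnj \<beta> * limit_mean) / 2 = limit_mean * cnj limit_mean"
    by (simp add: algebra_simps)
qed

lemma acorr_zero: "\<not> 2 ^ Suc k dvd m \<Longrightarrow> acorr k m = 0"
  unfolding acorr_def by (simp add: corr_aa_zero)

lemma acorr_0 [simp]: "acorr k 0 = 1"
  unfolding acorr_def corr_self_0 a_norm by simp

lemma acorr_minus: "acorr k (- m) = cnj (acorr k m)"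
  unfolding acorr_def corr_minus[OF a_L2 a_L2] by simp

lemma acorr_bound: "cmod (acorr k m) \<le> 1"
proof -
  have "cmod (corr (a k) (a k) m) \<le> (L2_norm \<mu> (a k))\<^sup>2"
    using corr_bound[OF a_L2 a_L2, of k k m] by (simp add: power2_eq_square)
  then show ?thesis unfolding a_norm acorr_def norm_mult by (simp add: norm_power field_simps)
qed

lemma acorr_rec:
  assumes \<sigma>: "\<sigma> = 1"
  shows "acorr k m = acorr (Suc k) m + (\<beta> * acorr (Suc k) (m - 2 ^ Suc k) + cnj \<beta> * acorr (Suc k) (m + 2 ^ Suc k)) / 2"
proof -
  let ?a = "a (Suc k)" and ?S = "shift_power (- (2 ^ Suc k)) :: (int \<Rightarrow> letter) \<Rightarrow> _"
  have SL: "(\<lambda>x. \<beta> * ?a (?S x)) \<in> L2 \<mu>" by (intro L2_cmult shift_L2 a_L2)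
  have "corr (a k) (a k) m = corr (\<lambda>x. ?a x + \<beta> * ?a (?S x)) (\<lambda>x. ?a x + \<beta> * ?a (?S x)) m"
    by (rule corr_cong) (rule even_a_rec[OF \<sigma>], assumption)+
  also have "\<dots> = corr ?a ?a m + \<beta> * corr ?a ?a (m - 2 ^ Suc k) + (cnj \<beta> * corr ?a ?a (m + 2 ^ Suc k) + (cnj \<beta> * \<beta>) * corr ?a ?a m)"
    unfolding corr_add_left[OF a_L2 SL L2_add[OF a_L2 SL]] corr_add_right[OF a_L2 a_L2 SL] corr_add_right[OF SL a_L2 SL]
      corr_cmult_left corr_cmult_right corr_shift_right corr_shift_left[OF a_L2 a_L2] corr_shift_left[OF a_L2 shift_L2[OF a_L2]]
    by (simp add: mult.assoc del: power_Suc)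
  also have "cnj \<beta> * \<beta> = 1" using norm_\<beta> complex_norm_square[of \<beta>] by (simp add: mult.commute)
  finally show ?thesis unfolding acorr_def by (simp add: field_simps)
qed

text \<open>Both neighbours of such a time miss the support period of level \<open>k + 1\<close>, so
  only the direct term survives.\<close>

lemma acorr_even:
  assumes \<sigma>: "\<sigma> = 1" and "2 ^ Suc (Suc k) dvd m"
  shows "acorr k m = acorr (Suc k) m"
proof -
  have nd: "\<not> (2::int) ^ Suc (Suc k) dvd 2 ^ Suc k" by (auto dest!: zdvd_imp_le)
  have "acorr (Suc k) (m - 2 ^ Suc k) = 0" "acorr (Suc k) (m + 2 ^ Suc k) = 0"
    by (intro acorr_zero; use nd assms(2) in \<open>simp only: dvd_diff_right_iff dvd_add_right_iff not_False_eq_True\<close>)+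
  then show ?thesis using acorr_rec[OF \<sigma>, of k m] by simp
qed

text \<open>Here it is the direct term that misses the support period, leaving exactly the two
  neighbours.\<close>

lemma acorr_odd:
  assumes \<sigma>: "\<sigma> = 1"
  shows "acorr k (2 ^ Suc k * (2 * s + 1)) =
    (\<beta> * acorr (Suc k) (2 ^ Suc (Suc k) * s) + cnj \<beta> * acorr (Suc k) (2 ^ Suc (Suc k) * (s + 1))) / 2"
proof -
  have "\<not> (2::int) ^ Suc (Suc k) dvd 2 ^ Suc k * (2 * s + 1)" by (rule not_dvd_odd_multiple) simp
  then have "acorr (Suc k) (2 ^ Suc k * (2 * s + 1)) = 0" by (rule acorr_zero)
  moreover have "2 ^ Suc k * (2 * s + 1) - 2 ^ Suc k = 2 ^ Suc (Suc k) * s"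
    "2 ^ Suc k * (2 * s + 1) + 2 ^ Suc k = 2 ^ Suc (Suc k) * (s + 1)" by (simp_all add: algebra_simps)
  ultimately show ?thesis using acorr_rec[OF \<sigma>, of k "2 ^ Suc k * (2 * s + 1)"] by (simp only:) simp
qed

lemma acorr_rescale:
  assumes \<sigma>: "\<sigma> = 1" shows "acorr k (2 ^ Suc (k + i) * t) = acorr (k + i) (2 ^ Suc (k + i) * t)"
proof (induction i arbitrary: k)
  case (Suc i)
  have "(2::int) ^ Suc (Suc k) dvd 2 ^ Suc (k + Suc i)" by (intro le_imp_power_dvd) simp
  then have "acorr k (2 ^ Suc (k + Suc i) * t) = acorr (Suc k) (2 ^ Suc (k + Suc i) * t)"
    by (intro acorr_even[OF \<sigma>]) (rule dvd_mult2)
  also have "\<dots> = acorr (k + Suc i) (2 ^ Suc (k + Suc i) * t)" using Suc[of "Suc k"] by simp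
  finally show ?case .
qed simp

text \<open>The distance to the fixed point halves when passing down a level and is bounded over all
  levels, so it is 0 throughout: the value is exact, not asymptotic.\<close>

lemma acorr_first:
  assumes \<sigma>: "\<sigma> = 1" shows "acorr k (2 ^ Suc k) = limit_mean"
proof -
  define d where "d k = cmod (acorr k (2 ^ Suc k) - limit_mean)" for k
  have "d k \<le> d (Suc k) / 2" for k
  proof -
    have "acorr k (2 ^ Suc k) = (\<beta> + cnj \<beta> * acorr (Suc k) (2 ^ Suc (Suc k))) / 2"
      using acorr_odd[OF \<sigma>, of k 0] by simp
    then have "acorr k (2 ^ Suc k) - limit_mean = (\<beta> + cnj \<beta> * acorr (Suc k) (2 ^ Suc (Suc k))) / 2 - (\<beta> + cnj \<beta> * limit_mean) / 2"
      by (simp only: limit_mean_fixed(1))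
    also have "\<dots> = cnj \<beta> * (acorr (Suc k) (2 ^ Suc (Suc k)) - limit_mean) / 2"
      unfolding diff_divide_distrib[symmetric] by (simp add: algebra_simps)
    finally have "cmod (acorr k (2 ^ Suc k) - limit_mean) = cmod (cnj \<beta> * (acorr (Suc k) (2 ^ Suc (Suc k)) - limit_mean) / 2)"
      by (rule arg_cong)
    also have "\<dots> = d (Suc k) / 2" unfolding norm_divide norm_mult by (simp add: norm_\<beta> d_def)
    finally show ?thesis unfolding d_def by simp
  qed
  moreover have "d k \<le> 2" for k
    unfolding d_def using norm_triangle_ineq4[of "acorr k (2 ^ Suc k)" limit_mean] acorr_bound[of k "2 ^ Suc k"] norm_limit_mean(1)
    by linarith
  ultimately have "d k \<le> 0" by (rule halving_tendsto_zero)
  then show ?thesis by (simp add: d_def)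
qed

lemma acorr_power:
  assumes \<sigma>: "\<sigma> = 1" shows "acorr k (2 ^ (Suc k + i)) = limit_mean"
  using acorr_rescale[OF \<sigma>, of k i 1] acorr_first[OF \<sigma>, of "k + i"] by simp

text \<open>Such a time is a difference of two powers of two. One neighbour in the recursion is a
  power of two, whose correlation is known exactly, and the other has the same form with smaller
  \<open>l\<close>, so the error halves at each step.\<close>

lemma acorr_difference:
  assumes \<sigma>: "\<sigma> = 1"
  shows "cmod (acorr k (2 ^ Suc k * (2 ^ l - 1)) - limit_mean * cnj limit_mean) \<le> 2 * (1 / 2) ^ l"
proof (induction l arbitrary: k)
  case 0
  have "cmod (limit_mean * cnj limit_mean) \<le> 1" using norm_limit_mean(1) by (simp add: norm_mult mult_le_one)
  then show ?case using norm_triangle_ineq4[of 1 "limit_mean * cnj limit_mean"] by simp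
next
  case (Suc l)
  let ?u = "acorr (Suc k) (2 ^ Suc (Suc k) * (2 ^ l - 1))" and ?cc = "limit_mean * cnj limit_mean"
  have e: "(2::int) ^ Suc l - 1 = 2 * (2 ^ l - 1) + 1" "(2::int) ^ l - 1 + 1 = 2 ^ l"
    "(2::int) ^ Suc (Suc k) * 2 ^ l = 2 ^ (Suc (Suc k) + l)" by (simp_all add: power_add)
  have "acorr k (2 ^ Suc k * (2 ^ Suc l - 1)) = (\<beta> * ?u + cnj \<beta> * limit_mean) / 2"
    unfolding e(1) acorr_odd[OF \<sigma>] e(2,3) acorr_power[OF \<sigma>] ..
  then have "acorr k (2 ^ Suc k * (2 ^ Suc l - 1)) - ?cc = (\<beta> * ?u + cnj \<beta> * limit_mean) / 2 - (\<beta> * ?cc + cnj \<beta> * limit_mean) / 2"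
    by (simp only: limit_mean_fixed(2))
  also have "\<dots> = \<beta> * (?u - ?cc) / 2" unfolding diff_divide_distrib[symmetric] by (simp add: algebra_simps)
  finally have "cmod (acorr k (2 ^ Suc k * (2 ^ Suc l - 1)) - ?cc) = cmod (\<beta> * (?u - ?cc) / 2)"
    by (rule arg_cong)
  also have "\<dots> = cmod (?u - ?cc) / 2" unfolding norm_divide norm_mult norm_\<beta> by simp
  also have "\<dots> \<le> 2 * (1 / 2) ^ Suc l" using Suc[of "Suc k"] by simp
  finally show ?case .
qed

text \<open>The exponents start at \<open>Suc k\<close>, since \<open>a k\<close> is orthogonal to
  its translates by smaller powers of two.\<close>

definition centred :: "nat \<Rightarrow> nat \<Rightarrow> (int \<Rightarrow> letter) \<Rightarrow> complex" where
  "centred k i x = a k (shift_power (2 ^ (Suc k + i)) x) - limit_mean * a k x"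

lemma centred_L2: "centred k i \<in> L2 \<mu>"
  unfolding centred_def[abs_def] by (intro L2_diff shift_L2 L2_cmult a_L2)

text \<open>Of the four terms, those carrying the factor \<open>cnj limit_mean\<close> cancel
  because correlations at powers of two are exact. What remains compares the correlation at the
  difference of the two times with the squared modulus of \<open>limit_mean\<close>.\<close>

lemma centred_inner:
  assumes \<sigma>: "\<sigma> = 1"
  shows "cmod (L2_inner \<mu> (centred k i) (centred k (i + l))) \<le> 2 * (1 / 2) ^ l"
proof -
  let ?p = "2 ^ (Suc k + i) :: int" and ?q = "2 ^ (Suc k + (i + l)) :: int"
  note L2s = a_L2 shift_L2[OF a_L2] L2_cmult[OF a_L2] L2_diff[OF shift_L2[OF a_L2] L2_cmult[OF a_L2]]
  have inner: "L2_inner \<mu> (centred k i) (centred k (i + l)) = corr (a k) (a k) (?q - ?p) - limit_mean * corr (a k) (a k) (- ?p)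
     - cnj limit_mean * (corr (a k) (a k) ?q - limit_mean * corr (a k) (a k) 0)"
    unfolding centred_def[abs_def] L2_inner_diff_left[OF L2s(2,3,4)] L2_inner_diff_right[OF L2s(2,2,3)] L2_inner_diff_right[OF L2s(3,2,3)] L2_inner_diff_right[OF L2s(1,2,3)]
      L2_inner_cmult_left L2_inner_cmult_right corr_shift[OF a_L2 a_L2]
    using corr_shift[OF a_L2[of k] a_L2[of k], of ?p 0] by (simp add: corr_def right_diff_distrib del: power_Suc)
  have "2 ^ Suc k * L2_inner \<mu> (centred k i) (centred k (i + l)) = acorr k (?q - ?p) - limit_mean * acorr k (- ?p)
     - cnj limit_mean * (acorr k ?q - limit_mean * acorr k 0)"
    unfolding inner acorr_def by (simp add: algebra_simps del: power_Suc)
  also have "\<dots> = acorr k (?q - ?p) - limit_mean * cnj limit_mean"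
    unfolding acorr_minus acorr_power[OF \<sigma>] acorr_0 by (simp add: algebra_simps)
  also have "?q - ?p = 2 ^ Suc (k + i) * (2 ^ l - 1)" by (simp add: power_add algebra_simps)
  also have "acorr k (2 ^ Suc (k + i) * (2 ^ l - 1)) = acorr (k + i) (2 ^ Suc (k + i) * (2 ^ l - 1))" by (rule acorr_rescale[OF \<sigma>])
  finally have "cmod (2 ^ Suc k * L2_inner \<mu> (centred k i) (centred k (i + l))) \<le> 2 * (1 / 2) ^ l"
    using acorr_difference[OF \<sigma>, of "k + i" l] by simp
  moreover have "cmod (L2_inner \<mu> (centred k i) (centred k (i + l))) \<le> cmod (2 ^ Suc k * L2_inner \<mu> (centred k i) (centred k (i + l)))"
  proof -
    have "1 * cmod (L2_inner \<mu> (centred k i) (centred k (i + l))) \<le> 2 ^ Suc k * cmod (L2_inner \<mu> (centred k i) (centred k (i + l)))"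
      by (intro mult_right_mono one_le_power) auto
    then show ?thesis by (simp add: norm_mult norm_power)
  qed
  ultimately show ?thesis by linarith
qed

text \<open>The inner products decay geometrically in the gap, so a new summand has inner product at
  most 2 with the earlier sum. The squared norm grows by at most \<open>2 * 2 + 2 = 6\<close> per
  term.\<close>

lemma centred_sum_norm:
  assumes \<sigma>: "\<sigma> = 1"
  shows "(L2_norm \<mu> (\<lambda>x. \<Sum>i<L. centred k i x))\<^sup>2 \<le> 6 * real L"
proof (induction L)
  case (Suc L)
  have SL: "(\<lambda>x. \<Sum>i<N. centred k i x) \<in> L2 \<mu>" for N by (intro L2_sum centred_L2)
  have lin: "L2_inner \<mu> (\<lambda>x. \<Sum>i<N. centred k i x) f = (\<Sum>i<N. L2_inner \<mu> (centred k i) f)" if "f \<in> L2 \<mu>" for N f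
    using that by (induction N) (simp_all add: L2_inner_add_left SL centred_L2)
  have "cmod (L2_inner \<mu> (\<lambda>x. \<Sum>i<L. centred k i x) (centred k L)) \<le> (\<Sum>i<L. 2 * (1 / 2) ^ (L - i))"
    unfolding lin[OF centred_L2]
  proof (rule sum_norm_le)
    fix i assume "i \<in> {..<L}"
    then show "cmod (L2_inner \<mu> (centred k i) (centred k L)) \<le> 2 * (1 / 2) ^ (L - i)"
      using centred_inner[OF \<sigma>, of k i "L - i"] by simp
  qed
  also have "\<dots> \<le> 2" unfolding sum_distrib_left[symmetric] using sum_geometric_half_le[of L] by simp
  finally have 1: "cmod (L2_inner \<mu> (\<lambda>x. \<Sum>i<L. centred k i x) (centred k L)) \<le> 2" .
  have 2: "(L2_norm \<mu> (centred k L))\<^sup>2 \<le> 2"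
  proof -
    have "cmod (of_real ((L2_norm \<mu> (centred k L))\<^sup>2)) \<le> 2"
      using centred_inner[OF \<sigma>, of k L 0] unfolding L2_inner_self[symmetric] by simp
    then show ?thesis unfolding norm_of_real by linarith
  qed
  have "(L2_norm \<mu> (\<lambda>x. (\<Sum>i<L. centred k i x) + centred k L x))\<^sup>2 \<le> 6 * real L + 2 * 2 + 2"
    using L2_norm_add_power2[OF SL centred_L2, of L k L] Suc 1 2 by linarith
  then show ?case by simp
qed simp

text \<open>The first \<open>Suc k\<close> summands are bounded trivially; the centred ones
  contribute only the square root of their number. Both are negligible against
  \<open>K\<close>.\<close>

lemma dyadic_mean_a:
  assumes \<sigma>: "\<sigma> = 1"
  shows "dyadic_mean limit_mean (a k)"
  unfolding dyadic_mean_def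
proof (rule tendsto_sandwich[OF _ _ tendsto_const])
  have a1: "L2_norm \<mu> (a k) \<le> 1"
    by (rule L2_norm_bounded[OF prob_space_axioms L2_measurable[OF a_L2] a_bound]) auto
  have bound: "L2_norm \<mu> (dyadic_sum limit_mean K (a k)) / real K \<le> 2 * real (Suc k) * (1 / real K) + sqrt (6 * (1 / real K))"
    if K: "K \<ge> Suc k" for K
  proof -
    define L where "L = K - Suc k"
    have KL: "K = Suc k + L" using K by (simp add: L_def)
    have "dyadic_sum limit_mean K (a k) x = dyadic_sum limit_mean (Suc k) (a k) x + (\<Sum>i<L. centred k i x)" for x
      unfolding dyadic_sum_def centred_def KL lessThan_atLeast0 sum.atLeastLessThan_shift_0[of _ "Suc k" "Suc k + L"]
        sum.atLeastLessThan_concat[of 0 "Suc k" "Suc k + L", symmetric, OF le0 le_add1]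
      by (simp add: atLeast0LessThan del: power_Suc sum.lessThan_Suc)
    then have eq: "dyadic_sum limit_mean K (a k) = (\<lambda>x. dyadic_sum limit_mean (Suc k) (a k) x + (\<Sum>i<L. centred k i x))" by blast
    have "L2_norm \<mu> (\<lambda>x. \<Sum>i<L. centred k i x) \<le> sqrt (6 * real L)"
      using centred_sum_norm[OF \<sigma>] by (rule real_le_rsqrt)
    also have "\<dots> \<le> sqrt (6 * real K)" by (simp add: KL)
    finally have 1: "L2_norm \<mu> (\<lambda>x. \<Sum>i<L. centred k i x) \<le> sqrt (6 * real K)" .
    have "2 * real (Suc k) * L2_norm \<mu> (a k) \<le> 2 * real (Suc k) * 1" by (intro mult_left_mono a1) simp
    then have 2: "L2_norm \<mu> (dyadic_sum limit_mean (Suc k) (a k)) \<le> 2 * real (Suc k)"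
      using dyadic_sum_norm[OF a_L2 norm_limit_mean(1), of "Suc k" k] by linarith
    have "L2_norm \<mu> (dyadic_sum limit_mean K (a k)) \<le> 2 * real (Suc k) + sqrt (6 * real K)"
      unfolding eq by (rule order_trans[OF L2_norm_triangle[OF dyadic_sum_L2[OF a_L2] L2_sum[OF centred_L2]] add_mono[OF 2 1]])
    then have "L2_norm \<mu> (dyadic_sum limit_mean K (a k)) / real K \<le> (2 * real (Suc k) + sqrt (6 * real K)) / real K"
      by (rule divide_right_mono) simp
    also have "\<dots> = 2 * real (Suc k) * (1 / real K) + sqrt (6 * real K) / real K" by (simp add: add_divide_distrib)
    also have "sqrt (6 * real K) / real K = sqrt (6 * (1 / real K))"
    proof -
      have "real K > 0" using K by simp
      then have "real K = sqrt (real K * real K)" by simp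
      then have "sqrt (6 * real K) / real K = sqrt ((6 * real K) / (real K * real K))" by (metis real_sqrt_divide)
      then show ?thesis using \<open>real K > 0\<close> by simp
    qed
    finally show ?thesis .
  qed
  then show "\<forall>\<^sub>F K in sequentially. L2_norm \<mu> (dyadic_sum limit_mean K (a k)) / real K \<le> 2 * real (Suc k) * (1 / real K) + sqrt (6 * (1 / real K))"
    unfolding eventually_sequentially by blast
  have "(\<lambda>K. 2 * real (Suc k) * (1 / real K) + sqrt (6 * (1 / real K))) \<longlonglongrightarrow> 2 * real (Suc k) * 0 + sqrt (6 * 0)"
    by (intro tendsto_intros lim_1_over_n)
  then show "(\<lambda>K. 2 * real (Suc k) * (1 / real K) + sqrt (6 * (1 / real K))) \<longlonglongrightarrow> 0" by simp
qed (simp add: L2_norm_nonneg)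

lemma even_case_singular:
  assumes g: "g \<in> H_chi \<alpha> \<mu> \<nu> n" and spec: "is_spectral_measure \<mu> g \<rho>"
    and \<nu>: "sets \<nu> = sets (restrict_space borel dyadic)" and \<sigma>: "\<sigma> = 1"
  shows "mutually_singular \<rho> circle_lebesgue"
proof (rule dyadic_mean_mutually_singular[OF _ spec norm_limit_mean(2)])
  show gL: "g \<in> L2 \<mu>" using g by (simp add: H_chi_def)
  show "dyadic_mean limit_mean g"
  proof (rule dyadic_mean_limit[OF gL norm_limit_mean(1)])
    fix \<epsilon> :: real assume "\<epsilon> > 0"
    then obtain K h where K: "K \<ge> 2" and h: "L2_norm \<mu> (\<lambda>x. g x - (\<Sum>j<2 ^ K. h j * cyl K j x)) \<le> \<epsilon>"
      using H_chi_approximation[OF g \<nu>, of \<epsilon> 2] by blast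
    define f where "f x = (\<Sum>j<2 ^ K. h j * cyl K j x)" for x
    have fL: "f \<in> L2 \<mu>" unfolding f_def[abs_def] by (intro L2_sum L2_cmult cyl_L2)
    have "dyadic_mean limit_mean (\<lambda>x. h j * cyl K j x)" if j: "j < 2 ^ K" for j
    proof -
      obtain d e where "\<And>x. x \<in> space \<mu> \<Longrightarrow> cyl K j x = d * a (K - 1) (shift_power e x)"
        using cyl_reduce_even[OF \<sigma> j K] by blast
      then show ?thesis
        by (intro dyadic_mean_cmult_shift[OF dyadic_mean_a[OF \<sigma>] a_L2, of _ "h j * d" "K - 1" e]) simp
    qed
    then have "dyadic_mean limit_mean f" unfolding f_def[abs_def] by (intro dyadic_mean_sum L2_cmult cyl_L2) auto
    then show "\<exists>f\<in>L2 \<mu>. L2_norm \<mu> (\<lambda>x. g x - f x) \<le> \<epsilon> \<and> dyadic_mean limit_mean f"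
      using fL h unfolding f_def[symmetric] by blast
  qed
qed

end

lemma cis_power_int_neq_1:
  assumes "\<phi> \<notin> \<rat>" "n \<noteq> 0"
  shows "cis (2 * pi * \<phi>) powi n \<noteq> 1"
proof
  assume "cis (2 * pi * \<phi>) powi n = 1"
  then have "cis (of_int n * (2 * pi * \<phi>)) = 1" by (simp add: Complex.cis_power_int)
  then have "cos (of_int n * (2 * pi * \<phi>)) = 1" by (metis cis.sel(1) one_complex.sel(1))
  then obtain m :: int where "of_int n * (2 * pi * \<phi>) = of_int m * 2 * pi" unfolding cos_one_2pi_int by blast
  then have "of_int n * \<phi> = of_int m" by simp
  then have "\<phi> = of_int m / of_int n" using assms(2) by (simp add: field_simps)
  then show False using assms(1) by (metis Rats_divide Rats_of_int)
qed

text \<open>The measure \<rho> is equivalent to the spectral measure of some \<open>g\<close>, so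
  each property is established for that measure and transferred through null sets.\<close>

theorem theorem4p18:
  fixes \<alpha> :: complex and \<phi> :: real
    and \<mu> :: "(int \<Rightarrow> letter) measure" and \<nu> :: "(nat \<Rightarrow> nat) measure"
    and n :: int and \<rho> :: "complex measure"
  assumes "\<alpha> = cis (2 * pi * \<phi>)" and "\<phi> \<notin> \<rat>"
    and "invariant_probability (X_rho \<alpha>) \<mu>"
    and "haar_dyadic \<nu>"
    and "is_maximal_spectral_type \<mu> (H_chi \<alpha> \<mu> \<nu> n) \<rho>"
  shows "(n = 0 \<longrightarrow> pure_point \<rho>) \<and>
         (odd n \<longrightarrow> equivalent_measures \<rho> circle_lebesgue) \<and>
         (even n \<and> n \<noteq> 0 \<longrightarrow> purely_singular_continuous \<rho>)"
proof -
  interpret subshift_character \<alpha> \<mu> n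
    using assms(1,3) by unfold_locales auto
  have \<nu>: "sets \<nu> = sets (restrict_space borel dyadic)" and \<nu>_fin: "finite_measure \<nu>"
    using assms(4) by (auto simp: haar_dyadic_def prob_space.finite_measure)
  obtain g \<rho>g where g: "g \<in> H_chi \<alpha> \<mu> \<nu> n" "is_spectral_measure \<mu> g \<rho>g" and eqv: "equivalent_measures \<rho>g \<rho>"
    using assms(5) unfolding is_maximal_spectral_type_def by blast
  have max: "absolutely_continuous \<rho> \<rho>f" if "f \<in> H_chi \<alpha> \<mu> \<nu> n" "is_spectral_measure \<mu> f \<rho>f" for f \<rho>f
    using assms(5) that unfolding is_maximal_spectral_type_def by blast
  have sets: "sets \<rho>g = sets \<rho>" and null: "null_sets \<rho>g \<subseteq> null_sets \<rho>" "null_sets \<rho> \<subseteq> null_sets \<rho>g"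
    using eqv by (auto simp: equivalent_measures_def absolutely_continuous_def)
  have \<rho>_sets: "sets \<rho> = sets circle_borel" using assms(5) by (simp add: is_maximal_spectral_type_def)
  have space: "space \<rho>g = space \<rho>" using sets by (rule sets_eq_imp_space_eq)
  have zero: "emeasure \<rho> A = 0" if "A \<in> sets \<rho>g" "emeasure \<rho>g A = 0" for A
    using null(1) null_setsI[OF that(2,1)] by (meson null_setsD1 subsetD)
  have gL: "g \<in> L2 \<mu>" using g by (simp add: H_chi_def)
  have "pure_point \<rho>" if n: "n = 0"
  proof -
    obtain C where C: "countable C" "C \<in> sets \<rho>g" "emeasure \<rho>g (space \<rho>g - C) = 0"
      using pure_point_case[OF g \<nu> n] unfolding pure_point_def by blast
    then have "emeasure \<rho> (space \<rho> - C) = 0" using zero[OF sets.compl_sets[OF C(2)]] space by simp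
    then show ?thesis using C(1,2) sets unfolding pure_point_def by blast
  qed
  moreover have "equivalent_measures \<rho> circle_lebesgue" if "odd n"
  proof -
    have \<sigma>: "\<sigma> = - 1" using that by (simp add: chi_def power_int_minus_left)
    have "absolutely_continuous circle_lebesgue \<rho>g"
      by (rule odd_case_absolutely_continuous[OF g \<nu> \<sigma>])
    then have "absolutely_continuous circle_lebesgue \<rho>" using null(1) by (auto simp: absolutely_continuous_def)
    \<comment> \<open>The normalised vector \<open>a 1\<close> lies in the space and has Lebesgue
      spectral measure, so maximality puts Lebesgue measure below \<rho>.\<close>
    moreover have "absolutely_continuous \<rho> circle_lebesgue"
    proof (rule max)
      show "is_spectral_measure \<mu> (\<lambda>x. of_real (sqrt (2 ^ Suc 1)) * a 1 x) circle_lebesgue"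
        by (rule odd_lebesgue_vector[OF \<sigma>]) auto
      show "(\<lambda>x. of_real (sqrt (2 ^ Suc 1)) * a 1 x) \<in> H_chi \<alpha> \<mu> \<nu> n"
        unfolding a_def by (rule cyl_in_H_chi[OF \<nu> \<nu>_fin])
    qed
    ultimately show ?thesis unfolding equivalent_measures_def using \<rho>_sets circle_lebesgue_sets by simp
  qed
  moreover have "purely_singular_continuous \<rho>" if "even n" "n \<noteq> 0"
  proof -
    have \<sigma>: "\<sigma> = 1" using that by (simp add: chi_def power_int_minus_left)
    \<comment> \<open>Irrationality enters here: a nonzero power of \<alpha> is never 1.\<close>
    have \<beta>: "\<beta> \<noteq> 1" using cis_power_int_neq_1[OF assms(2) that(2)] by (simp add: chi_def assms(1))
    interpret \<rho>g: finite_measure \<rho>g by (rule spectral_finite[OF gL g(2)])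
    have "emeasure \<rho> {z} = 0" if "z \<in> space \<rho>" for z
    proof (rule zero)
      have z: "z \<in> circle" using that space spectral_space[OF gL g(2)] by simp
      then show "{z} \<in> sets \<rho>g" unfolding sets \<rho>_sets circle_borel_iff by simp
      show "emeasure \<rho>g {z} = 0"
        unfolding \<rho>g.emeasure_eq_measure even_case_no_atoms[OF g \<nu> \<sigma> \<beta> z] by simp
    qed
    moreover obtain N where N: "N \<in> sets \<rho>g" "N \<in> sets circle_lebesgue" "emeasure circle_lebesgue N = 0" "emeasure \<rho>g (space \<rho>g - N) = 0"
      using even_case_singular[OF g \<nu> \<sigma>] unfolding mutually_singular_def by blast
    then have "emeasure \<rho> (space \<rho> - N) = 0" using zero[OF sets.compl_sets[OF N(1)]] space by simp
    then have "mutually_singular \<rho> circle_lebesgue" using N(1-3) sets unfolding mutually_singular_def by blast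
    ultimately show ?thesis unfolding purely_singular_continuous_def by blast
  qed
  ultimately show ?thesis by blast
qed

end
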